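(* Let $c_0(S_n)$, $\widetilde c_0(S_n)$, $c_0(\mathcal T(S_n))$, $c_0(\mathcal O(S_n))$ denote the numbers of connected components of $P_0(S_n)$, $\widetilde P_0(S_n)$, $P_0(\mathcal T(S_n))$, $\mathcal O_0(S_n)$ respectively. Then $c_0(S_n)=\widetilde c_0(S_n)$ and: (i) for $2\le n\le 7$: $c_0(S_n)=1,4,13,31,83,128$; $c_0(\mathcal T(S_n))=1,2,3,3,4,3$; $c_0(\mathcal O(S_n))=1,2,2,2,2,2$ for $n=2,3,4,5,6,7$ respectively; (ii) for $n\ge 8$: if $n$ is prime then $c_0(S_n)=(n-2)!+1$ and $c_0(\mathcal T(S_n))=c_0(\mathcal O(S_n))=2$; if $n=p+1$ with $p$ prime then $c_0(S_n)=n(n-3)!+1$ and $c_0(\mathcal T(S_n))=c_0(\mathcal O(S_n))=2$; if neither $n$ nor $n-1$ is prime then $c_0(S_n)=c_0(\mathcal T(S_n))=c_0(\mathcal O(S_n))=1$.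
   Context: For a finite group $G$, $G_0=G\setminus\{1\}$. $P_0(G)$: vertex set $G_0$, distinct $x,y$ adjacent iff one is a positive power of the other. $\widetilde P_0(G)$: vertex set $\{[x]:x\in G_0\}$ with $[x]=\{y:\langle y\rangle=\langle x\rangle\}$, distinct $[x],[y]$ adjacent iff some representatives are one a positive power of the other. $\mathcal O_0(G)$: vertex set $\{o(g):g\in G_0\}$ (element orders other than $1$), distinct $m,m'$ adjacent iff one divides the other. For $\psi\in S_n$, $T_\psi$ is the partition of $n$ given by the orbit lengths of $\langle\psi\rangle$ on $\{1,\dots,n\}$; for a partition $T=[m_1^{t_1},\dots,m_k^{t_k}]$ and $a\in\mathbb N$, $T^a=[(m_i/\gcd(a,m_i))^{t_i\gcd(a,m_i)}]_{i}$. $P_0(\mathcal T(S_n))$: vertex set the set of partitions of $n$ other than $[1^n]$, distinct $T,T'$ adjacent iff one is a power of the other. *)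

theory Defs
  imports "HOL-Algebra.Sym_Groups" "HOL-Algebra.Multiplicative_Group" "HOL-Library.Multiset" "HOL-Computational_Algebra.Primes"
begin

definition num_components :: "'v set \<Rightarrow> ('v \<Rightarrow> 'v \<Rightarrow> bool) \<Rightarrow> nat" where
  "num_components V E =
     card ((\<lambda>x. {y \<in> V. (\<lambda>a b. a \<in> V \<and> b \<in> V \<and> E a b)\<^sup>*\<^sup>* x y}) ` V)"

definition nonid :: "('a, 'b) monoid_scheme \<Rightarrow> 'a set" where
  "nonid G = carrier G - {\<one>\<^bsub>G\<^esub>}"

definition pos_power :: "('a, 'b) monoid_scheme \<Rightarrow> 'a \<Rightarrow> 'a \<Rightarrow> bool" where
  "pos_power G y x \<longleftrightarrow> (\<exists>k::nat. k > 0 \<and> y = x [^]\<^bsub>G\<^esub> k)"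

definition pg_adj :: "('a, 'b) monoid_scheme \<Rightarrow> 'a \<Rightarrow> 'a \<Rightarrow> bool" where
  "pg_adj G x y \<longleftrightarrow> x \<noteq> y \<and> (pos_power G x y \<or> pos_power G y x)"

definition c0 :: "('a, 'b) monoid_scheme \<Rightarrow> nat" where
  "c0 G = num_components (nonid G) (pg_adj G)"

definition gen_class :: "('a, 'b) monoid_scheme \<Rightarrow> 'a \<Rightarrow> 'a set" where
  "gen_class G x = {y \<in> carrier G. generate G {y} = generate G {x}}"

definition qpg_adj :: "('a, 'b) monoid_scheme \<Rightarrow> 'a set \<Rightarrow> 'a set \<Rightarrow> bool" where
  "qpg_adj G X Y \<longleftrightarrow> X \<noteq> Y \<and>
     (\<exists>x\<in>X. \<exists>y\<in>Y. pos_power G x y \<or> pos_power G y x)"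

definition c0_tilde :: "('a, 'b) monoid_scheme \<Rightarrow> nat" where
  "c0_tilde G = num_components (gen_class G ` nonid G) (qpg_adj G)"

definition ord_adj :: "nat \<Rightarrow> nat \<Rightarrow> bool" where
  "ord_adj m m' \<longleftrightarrow> m \<noteq> m' \<and> (m dvd m' \<or> m' dvd m)"

definition c0_order :: "('a, 'b) monoid_scheme \<Rightarrow> nat" where
  "c0_order G = num_components (group.ord G ` nonid G) ord_adj"

definition partitions :: "nat \<Rightarrow> nat multiset set" where
  "partitions n = {T. (\<forall>m\<in>#T. m > 0) \<and> sum_mset T = n}"

definition part_pow :: "nat multiset \<Rightarrow> nat \<Rightarrow> nat multiset" where
  "part_pow T a = sum_mset (image_mset (\<lambda>m. replicate_mset (gcd a m) (m div gcd a m)) T)"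

definition part_adj :: "nat multiset \<Rightarrow> nat multiset \<Rightarrow> bool" where
  "part_adj T T' \<longleftrightarrow> T \<noteq> T' \<and>
     ((\<exists>a::nat. a > 0 \<and> T' = part_pow T a) \<or> (\<exists>a::nat. a > 0 \<and> T = part_pow T' a))"

definition c0_type :: "nat \<Rightarrow> nat" where
  "c0_type n = num_components (partitions n - {replicate_mset n 1}) part_adj"

end

theory Submission
  imports Defs "HOL-Combinatorics.Multiset_Permutations"
begin

text \<open>
Every vertex of the three graphs is joined to one of prime type: an element of prime order, a prime,
or a partition \<open>[p, \<dots>, p, 1, \<dots>, 1]\<close>. Two elements of prime order are powers of a common
element iff they generate the same subgroup, or commute and have distinct orders; so components of
the power graph can be computed with commuting elements of distinct prime orders.

For \<open>n \<ge> 8\<close> an element of odd prime order with two fixed points commutes with a transposition, an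
involution with few fixed points commutes with an element of type \<open>[3, 3]\<close> permuting three of its
transpositions, and an element of prime order with at least two nontrivial orbits commutes with the
involution exchanging two of them. This joins everything except the \<open>p\<close>-cycles with
\<open>n \<le> p + 1\<close>, whose centralizer is the cyclic group they generate; each such group is a component
of its own. For \<open>n \<le> 7\<close> the same relation is analysed by hand; new components come from involutions
of type \<open>[2, 2]\<close> and from the elements of types \<open>[2, 2, 2]\<close> and \<open>[3, 3]\<close>, which are tied
together by their common support of six points.
\<close>

section \<open>Components and prime order elements\<close>

text \<open>Components are counted by labels: a function on the vertices that is constant along
  edges, and equal only on connected vertices, has as many values as there are components. In the
  power graph and the partition graph a vertex inherits the label of one of its prime type powers.
  Such a power is not unique, and this shapes the hypotheses of \<open>c0_eq_card_labels\<close> and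
  \<open>c0_type_labels\<close>: labels must agree on all prime type powers of one vertex. Inside a
  cyclic group these generate the same subgroup or have distinct prime orders; for partitions no
  elements are at hand, and \<open>p\<close>-adic valuations of the parts take over.

  The bound 8 is 6 + 2: an element of type \<open>[3, 3]\<close> needs two further points to leave
  room for a disjoint transposition. In the formulas for \<open>n \<ge> 8\<close>, each of the
  \<open>n choose p\<close> supports with \<open>p = n\<close> or \<open>p = n - 1\<close> carries
  \<open>fact (p - 2)\<close> groups of \<open>p\<close>-cycles, and the summand 1 is the component
  of the transpositions.\<close>

definition conn :: "'v set \<Rightarrow> ('v \<Rightarrow> 'v \<Rightarrow> bool) \<Rightarrow> 'v \<Rightarrow> 'v \<Rightarrow> bool" where
  "conn V E = (\<lambda>a b. a \<in> V \<and> b \<in> V \<and> E a b)\<^sup>*\<^sup>*"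

lemma conn_refl [simp]: "conn V E x x"
  by (simp add: conn_def)

lemma conn_trans [trans]: "conn V E x y \<Longrightarrow> conn V E y z \<Longrightarrow> conn V E x z"
  by (simp add: conn_def)

lemma conn_step: "x \<in> V \<Longrightarrow> y \<in> V \<Longrightarrow> E x y \<Longrightarrow> conn V E x y"
  by (auto simp: conn_def)

lemma conn_sym:
  assumes "symp E" "conn V E x y"
  shows "conn V E y x"
proof -
  have "symp (\<lambda>a b. a \<in> V \<and> b \<in> V \<and> E a b)"
    using assms(1) by (auto simp: symp_def)
  then show ?thesis
    using assms(2) unfolding conn_def by (meson sympD symp_rtranclp)
qed

lemma conn_invariant:
  assumes "conn V E x y" "\<And>x y. x \<in> V \<Longrightarrow> y \<in> V \<Longrightarrow> E x y \<Longrightarrow> f x = f y"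
  shows "f x = f y"
  using assms(1) unfolding conn_def by (induction) (auto dest: assms(2))

lemma conn_map:
  assumes "conn V E x y" "\<And>x y. x \<in> V \<Longrightarrow> y \<in> V \<Longrightarrow> E x y \<Longrightarrow> conn W F (g x) (g y)"
  shows "conn W F (g x) (g y)"
  using assms(1) unfolding conn_def[of V E]
  by (induction rule: rtranclp_induct) (auto intro: conn_trans assms(2))

text \<open>The fibres of \<open>f\<close> over its values on \<open>V\<close> are nonempty and
  pairwise disjoint, and the two hypotheses make them exactly the components.\<close>

lemma num_components_eq_card:
  assumes sym: "symp E"
    and inv: "\<And>x y. x \<in> V \<Longrightarrow> y \<in> V \<Longrightarrow> E x y \<Longrightarrow> f x = f y"
    and con: "\<And>x y. x \<in> V \<Longrightarrow> y \<in> V \<Longrightarrow> f x = f y \<Longrightarrow> conn V E x y"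
  shows "num_components V E = card (f ` V)"
proof -
  let ?c = "\<lambda>x. {y \<in> V. conn V E x y}"
  have iff: "conn V E x y \<longleftrightarrow> f x = f y" if "x \<in> V" "y \<in> V" for x y
    using con conn_invariant[of V E x y f] inv that by blast
  have "?c ` V = (\<lambda>l. {y \<in> V. l = f y}) ` f ` V"
    unfolding image_image using iff by (intro image_cong) auto
  moreover have "inj_on (\<lambda>l. {y \<in> V. l = f y}) (f ` V)"
    by (rule inj_onI) auto
  ultimately show ?thesis
    by (simp add: num_components_def conn_def card_image)
qed

section \<open>The power graph and its quotient\<close>

lemma symp_pg_adj: "symp (pg_adj G)"
  by (auto simp: symp_def pg_adj_def)

lemma symp_qpg_adj: "symp (qpg_adj G)"
  unfolding symp_def qpg_adj_def by blast

lemma symp_ord_adj: "symp ord_adj"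
  unfolding symp_def ord_adj_def by blast

lemma symp_part_adj: "symp part_adj"
  unfolding symp_def part_adj_def by blast

abbreviation pconn :: "('a, 'b) monoid_scheme \<Rightarrow> 'a \<Rightarrow> 'a \<Rightarrow> bool" where
  "pconn G \<equiv> conn (nonid G) (pg_adj G)"

lemma pconn_sym: "pconn G x y \<Longrightarrow> pconn G y x"
  using conn_sym[OF symp_pg_adj] .

lemma pconn_pos_power:
  assumes "x \<in> nonid G" "y \<in> nonid G" "pos_power G y x"
  shows "pconn G x y"
  using assms by (cases "x = y") (auto intro!: conn_step simp: pg_adj_def)

context group
begin

lemma pos_power_if_generate_eq:
  assumes "finite (carrier G)" "x \<in> carrier G" "y \<in> carrier G" "generate G {x} = generate G {y}"
  shows "pos_power G y x"
proof -
  have "y \<in> generate G {x}"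
    using assms(4) by (auto intro: generate.incl)
  then obtain k :: nat where k: "y = x [^] k"
    using generate_pow_nat[OF assms(2)] ord_ge_1[OF assms(1,2)]
    by fastforce
  \<comment> \<open>Adding \<open>ord x\<close> leaves the power unchanged and makes the exponent
    positive, which \<open>pos_power\<close> demands.\<close>
  then have "y = x [^] (k + ord x)"
    using assms(2) by (simp add: nat_pow_mult[symmetric])
  then show ?thesis
    using ord_ge_1[OF assms(1,2)] unfolding pos_power_def
    by (metis add_gr_0 less_le_trans zero_less_one)
qed

text \<open>Generators of the same cyclic group are positive powers of each other, so a class lies
  inside one component of the power graph. Passing to the quotient contracts connected pieces
  only.\<close>

lemma c0_tilde_eq_c0:
  assumes fin: "finite (carrier G)"
  shows "c0_tilde G = c0 G"
proof -
  let ?V = "gen_class G ` nonid G"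
  define comp where "comp x = {y \<in> nonid G. pconn G x y}" for x
  have comp_eq: "comp x = comp y \<longleftrightarrow> pconn G x y" if "x \<in> nonid G" "y \<in> nonid G" for x y
    using that unfolding comp_def by (auto intro: conn_trans pconn_sym)
  \<comment> \<open>A class is labelled by the component of a chosen representative; the choice is
    harmless because its elements are all connected.\<close>
  define F where "F X = comp (SOME x. x \<in> nonid G \<and> X = gen_class G x)" for X
  have same: "pconn G x y" if "x \<in> nonid G" "y \<in> nonid G" "generate G {x} = generate G {y}" for x y
    using that pos_power_if_generate_eq[OF fin] by (intro pconn_pos_power) (auto simp: nonid_def)
  have gc: "gen_class G x = gen_class G y \<longleftrightarrow> generate G {x} = generate G {y}"
    if "x \<in> nonid G" "y \<in> nonid G" for x y
    using that unfolding gen_class_def nonid_def by auto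
  have F: "F (gen_class G x) = comp x" if "x \<in> nonid G" for x
  proof -
    let ?y = "SOME y. y \<in> nonid G \<and> gen_class G x = gen_class G y"
    have y: "?y \<in> nonid G \<and> gen_class G x = gen_class G ?y"
      by (rule someI[of _ x]) (use that in auto)
    then have "pconn G x ?y"
      using same gc that by blast
    then show ?thesis
      unfolding F_def using comp_eq that y by blast
  qed
  \<comment> \<open>\<open>gen_class\<close> ranges over the whole carrier, so the representatives
    witnessing an edge must first be seen to be vertices: they generate a nontrivial group.\<close>
  have mem: "z \<in> nonid G \<and> pconn G x z" if "x \<in> nonid G" "z \<in> gen_class G x" for x z
  proof -
    have z: "z \<in> carrier G" "generate G {z} = generate G {x}" using that by (auto simp: gen_class_def)
    have "z \<noteq> \<one>"
    proof
      assume "z = \<one>"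
      then have "generate G {x} = {\<one>}" using z by (simp add: generate_one)
      then have "x = \<one>" using generate.incl[of x "{x}" G] by simp
      then show False using that by (simp add: nonid_def)
    qed
    then show ?thesis using same z that by (auto simp: nonid_def)
  qed
  have "num_components ?V (qpg_adj G) = card (F ` ?V)"
  proof (rule num_components_eq_card[OF symp_qpg_adj])
    fix X Y assume "X \<in> ?V" "Y \<in> ?V" and adj: "qpg_adj G X Y"
    then obtain x y where x: "x \<in> nonid G" "X = gen_class G x" and y: "y \<in> nonid G" "Y = gen_class G y"
      by auto
    obtain x' y' where xy': "x' \<in> X" "y' \<in> Y" "pos_power G x' y' \<or> pos_power G y' x'"
      using adj by (auto simp: qpg_adj_def)
    then have "pconn G x' y'"
      using mem x y pconn_pos_power pconn_sym by metis
    then have "pconn G x y"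
      using mem x y xy' by (metis conn_trans pconn_sym)
    then show "F X = F Y" using F x y comp_eq by simp
  next
    fix X Y assume "X \<in> ?V" "Y \<in> ?V" and eq: "F X = F Y"
    then obtain x y where x: "x \<in> nonid G" "X = gen_class G x" and y: "y \<in> nonid G" "Y = gen_class G y"
      by auto
    have "pconn G x y" using x y eq F comp_eq by simp
    then have "conn ?V (qpg_adj G) (gen_class G x) (gen_class G y)"
    proof (rule conn_map)
      fix a b assume ab: "a \<in> nonid G" "b \<in> nonid G" "pg_adj G a b"
      have "a \<in> gen_class G a" "b \<in> gen_class G b" using ab by (auto simp: gen_class_def nonid_def)
      then have "qpg_adj G (gen_class G a) (gen_class G b)" if "gen_class G a \<noteq> gen_class G b"
        using that ab unfolding qpg_adj_def pg_adj_def by blast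
      then show "conn ?V (qpg_adj G) (gen_class G a) (gen_class G b)"
        using ab by (cases "gen_class G a = gen_class G b") (auto intro: conn_step)
    qed
    then show "conn ?V (qpg_adj G) X Y" using x y by simp
  qed
  also have "F ` ?V = comp ` nonid G"
    unfolding image_image by (rule image_cong) (auto simp: F)
  also have "card \<dots> = c0 G"
    unfolding c0_def num_components_def comp_def conn_def ..
  finally show ?thesis by (simp add: c0_tilde_def)
qed

section \<open>Elements of prime order\<close>

definition prime_elts :: "'a set" where
  "prime_elts = {x \<in> carrier G. prime (ord x)}"

lemma prime_elts_nonid: "x \<in> prime_elts \<Longrightarrow> x \<in> nonid G"
  unfolding prime_elts_def nonid_def by auto

lemma pow_prime_elt:
  assumes "x \<in> carrier G" "prime p" "p dvd ord x" "ord x \<noteq> 0"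
  shows "x [^] (ord x div p) \<in> prime_elts" "ord (x [^] (ord x div p)) = p"
proof -
  show "ord (x [^] (ord x div p)) = p"
    using assms ord_pow[of x "ord x div p"] by (auto elim!: dvdE)
  then show "x [^] (ord x div p) \<in> prime_elts"
    using assms by (simp add: prime_elts_def)
qed

lemma generate_pow_subset:
  assumes "x \<in> carrier G"
  shows "generate G {x [^] (k::nat)} \<subseteq> generate G {x}"
proof -
  interpret H: subgroup "generate G {x}" G
    using assms by (intro generate_is_subgroup) auto
  have "x \<in> generate G {x}" by (simp add: generate.incl)
  then have "x [^] k \<in> generate G {x}"
    by (induction k) (auto simp: H.m_closed)
  then show ?thesis
    using H.subgroup_axioms by (intro generate_subgroup_incl) auto
qed

text \<open>An exponent that the prime \<open>ord x\<close> does not divide is invertible modulo it,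
  so \<open>x\<close> is in turn a power of \<open>x [^] k\<close>.\<close>

lemma generate_eq_of_pow_prime:
  assumes x: "x \<in> carrier G" and p: "prime (ord x)" and k: "x [^] (k::nat) \<noteq> \<one>"
  shows "generate G {x [^] k} = generate G {x}"
proof -
  have "\<not> ord x dvd k" using k pow_eq_id[OF x] by simp
  then have "coprime k (ord x)"
    using p by (metis prime_imp_coprime coprime_commute)
  then obtain i j where ij: "k * i = ord x * j + 1"
    using p coprime_bezout_strong[of k "ord x"] not_prime_1 by metis
  have "(x [^] k) [^] i = x [^] (ord x * j + 1)"
    using x ij by (simp add: nat_pow_pow)
  also have "\<dots> = x"
    using x by (simp add: nat_pow_mult[symmetric] nat_pow_pow[symmetric])
  finally have "generate G {x} \<subseteq> generate G {x [^] k}"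
    using generate_pow_subset[of "x [^] k" i] x by simp
  then show ?thesis
    using generate_pow_subset[OF x] by blast
qed

lemma pconn_if_generate_eq:
  assumes "finite (carrier G)" "x \<in> nonid G" "y \<in> nonid G" "generate G {x} = generate G {y}"
  shows "pconn G x y"
  using assms pos_power_if_generate_eq by (intro pconn_pos_power) (auto simp: nonid_def)

lemma pconn_pow:
  assumes "x \<in> nonid G" "x [^] (k::nat) \<noteq> \<one>"
  shows "pconn G x (x [^] k)"
proof (rule pconn_pos_power)
  have "k > 0" using assms by (cases k) auto
  then show "pos_power G (x [^] k) x" by (auto simp: pos_power_def)
qed (use assms in \<open>auto simp: nonid_def\<close>)

text \<open>As the factors commute, the exponent \<open>ord y\<close> removes \<open>y\<close> from
  the product. What is left is a power of \<open>x\<close>, nontrivial because distinct primes do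
  not divide each other.\<close>

lemma ord_mult_coprime_pow:
  assumes "x \<in> carrier G" "y \<in> carrier G" "x \<otimes> y = y \<otimes> x"
    and "prime (ord x)" "prime (ord y)" "ord x \<noteq> ord y"
  shows "(x \<otimes> y) [^] ord y \<noteq> \<one>" "generate G {(x \<otimes> y) [^] ord y} = generate G {x}"
proof -
  have eq: "(x \<otimes> y) [^] ord y = x [^] ord y"
    using assms by (simp add: pow_mult_distrib)
  have "\<not> ord x dvd ord y"
    using assms primes_dvd_imp_eq by blast
  then have "x [^] ord y \<noteq> \<one>"
    using assms(1) by (simp add: pow_eq_id)
  then show "(x \<otimes> y) [^] ord y \<noteq> \<one>" "generate G {(x \<otimes> y) [^] ord y} = generate G {x}"
    unfolding eq using assms generate_eq_of_pow_prime[of x "ord y"] by auto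
qed

text \<open>The product of \<open>x\<close> and \<open>y\<close> is a common root, up to the choice
  of generators of the two cyclic groups.\<close>

lemma pconn_commute:
  assumes fin: "finite (carrier G)" and x: "x \<in> carrier G" and y: "y \<in> carrier G"
    and comm: "x \<otimes> y = y \<otimes> x"
    and p: "prime (ord x)" "prime (ord y)" "ord x \<noteq> ord y"
  shows "pconn G x y"
proof -
  let ?z = "x \<otimes> y"
  note a = ord_mult_coprime_pow[OF x y comm p]
  note b = ord_mult_coprime_pow[OF y x comm[symmetric] p(2,1) p(3)[symmetric], folded comm]
  have nz: "?z \<in> nonid G"
    using a(1) x y by (auto simp: nonid_def)
  have xy: "x \<in> nonid G" "y \<in> nonid G"
    using x y p by (auto simp: nonid_def)
  have "pconn G ?z x"
    using pconn_pow[OF nz a(1)] a nz xy x y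
    by (intro conn_trans[OF pconn_pow[OF nz a(1)]] pconn_if_generate_eq fin) (auto simp: nonid_def)
  moreover have "pconn G ?z y"
    using pconn_pow[OF nz b(1)] b nz xy x y
    by (intro conn_trans[OF pconn_pow[OF nz b(1)]] pconn_if_generate_eq fin) (auto simp: nonid_def)
  ultimately show ?thesis
    by (blast intro: conn_trans pconn_sym)
qed

text \<open>A finite cyclic group has only one subgroup of order \<open>p\<close>; both powers of
  \<open>z\<close> are compared with its standard generator
  \<open>z [^] (ord z div p)\<close>.\<close>

lemma generate_eq_of_powers_same_prime_ord:
  assumes z: "z \<in> carrier G" and "ord z \<noteq> 0"
    and p: "prime p" "ord (z [^] (i::nat)) = p" "ord (z [^] (j::nat)) = p"
  shows "generate G {z [^] i} = generate G {z [^] j}"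
proof -
  have *: "p dvd ord z \<and> generate G {z [^] k} = generate G {z [^] (ord z div p)}" if "ord (z [^] k) = p" for k :: nat
  proof -
    define w where "w = z [^] (ord z div p)"
    have "(z [^] k) [^] ord z = \<one>"
      using z by (simp add: nat_pow_pow mult.commute[of k]) (simp add: nat_pow_pow[symmetric])
    then have pd: "p dvd ord z" using that z pow_eq_id[of "z [^] k" "ord z"] by simp
    have "(z [^] k) [^] p = \<one>" using that z pow_eq_id[of "z [^] k" p] by simp
    then have "ord z dvd k * p" using z by (simp add: nat_pow_pow pow_eq_id)
    then have "ord z div p dvd k"
      using pd p(1) prime_gt_0_nat[OF p(1)] by (auto elim!: dvdE simp: mult.commute[of p])
    then obtain l where "k = (ord z div p) * l" by (auto elim: dvdE)
    then have zk: "z [^] k = w [^] l" using z by (simp add: nat_pow_pow w_def)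
    have w: "w \<in> carrier G" "ord w = p"
      using pow_prime_elt[OF z p(1) pd assms(2)] z by (simp_all add: w_def)
    have "z [^] k \<noteq> \<one>"
    proof
      assume "z [^] k = \<one>"
      with \<open>ord (z [^] k) = p\<close> have "p = 1" by simp
      then show False using p(1) by simp
    qed
    then have "generate G {w [^] l} = generate G {w}"
      using generate_eq_of_pow_prime[of w l] w p zk by simp
    then show ?thesis using pd zk by (simp add: w_def)
  qed
  show ?thesis using *[OF p(2)] *[OF p(3)] by simp
qed

lemma ord_nz: "finite (carrier G) \<Longrightarrow> x \<in> carrier G \<Longrightarrow> ord x \<noteq> 0"
  using ord_ge_1[of x] by linarith

text \<open>A vertex takes the label of any of its powers of prime order. Two such powers commute;
  they have distinct orders, or the same order and then the same generated subgroup. So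
  \<open>com\<close> and \<open>gen\<close> are what makes the label independent of the
  choice.\<close>

lemma c0_eq_card_labels:
  fixes f :: "'a \<Rightarrow> 'l"
  assumes fin: "finite (carrier G)"
    and gen: "\<And>x y. x \<in> prime_elts \<Longrightarrow> y \<in> prime_elts \<Longrightarrow> generate G {x} = generate G {y} \<Longrightarrow> f x = f y"
    and com: "\<And>x y. x \<in> prime_elts \<Longrightarrow> y \<in> prime_elts \<Longrightarrow> x \<otimes> y = y \<otimes> x \<Longrightarrow> ord x \<noteq> ord y \<Longrightarrow> f x = f y"
    and con: "\<And>x y. x \<in> prime_elts \<Longrightarrow> y \<in> prime_elts \<Longrightarrow> f x = f y \<Longrightarrow> pconn G x y"
  shows "c0 G = card (f ` prime_elts)"
proof -
  define P where "P z x \<longleftrightarrow> x \<in> prime_elts \<and> (\<exists>k::nat. x = z [^] k)" for z x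
  define F where "F z = f (SOME x. P z x)" for z
  have ex: "\<exists>x. P z x" if z: "z \<in> nonid G" for z
  proof -
    have "ord z \<noteq> 1" "z \<in> carrier G" using z by (auto simp: nonid_def) (use ord_eq_1 in auto)
    moreover then obtain p where "prime p" "p dvd ord z" using prime_factor_nat by blast
    ultimately show ?thesis using pow_prime_elt[of z p] ord_nz[OF fin] unfolding P_def by blast
  qed
  have uniq: "f x = f y" if zxy: "z \<in> nonid G" "P z x" "P z y" for x y z
  proof -
    obtain i j :: nat where ij: "x = z [^] i" "y = z [^] j" "x \<in> prime_elts" "y \<in> prime_elts"
      using zxy unfolding P_def by blast
    have z: "z \<in> carrier G" using that by (simp add: nonid_def)
    show ?thesis
    proof (cases "ord x = ord y")
      case True
      have p: "prime (ord x)" using ij(3) by (simp add: prime_elts_def)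
      have "generate G {x} = generate G {y}"
        unfolding ij(1,2)
        by (rule generate_eq_of_powers_same_prime_ord[OF z ord_nz[OF fin z] p])
          (simp_all only: ij(1,2)[symmetric] True)
      then show ?thesis by (rule gen[OF ij(3,4)])
    next
      case False
      have "x \<otimes> y = y \<otimes> x" using ij z by (simp add: nat_pow_mult add.commute)
      then show ?thesis using com False ij by blast
    qed
  qed
  have F: "F z = f x" if "z \<in> nonid G" "P z x" for z x
    unfolding F_def using uniq[OF that(1)] someI[of "P z" x] that(2) by blast
  have self: "P x x" if "x \<in> prime_elts" for x
    unfolding P_def using that by (metis nat_pow_eone mem_Collect_eq prime_elts_def)
  have Pc: "pconn G z x" if "z \<in> nonid G" "P z x" for z x
  proof -
    obtain k :: nat where "x = z [^] k" using \<open>P z x\<close> by (auto simp: P_def)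
    moreover have "x \<noteq> \<one>" using prime_elts_nonid[of x] \<open>P z x\<close> by (auto simp: P_def nonid_def)
    ultimately show ?thesis using pconn_pow[OF that(1), of k] by simp
  qed
  have "num_components (nonid G) (pg_adj G) = card (F ` nonid G)"
  proof (rule num_components_eq_card[OF symp_pg_adj])
    have *: "F x = F y" if h: "x \<in> nonid G" "y \<in> nonid G" "pos_power G y x" for x y
    proof -
      \<comment> \<open>A power of \<open>y\<close> of prime order is also a power of
        \<open>x\<close>, so one element supplies the label at both ends of the edge.\<close>
      obtain w where w: "P y w" using ex h(2) by blast
      obtain k :: nat where "y = x [^] k" using h(3) by (auto simp: pos_power_def)
      then have "P x w" using w h(1) by (auto simp: P_def nat_pow_pow nonid_def)
      then show ?thesis using F[OF h(1), of w] F[OF h(2) w] by simp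
    qed
    fix x y assume "x \<in> nonid G" "y \<in> nonid G" "pg_adj G x y"
    then show "F x = F y" using *[of x y] *[of y x] by (auto simp: pg_adj_def)
  next
    fix x y assume xy: "x \<in> nonid G" "y \<in> nonid G" and eq: "F x = F y"
    obtain a b where ab: "P x a" "P y b" using ex xy by blast
    then have "f a = f b" using F[OF xy(1) ab(1)] F[OF xy(2) ab(2)] eq by simp
    then have "pconn G a b" using con ab by (simp add: P_def)
    then show "pconn G x y" using Pc[OF xy(1) ab(1)] Pc[OF xy(2) ab(2)] by (blast intro: conn_trans pconn_sym)
  qed
  also have "F ` nonid G = f ` prime_elts"
  proof (intro equalityI subsetI)
    fix l assume "l \<in> F ` nonid G"
    then obtain z x where "z \<in> nonid G" "l = F z" "P z x" using ex by blast
    then show "l \<in> f ` prime_elts" using F by (auto simp: P_def)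
  next
    fix l assume "l \<in> f ` prime_elts"
    then obtain x where "x \<in> prime_elts" "l = f x" by blast
    then show "l \<in> F ` nonid G" using F[OF prime_elts_nonid self] by (metis image_eqI prime_elts_nonid)
  qed
  finally show ?thesis by (simp add: c0_def)
qed

end

section \<open>Permutations of prime order\<close>

lemma sym_group_pow: "x [^]\<^bsub>sym_group n\<^esub> (k::nat) = x ^^ k"
  by (induction k) (simp_all add: sym_group_one sym_group_mult nat_pow_def funpow_Suc_right[symmetric] del: funpow.simps)

lemma finite_sym_group: "finite (carrier (sym_group n))"
  by (simp add: sym_group_def finite_permutations)

text \<open>Order exactly \<open>p\<close>, encoded by iteration instead of
  \<open>group.ord\<close>, so that arguments about points and orbits need no group
  structure.\<close>

definition prime_perm :: "nat \<Rightarrow> nat \<Rightarrow> (nat \<Rightarrow> nat) \<Rightarrow> bool" where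
  "prime_perm n p x \<longleftrightarrow> x permutes {1..n} \<and> prime p \<and> x ^^ p = id \<and> x \<noteq> id"

lemma prime_perm_ord: "prime_perm n p x \<Longrightarrow> group.ord (sym_group n) x = p"
proof -
  assume a: "prime_perm n p x"
  interpret group "sym_group n" by (rule sym_group_is_group)
  have x: "x \<in> carrier (sym_group n)" using a by (simp add: prime_perm_def sym_group_carrier)
  have "x [^]\<^bsub>sym_group n\<^esub> p = \<one>\<^bsub>sym_group n\<^esub>"
    using a by (simp only: sym_group_pow sym_group_one prime_perm_def)
  then have "ord x dvd p" using pow_eq_id[OF x] by simp
  moreover have "ord x \<noteq> 1" using ord_eq_1[OF x] a by (simp add: prime_perm_def sym_group_one)
  moreover have "prime p" using a by (simp add: prime_perm_def)
  ultimately show "ord x = p" by (auto simp: prime_nat_iff)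
qed

lemma prime_elts_sym_group_iff:
  "x \<in> group.prime_elts (sym_group n) \<longleftrightarrow> (\<exists>p. prime_perm n p x)"
proof -
  interpret group "sym_group n" by (rule sym_group_is_group)
  have "prime_perm n (ord x) x" if "x \<in> prime_elts"
  proof -
    have x: "x \<in> carrier (sym_group n)" "prime (ord x)"
      using that by (simp_all add: prime_elts_def)
    have "x ^^ ord x = id"
      using pow_ord_eq_1[OF x(1)] by (simp only: sym_group_pow sym_group_one)
    moreover have "x \<noteq> id"
      using x(2) ord_eq_1[OF x(1)] not_prime_1 by (metis sym_group_one)
    ultimately show ?thesis
      using x by (simp add: prime_perm_def sym_group_carrier)
  qed
  moreover have "x \<in> prime_elts" if "prime_perm n p x" for p
    using prime_perm_ord[OF that] that by (simp add: prime_elts_def prime_perm_def sym_group_carrier)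
  ultimately show ?thesis by blast
qed

lemma prime_perm_unique: "prime_perm n p x \<Longrightarrow> prime_perm n q x \<Longrightarrow> p = q"
  using prime_perm_ord by blast

lemma prime_perm_nonid: "prime_perm n p x \<Longrightarrow> x \<in> nonid (sym_group n)"
  by (simp add: nonid_def prime_perm_def sym_group_carrier sym_group_one)

abbreviation sconn :: "nat \<Rightarrow> (nat \<Rightarrow> nat) \<Rightarrow> (nat \<Rightarrow> nat) \<Rightarrow> bool" where
  "sconn n \<equiv> pconn (sym_group n)"

lemma sconn_commute:
  assumes "prime_perm n p x" "prime_perm n q y" "p \<noteq> q" "x \<circ> y = y \<circ> x"
  shows "sconn n x y"
proof (rule group.pconn_commute[OF sym_group_is_group finite_sym_group])
  show "x \<in> carrier (sym_group n)" "y \<in> carrier (sym_group n)"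
    using assms by (simp_all add: prime_perm_def sym_group_carrier)
  show "x \<otimes>\<^bsub>sym_group n\<^esub> y = y \<otimes>\<^bsub>sym_group n\<^esub> x"
    using assms by (simp add: sym_group_mult)
  show "prime (group.ord (sym_group n) x)" "prime (group.ord (sym_group n) y)"
    "group.ord (sym_group n) x \<noteq> group.ord (sym_group n) y"
    using assms prime_perm_ord by (auto simp: prime_perm_def)
qed

lemma sconn_generate:
  assumes "prime_perm n p x" "prime_perm n q y" "generate (sym_group n) {x} = generate (sym_group n) {y}"
  shows "sconn n x y"
  using assms by (intro group.pconn_if_generate_eq sym_group_is_group finite_sym_group prime_perm_nonid)

section \<open>Supports, orbits and commuting permutations\<close>

definition moved :: "('a \<Rightarrow> 'a) \<Rightarrow> 'a set" where
  "moved x = {a. x a \<noteq> a}"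

text \<open>Forward iterates suffice: for a permutation of finite order the inverse is among
  them.\<close>

definition orb :: "('a \<Rightarrow> 'a) \<Rightarrow> 'a \<Rightarrow> 'a set" where
  "orb x a = range (\<lambda>i::nat. (x ^^ i) a)"

lemma in_moved_iff: "a \<in> moved x \<longleftrightarrow> x a \<noteq> a"
  by (simp add: moved_def)

lemma funpow_in_orb [intro]: "(x ^^ i) a \<in> orb x a"
  by (simp add: orb_def)

lemma self_in_orb [intro, simp]: "a \<in> orb x a"
  using funpow_in_orb[of 0] by simp

lemma orbE: assumes "b \<in> orb x a" obtains i where "b = (x ^^ i) a"
  using assms by (auto simp: orb_def)

lemma funpow_commute_perm:
  fixes x y :: "'a \<Rightarrow> 'a"
  assumes "x \<circ> y = y \<circ> x"
  shows "x ((y ^^ i) a) = (y ^^ i) (x a)"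
proof (induction i)
  case (Suc i)
  then show ?case using fun_cong[OF assms, of "(y ^^ i) a"] by simp
qed simp

lemma fixes_orb_if_commute:
  assumes "x \<circ> y = y \<circ> x" "x a = a" "b \<in> orb y a"
  shows "x b = b"
  using assms(3) by (rule orbE) (simp add: funpow_commute_perm[OF assms(1)] assms(2))

lemma moved_closed_if_commute:
  assumes "x \<circ> y = y \<circ> x" "inj x" "a \<in> moved y"
  shows "x a \<in> moved y"
proof -
  have "y (x a) = x (y a)" using fun_cong[OF assms(1), of a] by simp
  then show ?thesis using assms(2,3) by (simp add: moved_def inj_eq)
qed

lemma commute_if_moved_disjoint:
  assumes "moved x \<inter> moved y = {}" "inj x" "inj y"
  shows "x \<circ> y = y \<circ> x"
proof
  fix a
  have *: "u (v a) = v (u a)" if "moved u \<inter> moved v = {}" "inj u" "a \<in> moved u" for u v :: "'a \<Rightarrow> 'a"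
  proof -
    have "u a \<in> moved u" using that by (simp add: moved_def inj_eq)
    then have "v (u a) = u a" "v a = a" using that by (auto simp: moved_def)
    then show ?thesis by simp
  qed
  show "(x \<circ> y) a = (y \<circ> x) a"
    using *[of x y] *[of y x] assms
    by (cases "a \<in> moved x"; cases "a \<in> moved y") (auto simp: in_moved_iff Int_commute)
qed

context
  fixes n p x
  assumes pp: "prime_perm n p x"
begin

lemma prime_perm_permutes: "x permutes {1..n}" using pp by (simp add: prime_perm_def)
lemma prime_perm_prime: "prime p" using pp by (simp add: prime_perm_def)
lemma prime_perm_inj: "inj x" using prime_perm_permutes by (rule permutes_inj)
lemma prime_perm_funpow: "(x ^^ p) a = a" using pp by (simp add: prime_perm_def)

lemma moved_subset: "moved x \<subseteq> {1..n}"
  using prime_perm_permutes by (auto simp: moved_def permutes_def)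

lemma finite_moved: "finite (moved x)"
  using moved_subset finite_subset by blast

lemma card_moved_le: "card (moved x) \<le> n"
  using card_mono[OF _ moved_subset] by simp

lemma moved_nonempty: "\<exists>a. a \<in> moved x"
  using pp unfolding prime_perm_def moved_def by (auto simp: fun_eq_iff)

lemma prime_perm_permutation: "permutation x"
  using prime_perm_permutes permutation_permutes by blast

text \<open>The cycle length \<open>least_power x a\<close> divides the prime \<open>p\<close> and
  is not 1 at a moved point, so it equals \<open>p\<close>.\<close>

lemma funpow_fixes_iff:
  assumes "a \<in> moved x"
  shows "(x ^^ i) a = a \<longleftrightarrow> p dvd i"
proof -
  have "least_power x a dvd p"
    using least_power_dvd[OF prime_perm_permutation] prime_perm_funpow by blast
  moreover have "least_power x a \<noteq> 1"
    using least_power_gt_one[OF prime_perm_permutation, of a] assms by (simp add: moved_def)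
  ultimately have "least_power x a = p"
    using prime_perm_prime by (auto simp: prime_nat_iff)
  then show ?thesis
    using least_power_dvd[OF prime_perm_permutation, of a i] by simp
qed

lemma funpow_mod: "(x ^^ i) a = (x ^^ (i mod p)) a"
proof -
  have "(x ^^ (p * k)) b = b" for k b
    using pp by (simp add: funpow_mult[symmetric] prime_perm_def)
  then show ?thesis
    by (metis comp_apply funpow_add mod_mult_div_eq)
qed

lemma funpow_inj_on: "a \<in> moved x \<Longrightarrow> inj_on (\<lambda>i. (x ^^ i) a) {..<p}"
proof (rule linorder_inj_onI)
  fix i j :: nat
  assume a: "a \<in> moved x" "i \<in> {..<p}" "j \<in> {..<p}" "i < j"
  show "(x ^^ i) a \<noteq> (x ^^ j) a"
  proof
    assume "(x ^^ i) a = (x ^^ j) a"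
    then have "(x ^^ (j - i)) a = a"
      using funpow_diff[OF prime_perm_inj] a by simp
    then show False using funpow_fixes_iff[OF a(1)] a by (auto dest: dvd_imp_le)
  qed
qed auto

lemma orb_eq_image: "orb x a = (\<lambda>i. (x ^^ i) a) ` {..<p}"
proof -
  have "(x ^^ i) a \<in> (\<lambda>i. (x ^^ i) a) ` {..<p}" for i
    using funpow_mod[of i a] prime_gt_0_nat[OF prime_perm_prime] by (metis imageI lessThan_iff mod_less_divisor)
  then show ?thesis by (auto simp: orb_def)
qed

lemma card_orb: "a \<in> moved x \<Longrightarrow> card (orb x a) = p"
  by (simp add: orb_eq_image card_image funpow_inj_on)

lemma funpow_in_moved: "a \<in> moved x \<Longrightarrow> (x ^^ i) a \<in> moved x"
  by (induction i) (use prime_perm_inj in \<open>auto simp: moved_def inj_eq\<close>)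

lemma orb_subset_moved: "a \<in> moved x \<Longrightarrow> orb x a \<subseteq> moved x"
  using funpow_in_moved by (auto elim: orbE)

lemma orb_sym: assumes "b \<in> orb x a" shows "a \<in> orb x b"
proof -
  obtain i where b: "b = (x ^^ i) a" using assms by (rule orbE)
  have "i \<le> p * i" using prime_gt_0_nat[OF prime_perm_prime] by simp
  then have "(x ^^ (p * i - i)) b = (x ^^ (p * i)) a"
    unfolding b by (metis comp_apply funpow_add le_add_diff_inverse2)
  also have "\<dots> = a" using funpow_mod[of "p * i" a] by simp
  finally show ?thesis by (metis funpow_in_orb)
qed

lemma orb_trans: "b \<in> orb x a \<Longrightarrow> c \<in> orb x b \<Longrightarrow> c \<in> orb x a"
  by (metis comp_apply funpow_add funpow_in_orb orbE)

lemma orb_eq: "b \<in> orb x a \<Longrightarrow> orb x b = orb x a"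
  using orb_sym orb_trans by blast

lemma orb_disjoint: "b \<notin> orb x a \<Longrightarrow> orb x a \<inter> orb x b = {}"
  using orb_sym orb_trans by blast

text \<open>The support is a disjoint union of orbits of size \<open>p\<close>.\<close>

lemma dvd_card_moved: "p dvd card (moved x)"
proof -
  have "\<Union> (orb x ` moved x) = moved x" using orb_subset_moved by auto
  moreover have "p dvd card (\<Union> (orb x ` moved x))"
  proof (rule dvd_partition)
    show "finite (\<Union> (orb x ` moved x))" using finite_moved calculation by simp
    show "\<forall>c\<in>orb x ` moved x. p dvd card c" using card_orb by simp
    show "\<forall>c1\<in>orb x ` moved x. \<forall>c2\<in>orb x ` moved x. c1 \<noteq> c2 \<longrightarrow> c1 \<inter> c2 = {}"
      using orb_eq orb_disjoint by blast
  qed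
  ultimately show ?thesis by simp
qed

lemma moved_eq_orb:
  assumes "card (moved x) = p" "a \<in> moved x"
  shows "moved x = orb x a"
  using card_subset_eq[OF finite_moved orb_subset_moved[OF assms(2)]] card_orb assms by simp

lemma card_moved_pos: "card (moved x) > 0"
  using moved_nonempty finite_moved by (auto simp: card_gt_0_iff)

lemma card_moved_ge: "p \<le> card (moved x)"
  using dvd_card_moved card_moved_pos by (simp add: dvd_imp_le)

lemma exists_second_orb:
  assumes "card (moved x) > p" "a \<in> moved x"
  obtains b where "b \<in> moved x" "b \<notin> orb x a"
proof -
  have "\<not> moved x \<subseteq> orb x a"
    using assms card_orb[OF assms(2)] card_mono[of "orb x a" "moved x"] orb_eq_image[of a] by auto
  then show ?thesis using that by blast
qed

text \<open>Commuting with \<open>x\<close> propagates the value at \<open>a\<close> along the whole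
  orbit.\<close>

lemma eq_funpow_on_orb_if_commute:
  assumes "y \<circ> x = x \<circ> y" "y a = (x ^^ i) a" "b \<in> orb x a"
  shows "y b = (x ^^ i) b"
proof -
  obtain j where b: "b = (x ^^ j) a" using assms(3) by (rule orbE)
  have "y b = (x ^^ j) ((x ^^ i) a)" using funpow_commute_perm[OF assms(1)] b assms(2) by simp
  also have "\<dots> = (x ^^ i) b" unfolding b by (metis add.commute comp_apply funpow_add)
  finally show ?thesis .
qed

text \<open>On the orbit, \<open>y\<close> acts as some power \<open>x ^^ i\<close>. Then
  \<open>y ^^ q = id\<close> gives \<open>p dvd i * q\<close>, hence \<open>p dvd i\<close> because
  \<open>q\<close> is another prime, and the action is trivial.\<close>

lemma fixes_orb_if_coprime:
  assumes y: "prime_perm n q y" "q \<noteq> p" "y \<circ> x = x \<circ> y"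
    and a: "a \<in> moved x" "y a \<in> orb x a" and b: "b \<in> orb x a"
  shows "y b = b"
proof -
  obtain i where i: "y a = (x ^^ i) a" using a(2) by (rule orbE)
  have pw: "(y ^^ k) a = (x ^^ (i * k)) a" for k
  proof (induction k)
    case (Suc k)
    have "(y ^^ Suc k) a = y ((x ^^ (i * k)) a)" using Suc by simp
    also have "\<dots> = (x ^^ i) ((x ^^ (i * k)) a)"
      by (rule eq_funpow_on_orb_if_commute[OF y(3) i funpow_in_orb])
    finally show ?case by (simp add: funpow_add)
  qed simp
  have "(x ^^ (i * q)) a = a" unfolding pw[symmetric] using y(1) by (simp add: prime_perm_def)
  then have "p dvd i * q" using funpow_fixes_iff[OF a(1)] by simp
  moreover have "\<not> p dvd q" using y prime_perm_prime primes_dvd_imp_eq by (auto simp: prime_perm_def)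
  ultimately have "p dvd i" using prime_perm_prime by (simp add: prime_dvd_mult_iff)
  then have "y a = a" using funpow_fixes_iff[OF a(1)] i by simp
  then show ?thesis using fixes_orb_if_commute[OF y(3) _ b] by simp
qed

lemma moved_disjoint_if_coprime_cycle:
  assumes y: "prime_perm n q y" "q \<noteq> p" "y \<circ> x = x \<circ> y" and c: "card (moved x) = p"
  shows "moved x \<inter> moved y = {}"
proof -
  obtain a where a: "a \<in> moved x" using moved_nonempty by blast
  have "inj y" using y(1) by (auto simp: prime_perm_def intro: permutes_inj)
  then have "y a \<in> orb x a"
    using moved_closed_if_commute[OF y(3) _ a] moved_eq_orb[OF c a] by simp
  then have "y b = b" if "b \<in> moved x" for b
    using fixes_orb_if_coprime[OF y a] that moved_eq_orb[OF c a] by simp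
  then show ?thesis by (auto simp: moved_def)
qed

text \<open>Since \<open>n < 2 * p\<close>, the support of \<open>x\<close> is a single orbit;
  \<open>y\<close> maps it to itself and acts there as some \<open>x ^^ i\<close>. At most one point
  lies outside, and it is fixed by both.\<close>

lemma centralizer_large_cycle:
  assumes n: "n \<le> p + 1" and y: "y permutes {1..n}" "y \<circ> x = x \<circ> y"
  shows "\<exists>i. y = x ^^ i"
proof -
  obtain a where a: "a \<in> moved x" using moved_nonempty by blast
  have "card (moved x) < 2 * p" using card_moved_le n prime_gt_1_nat[OF prime_perm_prime] by linarith
  then have c: "card (moved x) = p"
    using dvd_card_moved card_moved_pos by (auto elim!: dvdE)
  note mo = moved_eq_orb[OF c a]
  have yi: "inj y" using y by (auto intro: permutes_inj)
  have "y a \<in> orb x a"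
    using moved_closed_if_commute[OF y(2) yi a] mo by simp
  then obtain i where i: "y a = (x ^^ i) a" by (rule orbE)
  have on: "y b = (x ^^ i) b" if "b \<in> moved x" for b
    using eq_funpow_on_orb_if_commute[OF y(2) i] that mo by simp
  have xi: "x ^^ i permutes {1..n}" using prime_perm_permutes by (rule permutes_funpow)
  have "y b = (x ^^ i) b" for b
  proof (cases "b \<in> {1..n} - moved x")
    case True
    have "card ({1..n} - moved x) \<le> 1"
      using card_Diff_subset[OF finite_moved moved_subset] n c by simp
    then have one: "{1..n} - moved x = {b}"
      using True card_le_Suc0_iff_eq[of "{1..n} - moved x"] by auto
    \<comment> \<open>A permutation mapping the finite support into itself maps it onto itself, so
      by injectivity the remaining point cannot be sent into it.\<close>
    have out: "z b = b" if z: "z permutes {1..n}" "\<And>d. d \<in> moved x \<Longrightarrow> z d \<in> moved x" for z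
    proof (rule ccontr)
      assume zb: "z b \<noteq> b"
      have "z b \<in> {1..n}" using z(1) True permutes_in_image by fastforce
      then have "z b \<in> moved x" using zb one by blast
      moreover have "z ` moved x = moved x"
        using z finite_moved by (intro card_subset_eq) (auto simp: card_image permutes_inj_on)
      ultimately obtain d where "d \<in> moved x" "z d = z b" by (metis imageE)
      then show False using permutes_inj[OF z(1)] True by (auto simp: inj_eq)
    qed
    show ?thesis
      using out[OF y(1)] out[OF xi] funpow_in_moved moved_closed_if_commute[OF y(2) yi] by simp
  next
    case False
    then show ?thesis using on y(1) xi by (auto simp: permutes_def)
  qed
  then show ?thesis by blast
qed

end

section \<open>Connecting permutations of prime order\<close>

lemma sconn_moved_disjoint:
  assumes "prime_perm n p x" "prime_perm n q y" "p \<noteq> q" "moved x \<inter> moved y = {}"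
  shows "sconn n x y"
  using assms by (intro sconn_commute commute_if_moved_disjoint prime_perm_inj)

text \<open>The iterate with exponent \<open>p - 1\<close> is a two-sided inverse, so explicitly
  given maps need no separate proof of bijectivity.\<close>

lemma permutes_if_funpow_id:
  assumes "(x::'a \<Rightarrow> 'a) ^^ p = id" "p > 0" "moved x \<subseteq> S"
  shows "x permutes S"
proof -
  obtain m where m: "p = Suc m" using assms(2) by (cases p) auto
  have "x \<circ> x ^^ m = id" "x ^^ m \<circ> x = id"
    using assms(1) unfolding m by (simp, simp only: funpow_Suc_right)
  then have "bij x" using o_bij by blast
  then show ?thesis using assms(3) by (auto simp: permutes_def moved_def bij_iff)
qed

lemma prime_permI:
  assumes "prime p" "x ^^ p = id" "moved x \<subseteq> {1..n}" "a \<in> moved x"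
  shows "prime_perm n p x"
proof -
  have "x \<noteq> id" using assms(4) by (auto simp: moved_def)
  then show ?thesis
    using assms prime_gt_0_nat by (auto simp: prime_perm_def intro: permutes_if_funpow_id)
qed

section \<open>Transpositions and 3-cycles\<close>

lemma moved_transpose: "a \<noteq> b \<Longrightarrow> moved (transpose a b) = {a, b}"
  by (auto simp: moved_def transpose_def)

lemma prime_perm_transpose:
  assumes "a \<noteq> b" "a \<in> {1..n}" "b \<in> {1..n}"
  shows "prime_perm n 2 (transpose a b)"
proof (rule prime_permI[of _ _ _ a])
  show "transpose a b ^^ 2 = id" by (simp add: numeral_2_eq_2)
qed (use assms in \<open>auto simp: moved_transpose\<close>)

definition cycle3 :: "'a \<Rightarrow> 'a \<Rightarrow> 'a \<Rightarrow> 'a \<Rightarrow> 'a" where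
  "cycle3 a b c z = (if z = a then b else if z = b then c else if z = c then a else z)"

lemma moved_cycle3: "a \<noteq> b \<Longrightarrow> a \<noteq> c \<Longrightarrow> b \<noteq> c \<Longrightarrow> moved (cycle3 a b c) = {a, b, c}"
  by (auto simp: moved_def cycle3_def)

lemma prime_perm_cycle3:
  assumes "a \<noteq> b" "a \<noteq> c" "b \<noteq> c" "{a, b, c} \<subseteq> {1..n}"
  shows "prime_perm n 3 (cycle3 a b c)"
proof (rule prime_permI[of _ _ _ a])
  show "cycle3 a b c ^^ 3 = id" using assms by (auto simp: numeral_3_eq_3 cycle3_def fun_eq_iff)
qed (use assms in \<open>auto simp: moved_cycle3\<close>)

lemma exists_three:
  assumes "card (A :: nat set) \<ge> 3"
  obtains a b c where "a \<in> A" "b \<in> A" "c \<in> A" "a \<noteq> b" "a \<noteq> c" "b \<noteq> c"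
proof -
  obtain T where "T \<subseteq> A" "card T = 3" using assms obtain_subset_with_card_n by metis
  then show ?thesis using that by (auto simp: card_3_iff)
qed

lemma exists_two:
  assumes "card (A :: nat set) \<ge> 2"
  obtains a b where "a \<in> A" "b \<in> A" "a \<noteq> b"
proof -
  obtain T where "T \<subseteq> A" "card T = 2" using assms obtain_subset_with_card_n by metis
  then show ?thesis using that by (auto simp: card_2_iff)
qed

lemma card_compl: "A \<subseteq> {1..n} \<Longrightarrow> card ({1..n} - A) = n - card A"
  using card_Diff_subset[of A "{1..n}"] finite_subset[of A "{1..n}"] by simp

text \<open>Three points outside \<open>{a, b, c}\<close> carry a 3-cycle disjoint from both
  transpositions; this is what \<open>n \<ge> 6\<close> provides.\<close>

lemma sconn_transpose_share:
  assumes n: "n \<ge> 6" and a: "a \<in> {1..n}" "b \<in> {1..n}" "c \<in> {1..n}" "a \<noteq> b" "a \<noteq> c"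
  shows "sconn n (transpose a b) (transpose a c)"
proof -
  have "card {a, b, c} \<le> 3" by (simp add: card_insert_if)
  then have "card ({1..n} - {a, b, c}) \<ge> 3" using card_compl[of "{a, b, c}" n] a n by auto
  then obtain d e f where d: "d \<in> {1..n} - {a, b, c}" "e \<in> {1..n} - {a, b, c}" "f \<in> {1..n} - {a, b, c}"
    "d \<noteq> e" "d \<noteq> f" "e \<noteq> f" by (rule exists_three)
  have 3: "prime_perm n 3 (cycle3 d e f)" using d by (intro prime_perm_cycle3) auto
  have "sconn n (transpose a b) (cycle3 d e f)"
    by (rule sconn_moved_disjoint[OF prime_perm_transpose 3])
      (use a d in \<open>auto simp: moved_transpose moved_cycle3\<close>)
  moreover have "sconn n (transpose a c) (cycle3 d e f)"
    by (rule sconn_moved_disjoint[OF prime_perm_transpose 3])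
      (use a d in \<open>auto simp: moved_transpose moved_cycle3\<close>)
  ultimately show ?thesis using conn_trans pconn_sym by metis
qed

lemma sconn_transposes:
  assumes n: "n \<ge> 6" and a: "a \<in> {1..n}" "b \<in> {1..n}" "c \<in> {1..n}" "d \<in> {1..n}" "a \<noteq> b" "c \<noteq> d"
  shows "sconn n (transpose a b) (transpose c d)"
proof (cases "c = a")
  case True
  then show ?thesis using sconn_transpose_share assms by blast
next
  case False
  have "sconn n (transpose a b) (transpose a c)" using sconn_transpose_share[of n a b c] assms False by auto
  also have "transpose a c = transpose c a" by (rule transpose_commute)
  also have "sconn n (transpose c a) (transpose c d)" using sconn_transpose_share[of n c a d] assms False by auto
  finally show ?thesis .
qed

lemma sconn_base_odd:
  assumes n: "n \<ge> 6" and x: "prime_perm n p x" "p \<noteq> 2" "card (moved x) + 2 \<le> n"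
  shows "sconn n x (transpose 1 2)"
proof -
  have "card ({1..n} - moved x) \<ge> 2" using card_compl[OF moved_subset[OF x(1)]] x(3) by simp
  then obtain a b where ab: "a \<in> {1..n} - moved x" "b \<in> {1..n} - moved x" "a \<noteq> b" by (rule exists_two)
  have "sconn n x (transpose a b)"
    by (rule sconn_moved_disjoint[OF x(1) prime_perm_transpose x(2)])
      (use ab in \<open>auto simp: moved_transpose\<close>)
  also have "sconn n (transpose a b) (transpose 1 2)"
    using ab n by (intro sconn_transposes) auto
  finally show ?thesis .
qed

text \<open>Three fixed points of \<open>x\<close> carry a 3-cycle. At least three points lie
  outside that cycle, so the odd case applies to it.\<close>

lemma sconn_base_even:
  assumes n: "n \<ge> 6" and x: "prime_perm n 2 x" "card (moved x) + 3 \<le> n"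
  shows "sconn n x (transpose 1 2)"
proof -
  have "card ({1..n} - moved x) \<ge> 3" using card_compl[OF moved_subset[OF x(1)]] x(2) by simp
  then obtain d e f where d: "d \<in> {1..n} - moved x" "e \<in> {1..n} - moved x" "f \<in> {1..n} - moved x"
    "d \<noteq> e" "d \<noteq> f" "e \<noteq> f" by (rule exists_three)
  have 3: "prime_perm n 3 (cycle3 d e f)" using d by (intro prime_perm_cycle3) auto
  have "sconn n x (cycle3 d e f)"
    by (rule sconn_moved_disjoint[OF x(1) 3]) (use d in \<open>auto simp: moved_cycle3\<close>)
  also have "sconn n (cycle3 d e f) (transpose 1 2)"
    by (rule sconn_base_odd[OF n 3]) (use d n in \<open>auto simp: moved_cycle3\<close>)
  finally show ?thesis .
qed

section \<open>Involutions and pairs of 3-cycles\<close>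

lemma involution_involutive: "prime_perm n 2 x \<Longrightarrow> x (x a) = a"
  using prime_perm_funpow[of n 2 x a] by (simp add: numeral_2_eq_2)

lemma involution_eq_iff: "prime_perm n 2 x \<Longrightarrow> x a = b \<longleftrightarrow> a = x b"
  by (auto simp: involution_involutive)

definition double_cycle3 :: "'a \<Rightarrow> 'a \<Rightarrow> 'a \<Rightarrow> 'a \<Rightarrow> 'a \<Rightarrow> 'a \<Rightarrow> 'a \<Rightarrow> 'a" where
  "double_cycle3 a b c a' b' c' z =
    (if z = a then b else if z = b then c else if z = c then a
     else if z = a' then b' else if z = b' then c' else if z = c' then a' else z)"

lemma moved_double_cycle3:
  "distinct [a, b, c, a', b', c'] \<Longrightarrow> moved (double_cycle3 a b c a' b' c') = {a, b, c, a', b', c'}"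
  by (auto simp: moved_def double_cycle3_def)

lemma prime_perm_double_cycle3:
  assumes d: "distinct [a, b, c, a', b', c']" and "{a, b, c, a', b', c'} \<subseteq> {1..n}"
  shows "prime_perm n 3 (double_cycle3 a b c a' b' c')"
proof (rule prime_permI[of _ _ _ a])
  show "double_cycle3 a b c a' b' c' ^^ 3 = id"
    using d by (auto simp: numeral_3_eq_3 double_cycle3_def fun_eq_iff)
qed (use assms in \<open>auto simp: moved_double_cycle3\<close>)

text \<open>When \<open>c\<close> is picked, the four points \<open>a, x a, b, x b\<close> must be
  avoided, hence the bound 5; as the support of an involution is even, this amounts to six moved
  points.\<close>

lemma exists_three_transpositions:
  assumes x: "prime_perm n 2 x" and c: "card (moved x) \<ge> 5"
  obtains a b c where "distinct [a, b, c, x a, x b, x c]" "{a, b, c, x a, x b, x c} \<subseteq> moved x"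
proof -
  have ex: "\<exists>b. b \<in> moved x \<and> b \<notin> S" if "finite S" "card S \<le> 4" for S
  proof (rule ccontr)
    assume "\<nexists>b. b \<in> moved x \<and> b \<notin> S"
    then have "moved x \<subseteq> S" by blast
    then have "card (moved x) \<le> card S" by (rule card_mono[OF that(1)])
    then show False using that(2) c by simp
  qed
  obtain a where a: "a \<in> moved x" using ex[of "{}"] by (metis card.empty finite.emptyI zero_le)
  obtain b where b: "b \<in> moved x" "b \<notin> {a, x a}" using ex[of "{a, x a}"] card_length[of "[a, x a]"] by auto
  obtain c where c: "c \<in> moved x" "c \<notin> {a, x a, b, x b}"
    using ex[of "{a, x a, b, x b}"] card_length[of "[a, x a, b, x b]"] by auto
  note inv = involution_involutive[OF x] and eq = inj_eq[OF prime_perm_inj[OF x]]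
  have "x b \<noteq> a" using b(2) inv[of b] by auto
  moreover have "x c \<noteq> a" using c(2) inv[of c] by auto
  moreover have "x c \<noteq> b" using c(2) inv[of c] by auto
  moreover have "x a \<noteq> a" "x b \<noteq> b" "x c \<noteq> c" using a b(1) c(1) by (simp_all add: moved_def)
  ultimately have "distinct [a, b, c, x a, x b, x c]"
    using b(2) c(2) by (simp add: eq) metis
  moreover have "{a, b, c, x a, x b, x c} \<subseteq> moved x"
    using a b c by (auto simp: moved_def eq)
  ultimately show ?thesis by (rule that)
qed

text \<open>Conjugation by \<open>x\<close> exchanges the cycle on \<open>a, b, c\<close> with the
  cycle on their images.\<close>

lemma double_cycle3_commute:
  assumes x: "prime_perm n 2 x" and d: "distinct [a, b, c, x a, x b, x c]"
  shows "x \<circ> double_cycle3 a b c (x a) (x b) (x c) = double_cycle3 a b c (x a) (x b) (x c) \<circ> x"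
proof
  fix z
  let ?a = "x a" and ?b = "x b" and ?c = "x c"
  have ne: "a \<noteq> b" "a \<noteq> c" "b \<noteq> c" "a \<noteq> ?a" "a \<noteq> ?b" "a \<noteq> ?c" "b \<noteq> ?a" "b \<noteq> ?b"
    "b \<noteq> ?c" "c \<noteq> ?a" "c \<noteq> ?b" "c \<noteq> ?c" "?a \<noteq> ?b" "?a \<noteq> ?c" "?b \<noteq> ?c"
    using d by simp_all
  have xx: "x (x w) = w" for w using involution_involutive[OF x] .
  have eq: "x w = x v \<longleftrightarrow> w = v" for w v using inj_eq[OF prime_perm_inj[OF x]] .
  consider "z = a" | "z = b" | "z = c" | "z = ?a" | "z = ?b" | "z = ?c"
    | "z \<notin> {a, b, c, ?a, ?b, ?c}" "x z \<notin> {a, b, c, ?a, ?b, ?c}"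
    using xx eq by (metis empty_iff insert_iff)
  then show "(x \<circ> double_cycle3 a b c ?a ?b ?c) z = (double_cycle3 a b c ?a ?b ?c \<circ> x) z"
    by cases (simp_all add: double_cycle3_def ne ne[symmetric] xx)
qed

text \<open>The element of type \<open>[3, 3]\<close> moves six points and must leave two fixed for
  \<open>sconn_base_odd\<close>; this is why 8 points are required.\<close>

lemma sconn_base_large_involution:
  assumes n: "n \<ge> 8" and x: "prime_perm n 2 x" "card (moved x) \<ge> 5"
  shows "sconn n x (transpose 1 2)"
proof -
  obtain a b c where d: "distinct [a, b, c, x a, x b, x c]" "{a, b, c, x a, x b, x c} \<subseteq> moved x"
    using x by (rule exists_three_transpositions)
  let ?y = "double_cycle3 a b c (x a) (x b) (x c)"
  have y: "prime_perm n 3 ?y"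
    by (rule prime_perm_double_cycle3[OF d(1)]) (use d(2) moved_subset[OF x(1)] in blast)
  have "card (moved ?y) = 6"
    unfolding moved_double_cycle3[OF d(1)] using d(1) by (simp add: card_insert_if)
  then have "sconn n ?y (transpose 1 2)" using n by (intro sconn_base_odd[OF _ y]) auto
  moreover have "sconn n x ?y"
    by (rule sconn_commute[OF x(1) y _ double_cycle3_commute[OF x(1) d(1)]]) simp
  ultimately show ?thesis by (rule conn_trans[rotated])
qed

text \<open>The involution pairs \<open>(x ^^ i) a\<close> with \<open>(x ^^ i) b\<close>; applying
  \<open>x\<close> shifts the exponent on both sides and so commutes with the exchange.\<close>

lemma exists_swap_involution:
  assumes x: "prime_perm n p x" and a: "a \<in> moved x" and b: "b \<in> moved x" "b \<notin> orb x a"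
  obtains y where "prime_perm n 2 y" "moved y = orb x a \<union> orb x b" "x \<circ> y = y \<circ> x"
proof -
  \<comment> \<open>The exponents are determined only modulo \<open>p\<close>. As both orbits have
    length \<open>p\<close>, every choice gives the same value of \<open>y\<close>.\<close>
  define ia where "ia z = (SOME i. z = (x ^^ i) a)" for z
  define ib where "ib z = (SOME i. z = (x ^^ i) b)" for z
  define y where "y z = (if z \<in> orb x a then (x ^^ ia z) b
     else if z \<in> orb x b then (x ^^ ib z) a else z)" for z
  have disj: "orb x a \<inter> orb x b = {}" using orb_disjoint[OF x b(2)] .
  have pw: "(x ^^ i) u = (x ^^ j) u \<longleftrightarrow> i mod p = j mod p" if "u \<in> moved x" for i j u
  proof -
    have "i mod p < p" "j mod p < p" using prime_gt_0_nat[OF prime_perm_prime[OF x]] by auto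
    then show ?thesis
      using inj_onD[OF funpow_inj_on[OF x that], of "i mod p" "j mod p"]
        funpow_mod[OF x, of i u] funpow_mod[OF x, of j u] by auto
  qed
  have ya: "y ((x ^^ i) a) = (x ^^ i) b" for i
  proof -
    have "(x ^^ i) a = (x ^^ ia ((x ^^ i) a)) a" unfolding ia_def by (rule someI[of _ i]) simp
    then have "(x ^^ ia ((x ^^ i) a)) b = (x ^^ i) b" using pw[OF a] pw[OF b(1)] by metis
    then show ?thesis by (simp add: y_def funpow_in_orb)
  qed
  have yb: "y ((x ^^ i) b) = (x ^^ i) a" for i
  proof -
    have "(x ^^ i) b = (x ^^ ib ((x ^^ i) b)) b" unfolding ib_def by (rule someI[of _ i]) simp
    then have "(x ^^ ib ((x ^^ i) b)) a = (x ^^ i) a" using pw[OF a] pw[OF b(1)] by metis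
    moreover have "(x ^^ i) b \<notin> orb x a" using disj by blast
    ultimately show ?thesis by (simp add: y_def funpow_in_orb)
  qed
  have yo: "y z = z" if "z \<notin> orb x a" "z \<notin> orb x b" for z
    using that by (simp add: y_def)
  have "y (y z) = z" for z
    using ya yb yo by (cases "z \<in> orb x a"; cases "z \<in> orb x b") (auto elim!: orbE)
  then have "y ^^ 2 = id" by (auto simp: numeral_2_eq_2 fun_eq_iff)
  moreover have mv: "moved y = orb x a \<union> orb x b"
  proof -
    have "y z \<noteq> z" if "z \<in> orb x a \<or> z \<in> orb x b" for z
      using that disj ya yb by (metis disjoint_iff funpow_in_orb orbE)
    then show ?thesis using yo by (auto simp: moved_def)
  qed
  moreover have "orb x a \<union> orb x b \<subseteq> {1..n}"
    using orb_subset_moved[OF x a] orb_subset_moved[OF x b(1)] moved_subset[OF x] by blast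
  ultimately have "prime_perm n 2 y" by (intro prime_permI[of _ _ _ a]) auto
  moreover have "x \<circ> y = y \<circ> x"
  proof
    fix z
    consider i where "z = (x ^^ i) a" | i where "z = (x ^^ i) b" | "z \<notin> orb x a" "z \<notin> orb x b"
      by (metis orbE)
    then show "(x \<circ> y) z = (y \<circ> x) z"
    proof cases
      case (1 i)
      then show ?thesis using ya[of i] ya[of "Suc i"] by simp
    next
      case (2 i)
      then show ?thesis using yb[of i] yb[of "Suc i"] by simp
    next
      case 3
      have "z \<in> orb x (x z)" using orb_sym[OF x funpow_in_orb[of 1 x z]] by simp
      then have "x z \<notin> orb x a" "x z \<notin> orb x b" using 3 orb_trans[OF x] by blast+
      then show ?thesis using 3 yo by simp
    qed
  qed
  ultimately show ?thesis using mv by (intro that)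
qed

lemma sconn_base:
  assumes n: "n \<ge> 8" and x: "prime_perm n p x" "p + 1 < n"
  shows "sconn n x (transpose 1 2)"
proof (cases "p = 2")
  case True
  then show ?thesis
    using sconn_base_large_involution[of n x] sconn_base_even[of n x] x(1) n
    by (cases "card (moved x) \<ge> 5") auto
next
  case False
  show ?thesis
  proof (cases "card (moved x) + 2 \<le> n")
    case True
    then show ?thesis using sconn_base_odd[OF _ x(1) False] n by simp
  next
    case small: False
    obtain a where a: "a \<in> moved x" using moved_nonempty[OF x(1)] by blast
    \<comment> \<open>Fewer than two fixed points and \<open>p + 1 < n\<close> leave more than
      \<open>p\<close> moved points, hence a second orbit.\<close>
    have "card (moved x) > p" using small x(2) by simp
    then obtain b where b: "b \<in> moved x" "b \<notin> orb x a" using exists_second_orb[OF x(1) _ a] by blast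
    obtain y where y: "prime_perm n 2 y" "moved y = orb x a \<union> orb x b" "x \<circ> y = y \<circ> x"
      using x(1) a b by (rule exists_swap_involution)
    have fin: "finite (orb x a)" "finite (orb x b)"
      by (simp_all add: orb_eq_image[OF x(1)])
    have "card (moved y) = 2 * p"
      unfolding y(2) using card_orb[OF x(1)] a b(1) orb_disjoint[OF x(1) b(2)] fin
      by (simp add: card_Un_disjoint)
    \<comment> \<open>So the exchange moves \<open>2 * p \<ge> 6\<close> points and counts as a
      large involution.\<close>
    moreover have "p \<ge> 3" using False prime_ge_2_nat[OF prime_perm_prime[OF x(1)]] by linarith
    ultimately have "sconn n y (transpose 1 2)"
      using n by (intro sconn_base_large_involution y(1)) auto
    then show ?thesis
      using sconn_commute[OF x(1) y(1) False y(3)] by (rule conn_trans[rotated])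
  qed
qed

section \<open>Counting cyclic groups\<close>

abbreviation cyc_group :: "nat \<Rightarrow> (nat \<Rightarrow> nat) \<Rightarrow> (nat \<Rightarrow> nat) set" where
  "cyc_group n x \<equiv> generate (sym_group n) {x}"

lemma prime_perm_funpow_power:
  assumes x: "prime_perm n p x" and k: "x ^^ k \<noteq> id"
  shows "prime_perm n p (x ^^ k)" "cyc_group n (x ^^ k) = cyc_group n x"
proof -
  interpret group "sym_group n" by (rule sym_group_is_group)
  have "(x ^^ k) ^^ p = (x ^^ p) ^^ k" by (simp add: funpow_mult mult.commute)
  then have "(x ^^ k) ^^ p = id" using x by (simp add: prime_perm_def)
  then show "prime_perm n p (x ^^ k)"
    using x k by (simp add: prime_perm_def permutes_funpow)
  have "generate (sym_group n) {x [^]\<^bsub>sym_group n\<^esub> k} = cyc_group n x"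
  proof (rule generate_eq_of_pow_prime)
    show "x \<in> carrier (sym_group n)" using x by (simp add: prime_perm_def sym_group_carrier)
    show "prime (ord x)" using prime_perm_ord[OF x] prime_perm_prime[OF x] by simp
    show "x [^]\<^bsub>sym_group n\<^esub> k \<noteq> \<one>\<^bsub>sym_group n\<^esub>"
      unfolding sym_group_pow sym_group_one by (rule k)
  qed
  then show "cyc_group n (x ^^ k) = cyc_group n x" by (simp only: sym_group_pow)
qed

lemma funpow_if_cyc_group_eq:
  assumes "prime_perm n p x" "prime_perm n q y" "cyc_group n x = cyc_group n y"
  obtains k where "y = x ^^ k"
proof -
  have "pos_power (sym_group n) y x"
    using assms by (intro group.pos_power_if_generate_eq[OF sym_group_is_group finite_sym_group])
      (simp_all add: prime_perm_def sym_group_carrier)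
  then show ?thesis using that by (auto simp only: pos_power_def sym_group_pow)
qed

lemma moved_funpow: "moved (x ^^ k) \<subseteq> moved x"
proof
  fix a assume "a \<in> moved (x ^^ k)"
  moreover have "(x ^^ k) a = a" if "x a = a" using that by (induction k) simp_all
  ultimately show "a \<in> moved x" by (auto simp: moved_def)
qed

lemma moved_eq_if_cyc_group_eq:
  assumes "prime_perm n p x" "prime_perm n q y" "cyc_group n x = cyc_group n y"
  shows "moved x = moved y"
  using assms funpow_if_cyc_group_eq[of n p x q y] funpow_if_cyc_group_eq[of n q y p x] moved_funpow
  by (metis subset_antisym)

lemma ord_eq_if_cyc_group_eq:
  assumes "prime_perm n p x" "prime_perm n q y" "cyc_group n x = cyc_group n y"
  shows "p = q"
proof -
  obtain k where k: "y = x ^^ k" using assms by (rule funpow_if_cyc_group_eq)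
  moreover have "y \<noteq> id" using assms(2) by (simp add: prime_perm_def)
  ultimately have "prime_perm n p y" using prime_perm_funpow_power[OF assms(1), of k] by simp
  then show ?thesis using assms(2) by (rule prime_perm_unique)
qed

lemma no_commuting_prime_perm:
  assumes "prime_perm n p x" "n \<le> p + 1" "prime_perm n q y" "y \<circ> x = x \<circ> y"
  shows "p = q"
proof -
  obtain k where k: "y = x ^^ k"
    using centralizer_large_cycle[OF assms(1,2) prime_perm_permutes[OF assms(3)] assms(4)] by blast
  moreover have "y \<noteq> id" using assms(3) by (simp add: prime_perm_def)
  ultimately have "prime_perm n p y" using prime_perm_funpow_power[OF assms(1), of k] by simp
  then show ?thesis using assms(3) by (rule prime_perm_unique)
qed

lemma prime_le_if_prime_perm: "prime_perm n p x \<Longrightarrow> p \<le> n"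
  using card_moved_ge card_moved_le le_trans by blast

lemma card_moved_large:
  assumes x: "prime_perm n p x" and n: "n \<le> p + 1"
  shows "card (moved x) = p"
proof -
  have "card (moved x) < 2 * p"
    using card_moved_le[OF x] n prime_gt_1_nat[OF prime_perm_prime[OF x]] by linarith
  then show ?thesis
    using dvd_card_moved[OF x] card_moved_pos[OF x] by (auto elim!: dvdE)
qed

section \<open>Groups generated by cycles of prime length\<close>

definition prime_cycles :: "nat \<Rightarrow> nat \<Rightarrow> (nat \<Rightarrow> nat) set" where
  "prime_cycles n p = {x. prime_perm n p x \<and> card (moved x) = p}"

lemma cycle_of_list_funpow_nth:
  assumes "distinct l" "j < length l"
  shows "(cycle_of_list l ^^ i) (l ! j) = l ! ((i + j) mod length l)"
proof -
  have "(cycle_of_list l ^^ i) (l ! j) = map (cycle_of_list l ^^ i) l ! j"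
    using assms(2) by simp
  also have "\<dots> = rotate i l ! j" by (simp only: cyclic_rotation[OF assms(1)])
  finally show ?thesis using nth_rotate[OF assms(2), of i] by (simp add: add.commute)
qed

lemma cycle_of_list_prime_perm:
  assumes l: "distinct l" "length l = p" "prime p" "set l \<subseteq> {1..n}"
  shows "prime_perm n p (cycle_of_list l)" "moved (cycle_of_list l) = set l"
    "cycle_of_list l \<in> prime_cycles n p"
proof -
  let ?x = "cycle_of_list l"
  have p1: "p > 1" using l(3) by (rule prime_gt_1_nat)
  have "?x (l ! j) \<noteq> l ! j" if "j < p" for j
  proof -
    have "?x (l ! j) = l ! ((1 + j) mod p)"
      using cycle_of_list_funpow_nth[of l j 1] that l by simp
    moreover have "(1 + j) mod p \<noteq> j" "(1 + j) mod p < p"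
      using that p1 by (cases "Suc j = p"; simp)+
    ultimately show ?thesis using that l nth_eq_iff_index_eq by metis
  qed
  then have "set l \<subseteq> moved ?x"
    using l(2) by (auto simp: moved_def in_set_conv_nth)
  then show mv: "moved ?x = set l"
    using id_outside_supp[of _ l] by (auto simp: moved_def)
  have "(?x ^^ p) a = a" for a
  proof (cases "a \<in> set l")
    case True
    then obtain j where "j < p" "a = l ! j" using l(2) by (auto simp: in_set_conv_nth)
    then show ?thesis using cycle_of_list_funpow_nth[of l j p] l by simp
  next
    case False
    then have "a \<notin> moved (?x ^^ p)" using mv moved_funpow[of p ?x] by blast
    then show ?thesis by (simp add: moved_def)
  qed
  then have "?x ^^ p = id" by auto
  moreover have "l ! 0 \<in> moved ?x" using mv l p1 by simp
  ultimately show "prime_perm n p ?x"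
    using l mv by (intro prime_permI) auto
  then show "?x \<in> prime_cycles n p"
    using mv l distinct_card[of l] by (simp add: prime_cycles_def)
qed

lemma exists_prime_cycle:
  assumes "prime p" "p \<le> n"
  obtains x where "prime_perm n p x" "moved x = {1..p}"
proof -
  define l where "l = [1..<p+1]"
  have l: "distinct l" "length l = p" "set l = {1..p}" by (auto simp: l_def)
  then show ?thesis
    using that cycle_of_list_prime_perm(1,2)[OF l(1,2) assms(1), of n] assms(2) by simp
qed

text \<open>Every cyclic group generated by a \<open>p\<close>-cycle with support \<open>S\<close> contains exactly one
  element sending the smallest point of \<open>S\<close> to the second smallest one.\<close>

lemma card_prime_cycle_groups:
  assumes p: "prime p"
  shows "card (cyc_group n ` prime_cycles n p) = (n choose p) * fact (p - 2)"
proof -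
  have p2: "p \<ge> 2" using p by (rule prime_ge_2_nat)
  define s0 where "s0 S = Min S" for S :: "nat set"
  define s1 where "s1 S = Min (S - {s0 S})" for S :: "nat set"
  let ?Ss = "{S. S \<subseteq> {1..n} \<and> card S = p}"
  let ?L = "\<lambda>S. permutations_of_set (S - {s0 S, s1 S})"
  define ll where "ll S xs = s0 S # s1 S # xs" for S xs
  have ll01: "ll S xs ! 0 = s0 S" "ll S xs ! 1 = s1 S" for S xs by (simp_all add: ll_def)
  have s: "s0 S \<in> S" "s1 S \<in> S" "s0 S \<noteq> s1 S" "finite S" if "S \<in> ?Ss" for S
  proof -
    show fin: "finite S" using that finite_subset by blast
    have "card S > 0" using that p2 by simp
    then show "s0 S \<in> S" using fin unfolding s0_def by (intro Min_in) auto
    then have "card (S - {s0 S}) > 0" using that p2 fin by (simp add: card_Diff_singleton)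
    then have "s1 S \<in> S - {s0 S}" using fin unfolding s1_def by (intro Min_in) (auto simp: card_gt_0_iff)
    then show "s1 S \<in> S" "s0 S \<noteq> s1 S" by auto
  qed
  have l: "distinct (ll S xs)" "set (ll S xs) = S" "length (ll S xs) = p"
    if "S \<in> ?Ss" "xs \<in> ?L S" for S xs
  proof -
    show d: "distinct (ll S xs)" and "set (ll S xs) = S"
      using permutations_of_setD[OF that(2)] s[OF that(1)] by (auto simp: ll_def)
    then show "length (ll S xs) = p" using distinct_card[OF d] that(1) by simp
  qed
  \<comment> \<open>A group is encoded by its support and the cycle notation of its normalized
    generator, starting at the minimum. Two entries are prescribed and the other
    \<open>p - 2\<close> are free, whence \<open>fact (p - 2)\<close>.\<close>
  have bij: "bij_betw (\<lambda>(S, xs). cyc_group n (cycle_of_list (ll S xs))) (SIGMA S:?Ss. ?L S)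
      (cyc_group n ` prime_cycles n p)"
    unfolding bij_betw_def
  proof (intro conjI equalityI subsetI)
    show "inj_on (\<lambda>(S, xs). cyc_group n (cycle_of_list (ll S xs))) (SIGMA S:?Ss. ?L S)"
    proof (rule inj_onI, clarify)
      fix S xs T ys
      assume S: "S \<subseteq> {1..n}" "p = card S" "xs \<in> ?L S" and T: "T \<subseteq> {1..n}" "card T = card S" "ys \<in> ?L T"
      assume eq: "cyc_group n (cycle_of_list (ll S xs)) = cyc_group n (cycle_of_list (ll T ys))"
      have SS: "S \<in> ?Ss" "T \<in> ?Ss" using S T by auto
      define x where "x = cycle_of_list (ll S xs)"
      define y where "y = cycle_of_list (ll T ys)"
      have x: "prime_perm n p x" "moved x = S"
        unfolding x_def using cycle_of_list_prime_perm[OF l(1,3)[OF SS(1) S(3)] p, of n] l(2)[OF SS(1) S(3)] S(1) by simp_all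
      have y: "prime_perm n p y" "moved y = T"
        unfolding y_def using cycle_of_list_prime_perm[OF l(1,3)[OF SS(2) T(3)] p, of n] l(2)[OF SS(2) T(3)] T(1) by simp_all
      have ST: "S = T" using moved_eq_if_cyc_group_eq[OF x(1) y(1)] x y eq by (simp add: x_def y_def)
      obtain k where k: "y = x ^^ k"
        using funpow_if_cyc_group_eq[OF x(1) y(1)] eq unfolding x_def y_def by metis
      have nx: "(x ^^ i) (s0 S) = ll S xs ! i" if "i < p" for i
        using cycle_of_list_funpow_nth[OF l(1)[OF SS(1) S(3)], of 0 i] l(3)[OF SS(1) S(3)] that by (simp add: x_def ll01(1))
      have ny: "(y ^^ i) (s0 S) = ll S ys ! i" if "i < p" for i
        using cycle_of_list_funpow_nth[OF l(1)[OF SS(2) T(3)], of 0 i] l(3)[OF SS(2) T(3)] that by (simp add: y_def ST ll01(1))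
      \<comment> \<open>Both generators send \<open>s0 S\<close> to \<open>s1 S\<close>. Powers of
        \<open>x\<close> are distinguished by their value at a moved point, so the exponent is 1
        modulo \<open>p\<close>.\<close>
      have "(x ^^ k) (s0 S) = (x ^^ 1) (s0 S)"
        using nx[of 1] ny[of 1] p2 by (simp only: k ll01 ST) simp
      then have "(x ^^ (k mod p)) (s0 S) = (x ^^ 1) (s0 S)" using funpow_mod[OF x(1), of k "s0 S"] by simp
      then have "k mod p = 1"
        using inj_onD[OF funpow_inj_on[OF x(1), of "s0 S"], of "k mod p" 1] x(2) s(1)[OF SS(1)] p2 by simp
      then have "(x ^^ k) a = x a" for a using funpow_mod[OF x(1), of k a] by simp
      then have "y = x" using k by auto
      then have "ll S xs ! i = ll S ys ! i" if "i < p" for i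
        using nx ny that by metis
      then have "ll S xs = ll S ys"
        using l(3)[OF SS(1) S(3)] l(3)[OF SS(2) T(3)] by (intro nth_equalityI) (auto simp: ST)
      then show "S = T \<and> xs = ys" using ST by (simp add: ll_def)
    qed
  next
    fix C assume "C \<in> (\<lambda>(S, xs). cyc_group n (cycle_of_list (ll S xs))) ` (SIGMA S:?Ss. ?L S)"
    then obtain S xs where S: "S \<in> ?Ss" "xs \<in> ?L S" and C: "C = cyc_group n (cycle_of_list (ll S xs))" by auto
    then show "C \<in> cyc_group n ` prime_cycles n p"
      using cycle_of_list_prime_perm(3)[OF l(1,3)[OF S] p, of n] l(2)[OF S] by auto
  next
    fix C assume "C \<in> cyc_group n ` prime_cycles n p"
    then obtain x where x: "prime_perm n p x" "card (moved x) = p" and C: "C = cyc_group n x"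
      by (auto simp: prime_cycles_def)
    define S where "S = moved x"
    have S: "S \<in> ?Ss" using x moved_subset[OF x(1)] by (simp add: S_def)
    have "s1 S \<in> orb x (s0 S)" using moved_eq_orb[OF x, of "s0 S"] s[OF S] by (simp add: S_def)
    \<comment> \<open>The orbit is the whole support, so some power of the given generator takes the
      least point to the second one.\<close>
    then obtain k where k: "s1 S = (x ^^ k) (s0 S)" by (rule orbE)
    define y where "y = x ^^ k"
    have "x ^^ k \<noteq> id" using k s(3)[OF S] by (metis id_apply)
    note y0 = prime_perm_funpow_power[OF x(1) this, folded y_def]
    note y = y0(1)
    have my: "moved y = S" using moved_eq_if_cyc_group_eq[OF x(1) y] y0(2) by (simp add: S_def)
    have s0m: "s0 S \<in> moved y" using my s[OF S] by simp
    have cm: "card (moved y) = p" using my S by simp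
    define l' where "l' = map (\<lambda>i. (y ^^ i) (s0 S)) [0..<p]"
    have l': "distinct l'" "set l' = S" "length l' = p"
      using funpow_inj_on[OF y s0m] orb_eq_image[OF y, of "s0 S"] moved_eq_orb[OF y cm s0m] my
      by (auto simp: l'_def distinct_map atLeast0LessThan)
    obtain xs where xs: "l' = ll S xs"
    proof -
      have "[0..<p] = 0 # 1 # [2..<p]" using p2 by (simp add: upt_rec numeral_2_eq_2)
      then show ?thesis using that k by (simp add: l'_def y_def ll_def)
    qed
    have "xs \<in> ?L S" using l' s[OF S] unfolding xs ll_def by (intro permutations_of_setI) auto
    moreover have "cycle_of_list l' = y"
    proof
      fix a
      show "cycle_of_list l' a = y a"
      proof (cases "a \<in> S")
        case True
        then obtain j where j: "j < p" "a = l' ! j" using l' by (metis in_set_conv_nth)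
        then have "cycle_of_list l' a = l' ! ((1 + j) mod p)"
          using cycle_of_list_funpow_nth[OF l'(1), of j 1] l'(3) by simp
        also have "\<dots> = (y ^^ (1 + j)) (s0 S)"
          using p2 funpow_mod[OF y, of "1 + j" "s0 S"] by (simp add: l'_def)
        also have "\<dots> = y a" using j by (simp add: l'_def)
        finally show ?thesis .
      next
        case False
        then have "y a = a" using my in_moved_iff by metis
        then show ?thesis using id_outside_supp[of a l'] l'(2) False by simp
      qed
    qed
    ultimately have "C = (case (S, xs) of (S, xs) \<Rightarrow> cyc_group n (cycle_of_list (ll S xs)))" "(S, xs) \<in> (SIGMA S:?Ss. ?L S)"
      using S C y0(2) by (simp_all add: xs[symmetric])
    then show "C \<in> (\<lambda>(S, xs). cyc_group n (cycle_of_list (ll S xs))) ` (SIGMA S:?Ss. ?L S)"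
      by (rule image_eqI)
  qed
  have "card (?L S) = fact (p - 2)" if "S \<in> ?Ss" for S
  proof -
    have "card (S - {s0 S, s1 S}) = p - 2"
      using s[OF that] that by (simp add: card_Diff_subset)
    then show ?thesis using s(4)[OF that] by simp
  qed
  then have "card (SIGMA S:?Ss. ?L S) = card ?Ss * fact (p - 2)"
    by (subst card_SigmaI) auto
  then show ?thesis
    using bij_betw_same_card[OF bij] n_subsets[of "{1..n}" p] by simp
qed

text \<open>\<open>Main\<close> stands for the component of the transpositions; the other components are named
  by a cyclic group they contain or by a set of points.\<close>

datatype label = Main | Gen "(nat \<Rightarrow> nat) set" | Supp "nat set"

text \<open>Order, support and cyclic group of \<open>x\<close> depend only on the subgroup
  generated by \<open>x\<close>, so a label built from them agrees on all its generators. By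
  symmetry commuting pairs need checking for \<open>p < q\<close> only.\<close>

lemma c0_sym_group_labels:
  fixes h :: "nat \<Rightarrow> nat set \<Rightarrow> (nat \<Rightarrow> nat) set \<Rightarrow> label"
  assumes com: "\<And>p q x y. prime_perm n p x \<Longrightarrow> prime_perm n q y \<Longrightarrow> p < q \<Longrightarrow> x \<circ> y = y \<circ> x \<Longrightarrow>
      h p (moved x) (cyc_group n x) = h q (moved y) (cyc_group n y)"
    and con: "\<And>p q x y. prime_perm n p x \<Longrightarrow> prime_perm n q y \<Longrightarrow>
      h p (moved x) (cyc_group n x) = h q (moved y) (cyc_group n y) \<Longrightarrow> sconn n x y"
  shows "c0 (sym_group n) = card {h p (moved x) (cyc_group n x) |p x. prime_perm n p x}"
proof -
  interpret group "sym_group n" by (rule sym_group_is_group)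
  define f where "f x = h (ord x) (moved x) (cyc_group n x)" for x
  have f: "f x = h p (moved x) (cyc_group n x)" if "prime_perm n p x" for p x
    by (simp add: f_def prime_perm_ord[OF that])
  have "c0 (sym_group n) = card (f ` prime_elts)"
  proof (rule c0_eq_card_labels[OF finite_sym_group])
    fix x y assume "x \<in> prime_elts" "y \<in> prime_elts"
    then obtain p q where pq: "prime_perm n p x" "prime_perm n q y"
      using prime_elts_sym_group_iff by blast
    show "f x = f y" if "cyc_group n x = cyc_group n y"
      using f pq moved_eq_if_cyc_group_eq[OF pq that] ord_eq_if_cyc_group_eq[OF pq that] that by simp
    show "f x = f y" if "x \<otimes>\<^bsub>sym_group n\<^esub> y = y \<otimes>\<^bsub>sym_group n\<^esub> x" "ord x \<noteq> ord y"
    proof -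
      have "x \<circ> y = y \<circ> x" "p \<noteq> q" using that pq prime_perm_ord by (auto simp: sym_group_mult)
      then show ?thesis using com[OF pq] com[OF pq(2,1)] f pq by (metis linorder_neqE_nat)
    qed
    show "sconn n x y" if "f x = f y" using con[OF pq] f pq that by simp
  qed
  also have "f ` prime_elts = {h p (moved x) (cyc_group n x) |p x. prime_perm n p x}"
    using f prime_elts_sym_group_iff by (auto simp: image_iff) metis+
  finally show ?thesis .
qed

section \<open>Element orders\<close>

text \<open>The order of a power divides the order of its root, so an edge of the power graph maps
  to an edge or to a single vertex.\<close>

lemma (in group) conn_ord:
  assumes "pconn G x y"
  shows "conn (ord ` nonid G) ord_adj (ord x) (ord y)"
  using assms
proof (rule conn_map)
  fix x y assume xy: "x \<in> nonid G" "y \<in> nonid G" "pg_adj G x y"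
  have *: "ord v dvd ord u" if uv: "pos_power G v u" "u \<in> nonid G" for u v
  proof -
    obtain k :: nat where k: "v = u [^] k" using uv(1) by (auto simp: pos_power_def)
    have u: "u \<in> carrier G" using uv(2) by (simp add: nonid_def)
    have "v [^] ord u = (u [^] ord u) [^] k"
      unfolding k nat_pow_pow[OF u] by (simp only: mult.commute)
    then show ?thesis using u k pow_eq_id[of v "ord u"] by simp
  qed
  have "ord x dvd ord y \<or> ord y dvd ord x"
    using xy *[of x y] *[of y x] by (auto simp: pg_adj_def)
  then have "ord x = ord y \<or> ord_adj (ord x) (ord y)" by (auto simp: ord_adj_def)
  then show "conn (ord ` nonid G) ord_adj (ord x) (ord y)"
    using xy by (auto intro: conn_step)
qed

text \<open>\<open>z\<close> commutes with its power \<open>x\<close>. For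
  \<open>n \<le> p + 1\<close> this makes \<open>z\<close> a power of \<open>x\<close> in turn, so
  that its order is \<open>p\<close> too.\<close>

lemma exists_prime_perm_of_ord:
  assumes z: "z \<in> nonid (sym_group n)" and p: "prime p" "p dvd group.ord (sym_group n) z"
  obtains x where "prime_perm n p x" "n \<le> p + 1 \<Longrightarrow> group.ord (sym_group n) z = p"
proof -
  interpret group "sym_group n" by (rule sym_group_is_group)
  define m where "m = ord z"
  define x where "x = z ^^ (m div p)"
  have zc: "z \<in> carrier (sym_group n)" "z \<noteq> \<one>\<^bsub>sym_group n\<^esub>" using z by (auto simp: nonid_def)
  have m: "m \<noteq> 1" using ord_eq_1 zc by (simp add: m_def)
  have "x \<in> prime_elts" "ord x = p"
    using pow_prime_elt[OF zc(1) p ord_nz[OF finite_sym_group zc(1)]]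
    unfolding x_def m_def sym_group_pow by auto
  then have x: "prime_perm n p x"
    using prime_elts_sym_group_iff[of x n] prime_perm_ord by blast
  moreover have "m = p" if n: "n \<le> p + 1"
  proof -
    have "z \<circ> x = x \<circ> z" by (simp add: x_def funpow_swap1 fun_eq_iff)
    then obtain i where i: "z = x ^^ i"
      using centralizer_large_cycle[OF x n] zc(1) by (auto simp: sym_group_carrier)
    have "z ^^ p = (x ^^ p) ^^ i" by (simp add: i funpow_mult mult.commute)
    then have "z [^]\<^bsub>sym_group n\<^esub> p = \<one>\<^bsub>sym_group n\<^esub>"
      unfolding sym_group_pow sym_group_one using x by (simp add: prime_perm_def)
    then have "m dvd p" using pow_eq_id[OF zc(1)] by (simp add: m_def)
    then show ?thesis using m p(1) by (auto simp: prime_nat_iff)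
  qed
  ultimately show ?thesis using that by (simp add: m_def)
qed

text \<open>A prime from \<open>n - 1\<close> to \<open>n\<close> is an isolated vertex and its own
  label; 0 marks the orders joined to 2. The label 0 requires a prime with \<open>p + 1 < n\<close>,
  that is \<open>n \<ge> 4\<close>.\<close>

lemma c0_order_sym_group:
  "c0_order (sym_group n) = card ((if n \<ge> 4 then {0} else {}) \<union> {p. prime p \<and> n \<le> p + 1 \<and> p \<le> n})"
proof -
  interpret group "sym_group n" by (rule sym_group_is_group)
  let ?V = "ord ` nonid (sym_group n)"
  define f where "f m = (if prime m \<and> n \<le> m + 1 then m else 0)" for m
  have V: "\<exists>p x. prime p \<and> p dvd m \<and> prime_perm n p x" if mV: "m \<in> ?V" for m
  proof -
    obtain z where z: "z \<in> nonid (sym_group n)" "m = ord z" using mV by blast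
    have "m \<noteq> 1" using z ord_eq_1[of z] by (auto simp: nonid_def)
    then obtain p where "prime p" "p dvd m" using prime_factor_nat by blast
    then show ?thesis using exists_prime_perm_of_ord[OF z(1)] z(2) by blast
  qed
  have large: "m = p" if "m \<in> ?V" "prime p" "p dvd m" "n \<le> p + 1" for m p
  proof -
    obtain z where z: "z \<in> nonid (sym_group n)" "m = ord z" using \<open>m \<in> ?V\<close> by blast
    show ?thesis
      using exists_prime_perm_of_ord[OF z(1) \<open>prime p\<close> \<open>p dvd m\<close>[unfolded z(2)]] \<open>n \<le> p + 1\<close> z(2) by blast
  qed
  have pV: "p \<in> ?V" if "prime_perm n p x" for p x
    using prime_perm_ord[OF that] prime_perm_nonid[OF that] by force
  have "num_components ?V ord_adj = card (f ` ?V)"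
  proof (rule num_components_eq_card[OF symp_ord_adj])
    have *: "f m = f m'" if mm: "m \<in> ?V" "m' \<in> ?V" "m dvd m'" "m \<noteq> m'" for m m'
    proof -
      have "m \<noteq> 1" using mm(1) ord_eq_1 by (auto simp: nonid_def)
      then have "\<not> prime m'" using mm by (auto simp: prime_nat_iff)
      moreover have "\<not> (prime m \<and> n \<le> m + 1)" using large[OF mm(2) _ mm(3)] mm(4) by blast
      ultimately show ?thesis by (auto simp: f_def)
    qed
    fix m m' assume "m \<in> ?V" "m' \<in> ?V" "ord_adj m m'"
    then show "f m = f m'" using *[of m m'] *[of m' m] by (auto simp: ord_adj_def)
  next
    have to2: "conn ?V ord_adj m 2" if m: "m \<in> ?V" "f m = 0" for m
    proof -
      obtain p x where p: "prime p" "p dvd m" "prime_perm n p x" using V[OF m(1)] by blast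
      have n: "p + 1 < n"
      proof (rule ccontr)
        assume "\<not> p + 1 < n"
        moreover then have "m = p" using large[OF m(1) p(1,2)] by simp
        ultimately show False using m(2) p(1) by (auto simp: f_def)
      qed
      have "m = p \<or> ord_adj m p" using p(2) by (auto simp: ord_adj_def)
      then have "conn ?V ord_adj m p" using m(1) pV[OF p(3)] by (auto intro: conn_step)
      moreover have "conn ?V ord_adj p 2" if "p \<noteq> 2"
      proof -
        obtain c where c: "prime_perm n p c" "moved c = {1..p}"
          using exists_prime_cycle[OF p(1)] n by (metis add_lessD1 less_imp_le)
        \<comment> \<open>The cycle lives on \<open>{1..p}\<close> and \<open>p + 1 < n\<close>, so
          the last two points are free.\<close>
        have t: "prime_perm n 2 (transpose (n - 1) n)" using n by (intro prime_perm_transpose) auto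
        have sc: "sconn n c (transpose (n - 1) n)"
          by (rule sconn_moved_disjoint[OF c(1) t that]) (use n c(2) in \<open>auto simp: moved_transpose\<close>)
        show ?thesis using conn_ord[OF sc] by (simp only: prime_perm_ord[OF c(1)] prime_perm_ord[OF t])
      qed
      ultimately show ?thesis by (cases "p = 2") (auto intro: conn_trans)
    qed
    fix m m' assume m: "m \<in> ?V" "m' \<in> ?V" "f m = f m'"
    show "conn ?V ord_adj m m'"
    proof (cases "f m = 0")
      case True
      then show ?thesis
        using to2[OF m(1)] conn_sym[OF symp_ord_adj to2[OF m(2)]] m(3) by (auto intro: conn_trans)
    next
      case False
      then show ?thesis using m(3) by (auto simp: f_def split: if_splits)
    qed
  qed
  also have "f ` ?V = (if n \<ge> 4 then {0} else {}) \<union> {p. prime p \<and> n \<le> p + 1 \<and> p \<le> n}"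
  proof (intro equalityI subsetI)
    fix l assume "l \<in> f ` ?V"
    then obtain m where m: "m \<in> ?V" "l = f m" by blast
    obtain p x where p: "prime p" "p dvd m" "prime_perm n p x" using V[OF m(1)] by blast
    show "l \<in> (if n \<ge> 4 then {0} else {}) \<union> {p. prime p \<and> n \<le> p + 1 \<and> p \<le> n}"
    proof (cases "n \<le> p + 1")
      case True
      then have "l = p" using large[OF m(1) p(1,2)] m(2) p(1) by (simp add: f_def)
      then show ?thesis using True p prime_le_if_prime_perm[OF p(3)] by simp
    next
      case False
      then have "n \<ge> 4" using prime_ge_2_nat[OF p(1)] by linarith
      moreover have "prime m \<Longrightarrow> m = p" using p primes_dvd_imp_eq[of p m] by simp
      ultimately show ?thesis using False m(2) by (auto simp: f_def)
    qed
  next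
    fix l assume l: "l \<in> (if n \<ge> 4 then {0} else {}) \<union> {p. prime p \<and> n \<le> p + 1 \<and> p \<le> n}"
    show "l \<in> f ` ?V"
    proof (cases "prime l")
      case True
      then have "l \<noteq> 0" by auto
      then have "n \<le> l + 1" "l \<le> n" using l True by (auto split: if_splits)
      moreover obtain x where "prime_perm n l x" using exists_prime_cycle True calculation by blast
      ultimately show ?thesis using True by (intro image_eqI[OF _ pV]) (auto simp: f_def)
    next
      case False
      then have "l = 0" "n \<ge> 4" using l by (auto split: if_splits)
      moreover have "prime_perm n 2 (transpose 1 2)" using calculation by (intro prime_perm_transpose) auto
      ultimately show ?thesis by (intro image_eqI[OF _ pV]) (auto simp: f_def)
    qed
  qed
  finally show ?thesis by (simp add: c0_order_def)
qed

section \<open>Numbers of subgroups of prime order by type\<close>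

definition prime_type_groups :: "nat \<Rightarrow> nat \<Rightarrow> nat \<Rightarrow> (nat \<Rightarrow> nat) set set" where
  "prime_type_groups n p m = cyc_group n ` {x. prime_perm n p x \<and> card (moved x) = m}"

lemma finite_prime_type_groups [simp]: "finite (prime_type_groups n p m)"
proof -
  have "finite {x. prime_perm n p x \<and> card (moved x) = m}"
    by (rule finite_subset[OF _ finite_permutations[of "{1..n}"]]) (auto simp: prime_perm_def)
  then show ?thesis by (simp add: prime_type_groups_def)
qed

lemma prime_type_groups_disjoint:
  assumes "(p, m) \<noteq> (q, k)"
  shows "prime_type_groups n p m \<inter> prime_type_groups n q k = {}"
proof (rule ccontr)
  assume "\<not> ?thesis"
  then obtain x y where "prime_perm n p x" "card (moved x) = m" "prime_perm n q y" "card (moved y) = k"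
    "cyc_group n x = cyc_group n y"
    by (auto simp: prime_type_groups_def)
  then show False
    using assms moved_eq_if_cyc_group_eq[of n p x q y] ord_eq_if_cyc_group_eq[of n p x q y] by simp
qed

lemma card_prime_type_groups_cycles:
  "prime p \<Longrightarrow> card (prime_type_groups n p p) = (n choose p) * fact (p - 2)"
  using card_prime_cycle_groups[of p n] by (simp add: prime_type_groups_def prime_cycles_def)

text \<open>Once the partner of \<open>a\<close> is chosen among three points, the other two must be
  exchanged; so evaluation at \<open>a\<close> is a bijection.\<close>

lemma card_involutions_on_four:
  assumes S: "S \<subseteq> {1..n}" "card S = 4"
  shows "card {x. prime_perm n 2 x \<and> moved x = S} = 3"
proof -
  have fin: "finite S" using S finite_subset by blast
  obtain a where a: "a \<in> S" using S by fastforce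
  have "bij_betw (\<lambda>x. x a) {x. prime_perm n 2 x \<and> moved x = S} (S - {a})"
    unfolding bij_betw_def
  proof (intro conjI equalityI subsetI)
    have closed: "x z \<in> S" "x z \<noteq> z" if "prime_perm n 2 x" "moved x = S" "z \<in> S" for x z
      using that funpow_in_moved[OF that(1), of z 1] by (auto simp: moved_def)
    show "inj_on (\<lambda>x. x a) {x. prime_perm n 2 x \<and> moved x = S}"
    proof (rule inj_onI, clarify)
      fix x y assume x: "prime_perm n 2 x" "S = moved x" and y: "prime_perm n 2 y" "moved y = moved x"
        and eq: "x a = y a"
      note ix = involution_eq_iff[OF x(1)] and iy = involution_eq_iff[OF y(1)]
      have u: "x a \<in> S" "x a \<noteq> a" using closed[OF x(1)] x(2) a by auto
      have "card (S - {a, x a}) = 2" using S(2) a u fin by (simp add: card_Diff_subset)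
      then obtain v w where vw: "S - {a, x a} = {v, w}" "v \<noteq> w" by (auto simp: card_2_iff)
      have Se: "S = {a, x a, v, w}" using vw a u by blast
      have "v \<in> S" using vw by blast
      then have cv: "x v \<in> S" "x v \<noteq> v" "y v \<in> S" "y v \<noteq> v"
        using closed[OF x(1) x(2)[symmetric]] closed[OF y(1) trans[OF y(2) x(2)[symmetric]]] by blast+
      have dist: "v \<noteq> a" "w \<noteq> a" "v \<noteq> x a" "w \<noteq> x a" using vw by blast+
      have xv: "x v = w" using cv(1,2) dist unfolding Se by (auto simp: ix involution_involutive[OF x(1)])
      have yv: "y v = w" using cv(3,4) dist unfolding Se eq by (auto simp: iy involution_involutive[OF y(1)])
      show "x = y"
      proof
        fix z
        consider "z = a" | "z = x a" | "z = v" | "z = w" | "z \<notin> S" using Se by blast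
        then show "x z = y z"
        proof cases
          case 2
          then show ?thesis using eq involution_involutive[OF x(1), of a] involution_involutive[OF y(1), of a] by simp
        next
          case 4
          then show ?thesis using xv yv involution_involutive[OF x(1), of v] involution_involutive[OF y(1), of v] by simp
        next
          case 5
          then show ?thesis using x(2) y(2) in_moved_iff by metis
        qed (use eq xv yv in simp_all)
      qed
    qed
    fix u
    show "u \<in> S - {a}" if "u \<in> (\<lambda>x. x a) ` {x. prime_perm n 2 x \<and> moved x = S}"
      using that closed a by auto
    assume u: "u \<in> S - {a}"
    have "card (S - {a, u}) = 2" using S(2) a u fin by (simp add: card_Diff_subset)
    then obtain v w where vw: "S - {a, u} = {v, w}" "v \<noteq> w" by (auto simp: card_2_iff)
    have Se: "S = {a, u, v, w}" using vw a u by blast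
    have dist: "v \<noteq> a" "w \<noteq> a" "v \<noteq> u" "w \<noteq> u" "u \<noteq> a" using vw u by blast+
    define x where "x = transpose a u \<circ> transpose v w"
    have mx: "moved x = S" unfolding Se x_def using dist vw(2) by (auto simp: moved_def transpose_def)
    have "x ^^ 2 = id" unfolding x_def using dist vw(2) by (auto simp: numeral_2_eq_2 fun_eq_iff transpose_def)
    then have "prime_perm n 2 x" using mx S(1) a by (intro prime_permI[of _ _ _ a]) auto
    moreover have "x a = u" using dist vw(2) by (simp add: x_def transpose_def)
    ultimately show "u \<in> (\<lambda>x. x a) ` {x. prime_perm n 2 x \<and> moved x = S}" using mx by blast
  qed
  then show ?thesis using bij_betw_same_card S(2) a fin by fastforce
qed

text \<open>A group of order two has a single generator, so the involutions themselves can be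
  counted: three on each set of four points.\<close>

lemma card_prime_type_groups_double:
  "card (prime_type_groups n 2 4) = 3 * (n choose 4)"
proof -
  let ?A = "{x. prime_perm n 2 x \<and> card (moved x) = 4}"
  have "inj_on (cyc_group n) ?A"
  proof (rule inj_onI, clarify)
    fix x y assume x: "prime_perm n 2 x" and y: "prime_perm n 2 y" and eq: "cyc_group n x = cyc_group n y"
    obtain k where k: "y = x ^^ k" using funpow_if_cyc_group_eq[OF x y eq] .
    then have "y a = (x ^^ (k mod 2)) a" for a using funpow_mod[OF x, of k a] by simp
    moreover have "y \<noteq> id" using y by (simp add: prime_perm_def)
    ultimately have "k mod 2 \<noteq> 0" by (metis ext funpow_0 id_apply)
    then have "k mod 2 = 1" by simp
    then have "y a = x a" for a using \<open>\<And>a. y a = (x ^^ (k mod 2)) a\<close>[of a] by simp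
    then show "x = y" by auto
  qed
  then have "card (prime_type_groups n 2 4) = card ?A" by (simp add: prime_type_groups_def card_image)
  also have "?A = (\<Union>S\<in>{S. S \<subseteq> {1..n} \<and> card S = 4}. {x. prime_perm n 2 x \<and> moved x = S})"
    using moved_subset by auto
  also have "card \<dots> = (\<Sum>S\<in>{S. S \<subseteq> {1..n} \<and> card S = 4}. card {x. prime_perm n 2 x \<and> moved x = S})"
  proof (rule card_UN_disjoint)
    have "finite {x. prime_perm n 2 x \<and> moved x = S}" for S
      by (rule finite_subset[OF _ finite_permutations[of "{1..n}"]]) (auto simp: prime_perm_def)
    then show "\<forall>S\<in>{S. S \<subseteq> {1..n} \<and> card S = 4}. finite {x. prime_perm n 2 x \<and> moved x = S}"
      by simp
  qed auto
  also have "\<dots> = 3 * (n choose 4)"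
    using card_involutions_on_four[of _ n] n_subsets[of "{1..n}" 4] by simp
  finally show ?thesis .
qed

section \<open>Elements moving exactly six points\<close>

text \<open>For distinct points, the product of three disjoint transpositions, viewed as the perfect
  matching \<open>ab | cd | ef\<close> of six points.\<close>

definition matching3 :: "'a \<Rightarrow> 'a \<Rightarrow> 'a \<Rightarrow> 'a \<Rightarrow> 'a \<Rightarrow> 'a \<Rightarrow> 'a \<Rightarrow> 'a" where
  "matching3 a b c d e f z =
    (if z = a then b else if z = b then a else if z = c then d else if z = d then c
     else if z = e then f else if z = f then e else z)"

lemma moved_matching3:
  "distinct [a, b, c, d, e, f] \<Longrightarrow> moved (matching3 a b c d e f) = {a, b, c, d, e, f}"
  by (auto simp: moved_def matching3_def)

lemma prime_perm_matching3:
  assumes d: "distinct [a, b, c, d, e, f]" and "{a, b, c, d, e, f} \<subseteq> {1..n}"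
  shows "prime_perm n 2 (matching3 a b c d e f)"
proof (rule prime_permI[of _ _ _ a])
  show "matching3 a b c d e f ^^ 2 = id"
    using d by (auto simp: numeral_2_eq_2 matching3_def fun_eq_iff)
qed (use assms in \<open>auto simp: moved_matching3\<close>)

lemma involution_eq_matching3:
  assumes x: "prime_perm n 2 x" and "moved x \<subseteq> {a, b, c, d, e, f}"
    and "distinct [a, b, c, d, e, f]" and v: "x a = b" "x c = d" "x e = f"
  shows "x = matching3 a b c d e f"
proof
  fix z
  have "x b = a" "x d = c" "x f = e" using v involution_involutive[OF x] by metis+
  moreover have "x z = z" if "z \<notin> {a, b, c, d, e, f}" using that assms(2) by (auto simp: moved_def)
  ultimately show "x z = matching3 a b c d e f z" using v by (auto simp: matching3_def)
qed

text \<open>Both matchings commute with the element of order three rotating \<open>a, c, e\<close> and \<open>b, d, f\<close>.\<close>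

lemma sconn_matching3_rotate:
  assumes d: "distinct [a, b, c, d, e, f]" and s: "{a, b, c, d, e, f} \<subseteq> {1..n}"
  shows "sconn n (matching3 a b c d e f) (matching3 a d c f e b)"
proof -
  let ?y = "double_cycle3 a c e b d f"
  have y: "prime_perm n 3 ?y" using d s by (intro prime_perm_double_cycle3) auto
  have ne: "a \<noteq> b" "a \<noteq> c" "a \<noteq> d" "a \<noteq> e" "a \<noteq> f" "b \<noteq> c" 
    "b \<noteq> d" "b \<noteq> e" "b \<noteq> f" "c \<noteq> d" "c \<noteq> e" "c \<noteq> f" 
    "d \<noteq> e" "d \<noteq> f" "e \<noteq> f"
    using d by auto
  have cases6: "z = a \<or> z = b \<or> z = c \<or> z = d \<or> z = e \<or> z = f \<or>
    z \<noteq> a \<and> z \<noteq> b \<and> z \<noteq> c \<and> z \<noteq> d \<and> z \<noteq> e \<and> z \<noteq> f" for z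
    by blast
  have "(matching3 a b c d e f \<circ> ?y) z = (?y \<circ> matching3 a b c d e f) z" for z
    using cases6[of z] by (elim disjE) (simp_all add: matching3_def double_cycle3_def ne ne[symmetric])
  then have "matching3 a b c d e f \<circ> ?y = ?y \<circ> matching3 a b c d e f" ..
  then have "sconn n (matching3 a b c d e f) ?y"
    by (intro sconn_commute[OF prime_perm_matching3[OF d s] y]) simp_all
  moreover have d': "distinct [a, d, c, f, e, b]" "{a, d, c, f, e, b} \<subseteq> {1..n}" using d s by auto
  have "(matching3 a d c f e b \<circ> ?y) z = (?y \<circ> matching3 a d c f e b) z" for z
    using cases6[of z] by (elim disjE) (simp_all add: matching3_def double_cycle3_def ne ne[symmetric])
  then have "matching3 a d c f e b \<circ> ?y = ?y \<circ> matching3 a d c f e b" ..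
  then have "sconn n (matching3 a d c f e b) ?y"
    by (intro sconn_commute[OF prime_perm_matching3[OF d'] y]) simp_all
  ultimately show ?thesis by (blast intro: conn_trans pconn_sym)
qed

text \<open>Both matchings are one rotation away from \<open>ac | de | fb\<close>. The rewriting
  only reorders pairs and their entries to bring them into the form of
  \<open>sconn_matching3_rotate\<close>.\<close>

lemma sconn_matching3_share:
  assumes d: "distinct [a, b, c, d, e, f]" and s: "{a, b, c, d, e, f} \<subseteq> {1..n}"
  shows "sconn n (matching3 a b c d e f) (matching3 a b c e d f)"
proof -
  have "matching3 a b c d e f = matching3 a b d c f e" "matching3 a b c e d f = matching3 a b e c f d"
    "matching3 a c e d f b = matching3 a c d e f b"
    using d by (auto simp: matching3_def fun_eq_iff)
  moreover have "sconn n (matching3 a b d c f e) (matching3 a c d e f b)"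
    using d s by (intro sconn_matching3_rotate) auto
  moreover have "sconn n (matching3 a b e c f d) (matching3 a c e d f b)"
    using d s by (intro sconn_matching3_rotate) auto
  ultimately show ?thesis by (metis conn_trans pconn_sym)
qed

text \<open>Two perfect matchings of six points are compared by their shared pairs. Two shared pairs
  force the third and hence equality; with one, \<open>sconn_matching3_share\<close> applies; with
  none, the union is a hexagon and \<open>sconn_matching3_rotate\<close> applies.\<close>

lemma sconn_six_involutions:
  assumes x: "prime_perm n 2 x" and y: "prime_perm n 2 y"
    and mv: "moved y = moved x" and card: "card (moved x) = 6"
  shows "sconn n x y"
proof -
  define S where "S = moved x"
  have fin: "finite S" and c6: "card S = 6" and Sn: "S \<subseteq> {1..n}"
    using finite_moved[OF x] card moved_subset[OF x] by (simp_all add: S_def)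
  have clx: "x z \<in> S" "x z \<noteq> z" if "z \<in> S" for z
    using that funpow_in_moved[OF x, of z 1] by (auto simp: S_def moved_def)
  have cly: "y z \<in> S" "y z \<noteq> z" if "z \<in> S" for z
    using that funpow_in_moved[OF y, of z 1] mv by (auto simp: S_def moved_def)
  have xx: "x (x z) = z" and yy: "y (y z) = z" for z
    using involution_involutive x y by blast+
  have ex: "\<exists>z. z \<in> S \<and> z \<notin> T" if "finite T" "card T \<le> 4" for T
  proof (rule ccontr)
    assume "\<not> ?thesis"
    then have "S \<subseteq> T" by blast
    then have "card S \<le> card T" by (rule card_mono[OF that(1)])
    then show False using that(2) c6 by simp
  qed
  have full: "S = {a, b, c, d, e, f}" if "distinct [a, b, c, d, e, f]" "{a, b, c, d, e, f} \<subseteq> S" for a b c d e f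
    using card_subset_eq[OF fin that(2)] distinct_card[OF that(1)] c6 by simp
  have xM: "x = matching3 a b c d e f"
    if "distinct [a, b, c, d, e, f]" "S = {a, b, c, d, e, f}" "x a = b" "x c = d" "x e = f" for a b c d e f
    using involution_eq_matching3[OF x _ that(1,3-5)] that(2) by (simp add: S_def)
  have yM: "y = matching3 a b c d e f"
    if "distinct [a, b, c, d, e, f]" "S = {a, b, c, d, e, f}" "y a = b" "y c = d" "y e = f" for a b c d e f
    using involution_eq_matching3[OF y _ that(1,3-5)] that(2) mv by (simp add: S_def)
  obtain a where a: "a \<in> S" using ex[of "{}"] by (metis card.empty finite.emptyI zero_le)
  define b where "b = x a"
  have b: "b \<in> S" "b \<noteq> a" "x b = a" using clx[OF a] xx by (auto simp: b_def)
  show ?thesis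
  proof (cases "y a = b")
    case True
    have yb: "y b = a" using True yy by metis
    obtain c where c: "c \<in> S" "c \<notin> {a, b}" using ex[of "{a, b}"] card_length[of "[a, b]"] by auto
    define d where "d = x c"
    have d: "d \<in> S" "d \<noteq> c" "x d = c" using clx[OF c(1)] xx by (auto simp: d_def)
    have d': "d \<noteq> a" "d \<noteq> b" using d(3) b(3) c(2) b_def by auto
    show ?thesis
    proof (cases "y c = d")
      case yc: True
      have yd: "y d = c" using yc yy by metis
      obtain e where e: "e \<in> S" "e \<notin> {a, b, c, d}"
        using ex[of "{a, b, c, d}"] card_length[of "[a, b, c, d]"] by auto
      define f where "f = x e"
      have f: "f \<in> S" "f \<noteq> e" "x f = e" using clx[OF e(1)] xx by (auto simp: f_def)
      have f': "f \<notin> {a, b, c, d}" using f(3) b(3) d(3) e(2) b_def d_def by auto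
      have dist: "distinct [a, b, c, d, e, f]" using b c d d' e f f' by auto
      then have Se: "S = {a, b, c, d, e, f}" by (rule full) (use a b c d e f in auto)
      have "y e \<notin> {a, b, c, d, e}"
        using cly(2)[OF e(1)] yy[of e] e(2) True yb yc yd by auto
      then have "y e = f" using cly(1)[OF e(1)] Se by blast
      then have "y = matching3 a b c d e f" using True yc by (intro yM dist Se)
      moreover have "x = matching3 a b c d e f" by (intro xM dist Se) (simp_all add: b_def d_def f_def)
      ultimately show ?thesis by simp
    next
      case yc: False
      define e where "e = y c"
      have e: "e \<in> S" "e \<notin> {a, b, c, d}" "y e = c"
        using cly[OF c(1)] yc yy[of c] c(2) True yb by (auto simp: e_def)
      define f where "f = x e"
      have f: "f \<in> S" "f \<noteq> e" "x f = e" using clx[OF e(1)] xx by (auto simp: f_def)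
      have f': "f \<notin> {a, b, c, d}" using f(3) b(3) d(3) e(2) b_def d_def by auto
      have dist: "distinct [a, b, c, d, e, f]" using b c d d' e f f' by auto
      then have Se: "S = {a, b, c, d, e, f}" by (rule full) (use a b c d e f in auto)
      have "y d \<notin> {a, b, c, d, e}"
        using cly(2)[OF d(1)] yy[of d] d(2) d' e(2,3) True yb e_def by auto
      then have "y d = f" using cly(1)[OF d(1)] Se by blast
      then have "y = matching3 a b c e d f" using True dist Se by (intro yM) (auto simp: e_def)
      moreover have "x = matching3 a b c d e f" by (intro xM dist Se) (simp_all add: b_def d_def f_def)
      ultimately show ?thesis using sconn_matching3_share[OF dist] Se Sn by simp
    qed
  next
    case False
    define d where "d = y a"
    have d: "d \<in> S" "d \<noteq> a" "d \<noteq> b" "y d = a" using cly[OF a] False yy by (auto simp: d_def)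
    define c where "c = x d"
    have c: "c \<in> S" "c \<noteq> d" "x c = d" using clx[OF d(1)] xx by (auto simp: c_def)
    have c': "c \<noteq> a" "c \<noteq> b" using c(3) b(3) d b_def by auto
    \<comment> \<open>The pairs of \<open>x\<close> and \<open>y\<close> alternate around the
      hexagon \<open>a, b, e, f, c, d\<close>.\<close>
    have rot: ?thesis if e: "e \<in> S" "e \<notin> {a, b, c, d}" "y b = e" for e
    proof -
      define f where "f = x e"
      have f: "f \<in> S" "f \<noteq> e" "x f = e" using clx[OF e(1)] xx by (auto simp: f_def)
      have f': "f \<notin> {a, b, c, d}" using f(3) b(3) c(3) e(2) b_def c_def by auto
      have dist: "distinct [a, b, c, d, e, f]" using b c c' d e f f' by auto
      then have Se: "S = {a, b, c, d, e, f}" by (rule full) (use a b c d e f in auto)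
      have ye: "y e = b" using e(3) yy by metis
      have "y c \<notin> {a, b, c, d, e}"
        using cly(2)[OF c(1)] yy[of c] c c' d e(2,3) ye d_def by auto
      then have "y c = f" using cly(1)[OF c(1)] Se by blast
      then have "y = matching3 a d c f e b" using dist Se ye by (intro yM) (auto simp: d_def)
      moreover have "x = matching3 a b c d e f" using c(3) by (intro xM dist Se) (simp_all add: b_def f_def)
      ultimately show ?thesis using sconn_matching3_rotate[OF dist] Se Sn by simp
    qed
    show ?thesis
    proof (cases "y b = c")
      case True
      have yc: "y c = b" using True yy by metis
      obtain e where e: "e \<in> S" "e \<notin> {a, b, c, d}"
        using ex[of "{a, b, c, d}"] card_length[of "[a, b, c, d]"] by auto
      define f where "f = x e"
      have f: "f \<in> S" "f \<noteq> e" "x f = e" using clx[OF e(1)] xx by (auto simp: f_def)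
      have f': "f \<notin> {a, b, c, d}" using f(3) b(3) c(3) e(2) b_def c_def by auto
      \<comment> \<open>The pairs of \<open>x\<close> and \<open>y\<close> alternate around the
        square \<open>a, b, c, d\<close>, so the shared pair is \<open>e, f\<close>; it comes first
        in the notation.\<close>
      have dist: "distinct [e, f, a, b, d, c]" using b c c' d e f f' by auto
      then have Se: "S = {e, f, a, b, d, c}" by (rule full) (use a b c d e f in auto)
      have "y e \<notin> {a, b, c, d, e}"
        using cly(2)[OF e(1)] yy[of e] e(2) True yc d(4) d_def by auto
      then have "y e = f" using cly(1)[OF e(1)] Se by blast
      then have "y = matching3 e f a d b c" using True dist Se by (intro yM) (auto simp: d_def)
      moreover have "x = matching3 e f a b d c"
        by (intro xM dist Se) (simp_all add: b_def f_def c_def)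
      ultimately show ?thesis using sconn_matching3_share[OF dist] Se Sn by simp
    next
      case yb: False
      have "y b \<notin> {a, b, c, d}" using cly(2)[OF b(1)] yb yy[of b] b(2) d d_def by auto
      then show ?thesis using rot[of "y b"] cly(1)[OF b(1)] by simp
    qed
  qed
qed

lemma card_orb_Un:
  assumes x: "prime_perm n p x" and a: "a \<in> moved x" and b: "b \<in> moved x" "b \<notin> orb x a"
  shows "card (orb x a \<union> orb x b) = 2 * p"
proof -
  have "finite (orb x c)" for c by (simp add: orb_eq_image[OF x])
  then have "card (orb x a \<union> orb x b) = card (orb x a) + card (orb x b)"
    using orb_disjoint[OF x b(2)] by (intro card_Un_disjoint)
  then show ?thesis using card_orb[OF x a] card_orb[OF x b(1)] by simp
qed

text \<open>A prime order dividing 6 is 2 or 3. Order 3 reduces to order 2 by the involution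
  exchanging the two orbits, whose support is the same six points.\<close>

lemma sconn_six:
  assumes x: "prime_perm n p x" and y: "prime_perm n q y"
    and mv: "moved x = moved y" and card: "card (moved x) = 6"
  shows "sconn n x y"
proof -
  have inv: "\<exists>z. prime_perm n 2 z \<and> moved z = moved u \<and> sconn n u z"
    if u: "prime_perm n r u" and c6: "card (moved u) = 6" for r u
  proof (cases "r = 2")
    case True
    then show ?thesis using u by auto
  next
    case False
    have "r dvd 2 * 3" using dvd_card_moved[OF u] c6 by simp
    then have "r dvd 2 \<or> r dvd 3" using prime_perm_prime[OF u] by (simp only: prime_dvd_mult_iff)
    then have "r = 3" using False prime_perm_prime[OF u] primes_dvd_imp_eq[of r 2] primes_dvd_imp_eq[of r 3] by auto
    obtain a where a: "a \<in> moved u" using moved_nonempty[OF u] by blast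
    obtain b where b: "b \<in> moved u" "b \<notin> orb u a"
      using exists_second_orb[OF u _ a] c6 \<open>r = 3\<close> by auto
    obtain z where z: "prime_perm n 2 z" "moved z = orb u a \<union> orb u b" "u \<circ> z = z \<circ> u"
      using u a b by (rule exists_swap_involution)
    have "moved z = moved u"
      unfolding z(2) using card_orb_Un[OF u a b] orb_subset_moved[OF u] a b(1) c6 \<open>r = 3\<close>
      by (intro card_subset_eq finite_moved[OF u]) auto
    moreover have "sconn n u z" using z(1,3) u False by (intro sconn_commute)
    ultimately show ?thesis using z(1) by blast
  qed
  obtain x' where x': "prime_perm n 2 x'" "moved x' = moved x" "sconn n x x'" using inv[OF x card] by blast
  obtain y' where y': "prime_perm n 2 y'" "moved y' = moved y" "sconn n y y'" using inv[OF y] card mv by auto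
  have "sconn n x' y'" using x' y' mv card by (intro sconn_six_involutions) auto
  then show ?thesis using x'(3) y'(3) by (blast intro: conn_trans pconn_sym)
qed

text \<open>At most one point lies outside the support of \<open>y\<close>, so \<open>x\<close>
  moves nothing there. If \<open>x\<close> fixed a point of the support, it would fix its orbit,
  hence preserve the other orbit, and by coprimality fix that one too; but \<open>x\<close> is not
  the identity.\<close>

lemma moved_eq_six:
  assumes x: "prime_perm n 2 x" and y: "prime_perm n 3 y" and c: "x \<circ> y = y \<circ> x"
    and card: "card (moved y) = 6" and n: "n \<le> 7"
  shows "moved x = moved y"
proof -
  have xi: "inj x" using prime_perm_inj[OF x] .
  have cl: "x z \<in> moved y" if "z \<in> moved y" for z
    using moved_closed_if_commute[OF c xi that] .
  have sub: "moved x \<subseteq> moved y"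
  proof
    fix r assume r: "r \<in> moved x"
    show "r \<in> moved y"
    proof (rule ccontr)
      assume ry: "r \<notin> moved y"
      have "x r \<notin> moved y" using cl[of "x r"] ry by (auto simp: involution_involutive[OF x])
      moreover have "x r \<noteq> r" "x r \<in> {1..n}" "r \<in> {1..n}"
        using r moved_subset[OF x] funpow_in_moved[OF x r, of 1] by (auto simp: moved_def)
      ultimately have "{r, x r} \<subseteq> {1..n} - moved y" "card {r, x r} = 2" using ry by auto
      then have "2 \<le> card ({1..n} - moved y)" using card_mono[of "{1..n} - moved y"] by (metis finite_Diff finite_atLeastAtMost)
      then show False using card_compl[OF moved_subset[OF y]] card n by simp
    qed
  qed
  moreover have "a \<in> moved x" if a: "a \<in> moved y" for a
  proof (rule ccontr)
    assume "a \<notin> moved x"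
    then have xa: "x a = a" by (simp add: moved_def)
    obtain b where b: "b \<in> moved y" "b \<notin> orb y a"
      using exists_second_orb[OF y _ a] card by auto
    have "moved y = orb y a \<union> orb y b"
      using card_orb_Un[OF y a b] orb_subset_moved[OF y] a b(1) card
      by (intro card_subset_eq[symmetric] finite_moved[OF y]) auto
    moreover have fa: "x z = z" if "z \<in> orb y a" for z using fixes_orb_if_commute[OF c xa that] .
    moreover have "x b \<notin> orb y a"
      using fa[of "x b"] b(2) involution_involutive[OF x] by metis
    ultimately have "x b \<in> orb y b" using cl[OF b(1)] by blast
    then have "x z = z" if "z \<in> orb y b" for z
      using fixes_orb_if_coprime[OF y x _ c b(1)] that by simp
    then have "x z = z" if "z \<in> moved y" for z
      using fa that \<open>moved y = orb y a \<union> orb y b\<close> by blast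
    then show False using sub moved_nonempty[OF x] by (auto simp: moved_def)
  qed
  ultimately show ?thesis by blast
qed

section \<open>Values of \<open>c0\<close> and \<open>c0_order\<close>\<close>

lemma card_image_label [simp]: "card (Gen ` A) = card A" "card (Supp ` B) = card B"
  by (auto intro!: card_image inj_onI)

lemma prime_perm_bounds:
  assumes "prime_perm n p x"
  shows "prime p" "2 \<le> p" "p \<le> n" "p dvd card (moved x)" "1 \<le> card (moved x)" "card (moved x) \<le> n"
  using prime_perm_prime[OF assms] prime_ge_2_nat prime_le_if_prime_perm[OF assms]
    dvd_card_moved[OF assms] card_moved_pos[OF assms] card_moved_le[OF assms] by auto

lemma ord_bound_if_commuting:
  assumes "prime_perm n p x" "prime_perm n q y" "p < q" "x \<circ> y = y \<circ> x"
  shows "q + 1 < n"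
  using no_commuting_prime_perm[OF assms(2) _ assms(1) assms(4)] assms(3) by fastforce

lemma prime_type_groupsI: "prime_perm n p x \<Longrightarrow> card (moved x) = m \<Longrightarrow> cyc_group n x \<in> prime_type_groups n p m"
  by (simp add: prime_type_groups_def)

lemma prime_type_groupsE:
  assumes "C \<in> prime_type_groups n p m"
  obtains x where "prime_perm n p x" "card (moved x) = m" "C = cyc_group n x"
  using assms by (auto simp: prime_type_groups_def)

lemma cyc_groups_eq_UN_types:
  assumes "\<And>p x. prime_perm n p x \<Longrightarrow> (p, card (moved x)) \<in> K"
  shows "{cyc_group n x |p x. prime_perm n p x} = (\<Union>(p, m)\<in>K. prime_type_groups n p m)"
  unfolding prime_type_groups_def using assms by fastforce

section \<open>Degrees 2 to 7\<close>

lemma c0_sym_group_le_4: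
  assumes "n \<le> 4"
  shows "c0 (sym_group n) = card {cyc_group n x |p x. prime_perm n p x}"
proof -
  have "c0 (sym_group n) = card {Gen (cyc_group n x) |p x. prime_perm n p x}"
  proof (rule c0_sym_group_labels[where h = "\<lambda>_ _ C. Gen C"])
    fix p q x y assume a: "prime_perm n p x" "prime_perm n q y" "p < q" "x \<circ> y = y \<circ> x"
    \<comment> \<open>This contradicts \<open>2 \<le> p < q\<close> and \<open>n \<le> 4\<close>: no
      elements of distinct prime orders commute, and each subgroup of prime order gives its own
      component.\<close>
    have "q + 1 < n" using a by (rule ord_bound_if_commuting)
    then show "Gen (cyc_group n x) = Gen (cyc_group n y)"
      using assms prime_perm_bounds(2)[OF a(1)] a(3) by simp
  qed (auto intro: sconn_generate)
  also have "{Gen (cyc_group n x) |p x. prime_perm n p x} = Gen ` {cyc_group n x |p x. prime_perm n p x}"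
    by auto
  finally show ?thesis by simp
qed

lemma c0_sym_group_2: "c0 (sym_group 2) = 1"
proof -
  have *: "p = 2 \<and> card (moved x) = 2" if "prime_perm 2 p x" for p x
  proof -
    have "p = 2" "card (moved x) = 1 \<or> card (moved x) = 2"
      using prime_perm_bounds[OF that] by linarith+
    then show ?thesis using prime_perm_bounds(4)[OF that] by auto
  qed
  have "{cyc_group 2 x |p x. prime_perm 2 p x} = prime_type_groups 2 2 2"
    using * by (subst cyc_groups_eq_UN_types[where K = "{(2, 2)}"]) auto
  then show ?thesis
    using c0_sym_group_le_4[of 2] card_prime_type_groups_cycles[of 2 2] by simp
qed

text \<open>Three groups of transpositions and one of 3-cycles.\<close>

lemma c0_sym_group_3: "c0 (sym_group 3) = 4"
proof -
  have *: "p = 2 \<and> card (moved x) = 2 \<or> p = 3 \<and> card (moved x) = 3" if "prime_perm 3 p x" for p x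
  proof -
    have "p = 2 \<or> p = 3" "card (moved x) = 1 \<or> card (moved x) = 2 \<or> card (moved x) = 3"
      using prime_perm_bounds[OF that] by linarith+
    then show ?thesis using prime_perm_bounds(4)[OF that] by auto
  qed
  have "{cyc_group 3 x |p x. prime_perm 3 p x} = prime_type_groups 3 2 2 \<union> prime_type_groups 3 3 3"
    using * by (subst cyc_groups_eq_UN_types[where K = "{(2, 2), (3, 3)}"]) auto
  then show ?thesis
    using c0_sym_group_le_4[of 3] card_prime_type_groups_cycles[of 2 3] card_prime_type_groups_cycles[of 3 3]
    by (simp add: card_Un_disjoint prime_type_groups_disjoint choose_two)
qed

text \<open>Six groups of transpositions, three of double transpositions and four of
  3-cycles.\<close>

lemma c0_sym_group_4: "c0 (sym_group 4) = 13"
proof -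
  have *: "p = 2 \<and> card (moved x) = 2 \<or> p = 2 \<and> card (moved x) = 4 \<or> p = 3 \<and> card (moved x) = 3"
    if "prime_perm 4 p x" for p x
  proof -
    have "p = 2 \<or> p = 3 \<or> p = 4" "card (moved x) = 1 \<or> card (moved x) = 2 \<or> card (moved x) = 3 \<or> card (moved x) = 4"
      using prime_perm_bounds[OF that] by linarith+
    then show ?thesis using prime_perm_bounds(1,4)[OF that] by auto
  qed
  have "{cyc_group 4 x |p x. prime_perm 4 p x} =
      prime_type_groups 4 2 2 \<union> (prime_type_groups 4 2 4 \<union> prime_type_groups 4 3 3)"
    using * by (subst cyc_groups_eq_UN_types[where K = "{(2, 2), (2, 4), (3, 3)}"]) auto
  moreover have "(4 choose 3) = (4::nat)" by code_simp
  ultimately show ?thesis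
    using c0_sym_group_le_4[of 4] card_prime_type_groups_cycles[of 2 4] card_prime_type_groups_cycles[of 3 4]
      card_prime_type_groups_double[of 4]
    by (simp add: card_Un_disjoint prime_type_groups_disjoint Int_Un_distrib choose_two)
qed

text \<open>A transposition is joined to the 3-cycles on the complementary three points; the common
  label is the pair that it moves and they fix. Groups of 5-cycles and of double transpositions stay
  alone, which gives 6 + 15 + 10 components.\<close>

lemma c0_sym_group_5: "c0 (sym_group 5) = 31"
proof -
  define h where "h p S C = (if p = 5 \<or> card S = 4 then Gen C else if p = 2 then Supp S else Supp ({1..5} - S))"
    for p :: nat and S :: "nat set" and C
  have *: "p = 2 \<and> card (moved x) = 2 \<or> p = 2 \<and> card (moved x) = 4 \<or> p = 3 \<and> card (moved x) = 3
      \<or> p = 5 \<and> card (moved x) = 5"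
    if "prime_perm 5 p x" for p x
  proof -
    have "p = 2 \<or> p = 3 \<or> p = 4 \<or> p = 5"
      "card (moved x) = 1 \<or> card (moved x) = 2 \<or> card (moved x) = 3 \<or> card (moved x) = 4 \<or> card (moved x) = 5"
      using prime_perm_bounds[OF that] by linarith+
    then show ?thesis using prime_perm_bounds(1,4)[OF that] by auto
  qed
  have "c0 (sym_group 5) = card {h p (moved x) (cyc_group 5 x) |p x. prime_perm 5 p x}"
  proof (rule c0_sym_group_labels)
    fix p q x y assume x: "prime_perm 5 p x" and y: "prime_perm 5 q y" and pq: "p < q" and c: "x \<circ> y = y \<circ> x"
    have "q + 1 < 5" using x y pq c by (rule ord_bound_if_commuting)
    then have p: "p = 2" "q = 3" "card (moved y) = 3" using *[OF x] *[OF y] pq by auto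
    have "moved y \<inter> moved x = {}"
      using moved_disjoint_if_coprime_cycle[OF y x _ c] p by simp
    then have sub: "moved x \<subseteq> {1..5} - moved y" using moved_subset[OF x] by blast
    have c2: "card ({1..5} - moved y) = 2" using card_compl[OF moved_subset[OF y]] p(3) by simp
    then have "card (moved x) = 2" using card_mono[OF _ sub] *[OF x] p by auto
    moreover then have "moved x = {1..5} - moved y" using sub c2 by (intro card_subset_eq) auto
    ultimately show "h p (moved x) (cyc_group 5 x) = h q (moved y) (cyc_group 5 y)"
      using p by (simp add: h_def)
  next
    \<comment> \<open>The transposition of the pair serves as centre of the component labelled by
      that pair.\<close>
    have tr: "sconn 5 x (transpose a b)"
      if x: "prime_perm 5 p x" and hx: "h p (moved x) (cyc_group 5 x) = Supp {a, b}" and ab: "a \<noteq> b"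
        "{a, b} \<subseteq> {1..5}" for p x a b
    proof -
      have t: "prime_perm 5 2 (transpose a b)" using ab by (intro prime_perm_transpose) auto
      consider "p = 2" "card (moved x) = 2" | "p = 3" "card (moved x) = 3"
        using *[OF x] hx by (auto simp: h_def)
      then show ?thesis
      proof cases
        case 1
        then have mx: "moved x = {a, b}" using hx by (simp add: h_def)
        have "x a \<in> {a, b}" "x a \<noteq> a"
          using funpow_in_moved[OF x, of a 1] mx by (auto simp: moved_def)
        then have xab: "x a = b" by simp
        have "x z = transpose a b z" for z
        proof (cases "z \<in> moved x")
          case True
          then show ?thesis using mx xab involution_involutive[of 5 x a] x 1 by auto
        next
          case False
          then show ?thesis using mx in_moved_iff[of z x] by (auto simp: transpose_def)
        qed
        then show ?thesis using conn_refl by (metis ext)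
      next
        case 2
        then have "{1..5} - moved x = {a, b}" using hx by (simp add: h_def)
        then have "moved x \<inter> moved (transpose a b) = {}" by (auto simp: moved_transpose[OF ab(1)])
        then show ?thesis using sconn_moved_disjoint[OF x t] 2 by simp
      qed
    qed
    fix p q x y assume x: "prime_perm 5 p x" and y: "prime_perm 5 q y"
      and eq: "h p (moved x) (cyc_group 5 x) = h q (moved y) (cyc_group 5 y)"
    show "sconn 5 x y"
    proof (cases "h p (moved x) (cyc_group 5 x)")
      case Main
      then show ?thesis by (simp add: h_def split: if_splits)
    next
      case (Gen C)
      then have "cyc_group 5 x = cyc_group 5 y" using eq by (simp add: h_def split: if_splits)
      then show ?thesis by (rule sconn_generate[OF x y])
    next
      case (Supp T)
      have "card ({1..5} - moved x) = 5 - card (moved x)" by (rule card_compl[OF moved_subset[OF x]])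
      then have "card T = 2" "T \<subseteq> {1..5}" using Supp *[OF x] moved_subset[OF x]
        by (auto simp: h_def split: if_splits)
      then obtain a b where T: "T = {a, b}" "a \<noteq> b" "{a, b} \<subseteq> {1..5}" by (auto simp: card_2_iff)
      show ?thesis using tr[OF x _ T(2,3)] tr[OF y _ T(2,3)] Supp eq T(1) by (auto intro: conn_trans pconn_sym)
    qed
  qed
  also have "{h p (moved x) (cyc_group 5 x) |p x. prime_perm 5 p x} =
      Gen ` (prime_type_groups 5 5 5 \<union> prime_type_groups 5 2 4) \<union> Supp ` {T. T \<subseteq> {1..5} \<and> card T = 2}"
    (is "?L = ?R")
  proof (intro equalityI subsetI)
    fix l assume "l \<in> ?L"
    then obtain p x where x: "prime_perm 5 p x" "l = h p (moved x) (cyc_group 5 x)" by blast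
    have "card ({1..5} - moved x) = 5 - card (moved x)" by (rule card_compl[OF moved_subset[OF x(1)]])
    then show "l \<in> ?R"
      using *[OF x(1)] x moved_subset[OF x(1)] by (auto simp: h_def intro!: imageI prime_type_groupsI)
  next
    fix l assume "l \<in> ?R"
    then consider C where "l = Gen C" "C \<in> prime_type_groups 5 5 5" | C where "l = Gen C" "C \<in> prime_type_groups 5 2 4"
      | T where "l = Supp T" "T \<subseteq> {1..5}" "card T = 2" by blast
    then show "l \<in> ?L"
    proof cases
      case 1
      then obtain x where "prime_perm 5 5 x" "C = cyc_group 5 x" by (auto elim: prime_type_groupsE)
      then show ?thesis using 1 by (intro CollectI exI[of _ 5] exI[of _ x]) (simp add: h_def)
    next
      case 2
      then obtain x where "prime_perm 5 2 x" "card (moved x) = 4" "C = cyc_group 5 x" by (auto elim: prime_type_groupsE)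
      then show ?thesis using 2 by (intro CollectI exI[of _ 2] exI[of _ x]) (simp add: h_def)
    next
      case 3
      then obtain a b where T: "T = {a, b}" "a \<noteq> b" by (auto simp: card_2_iff)
      then have "prime_perm 5 2 (transpose a b)" using 3 by (intro prime_perm_transpose) auto
      then show ?thesis using 3 T
        by (intro CollectI exI[of _ 2] exI[of _ "transpose a b"]) (simp add: h_def moved_transpose)
    qed
  qed
  also have "card \<dots> = 31"
  proof -
    have "(5 choose 4) = (5::nat)" "(5 choose 2) = (10::nat)" "fact 3 = (6::nat)" by code_simp+
    then have "card (prime_type_groups 5 5 5 \<union> prime_type_groups 5 2 4) = 21"
      using card_prime_type_groups_cycles[of 5 5] card_prime_type_groups_double[of 5]
      by (simp add: card_Un_disjoint prime_type_groups_disjoint)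
    moreover have "card {T. T \<subseteq> {1..5::nat} \<and> card T = 2} = 10"
      using n_subsets[of "{1..5::nat}" 2] \<open>(5 choose 2) = 10\<close> by simp
    moreover have "finite {T. T \<subseteq> {1..5::nat} \<and> card T = 2}" by simp
    ultimately show ?thesis by (subst card_Un_disjoint) auto
  qed
  finally show ?thesis .
qed

text \<open>The three points outside a 3-cycle are too few for a double transposition, so these stay
  alone, like the groups of 5-cycles. The elements of types \<open>[2, 2, 2]\<close> and
  \<open>[3, 3]\<close> share one label. With \<open>Main\<close> this makes 36 + 45 + 1 +
  1.\<close>

lemma c0_sym_group_6: "c0 (sym_group 6) = 83"
proof -
  define h where "h p S C = (if p = 5 \<or> card S = 4 then Gen C else if card S = 6 then Supp S else Main)"
    for p :: nat and S :: "nat set" and C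
  have *: "p = 2 \<and> card (moved x) = 2 \<or> p = 2 \<and> card (moved x) = 4 \<or> p = 2 \<and> card (moved x) = 6
      \<or> p = 3 \<and> card (moved x) = 3 \<or> p = 3 \<and> card (moved x) = 6 \<or> p = 5 \<and> card (moved x) = 5"
    if "prime_perm 6 p x" for p x
  proof -
    have "p = 2 \<or> p = 3 \<or> p = 4 \<or> p = 5 \<or> p = 6"
      "card (moved x) = 1 \<or> card (moved x) = 2 \<or> card (moved x) = 3 \<or> card (moved x) = 4
        \<or> card (moved x) = 5 \<or> card (moved x) = 6"
      using prime_perm_bounds[OF that] by linarith+
    then show ?thesis using prime_perm_bounds(1,4)[OF that] by auto
  qed
  have "c0 (sym_group 6) = card {h p (moved x) (cyc_group 6 x) |p x. prime_perm 6 p x}"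
  proof (rule c0_sym_group_labels)
    fix p q x y assume x: "prime_perm 6 p x" and y: "prime_perm 6 q y" and pq: "p < q" and c: "x \<circ> y = y \<circ> x"
    have "q + 1 < 6" using x y pq c by (rule ord_bound_if_commuting)
    then have p: "p = 2" "q = 3" using *[OF x] *[OF y] pq by auto
    show "h p (moved x) (cyc_group 6 x) = h q (moved y) (cyc_group 6 y)"
    proof (cases "card (moved y) = 3")
      case True
      then have "moved y \<inter> moved x = {}"
        using moved_disjoint_if_coprime_cycle[OF y x _ c] p by simp
      then have sub: "moved x \<subseteq> {1..6} - moved y" using moved_subset[OF x] by blast
      have "card ({1..6} - moved y) = 3" using card_compl[OF moved_subset[OF y]] True by simp
      then have "card (moved x) = 2" using card_mono[OF _ sub] *[OF x] p by auto
      then show ?thesis using p True by (simp add: h_def)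
    next
      case False
      then have y6: "card (moved y) = 6" using *[OF y] p by auto
      then have "moved x = moved y" using moved_eq_six[of 6 x y] x y p c by simp
      then show ?thesis using y6 p by (simp add: h_def)
    qed
  next
    fix p q x y assume x: "prime_perm 6 p x" and y: "prime_perm 6 q y"
      and eq: "h p (moved x) (cyc_group 6 x) = h q (moved y) (cyc_group 6 y)"
    have base: "sconn 6 u (transpose 1 2)" if u: "prime_perm 6 r u" and m: "h r (moved u) (cyc_group 6 u) = Main" for r u
      using *[OF u] m sconn_base_even[of 6 u] sconn_base_odd[of 6 r u] u by (auto simp: h_def)
    show "sconn 6 x y"
    proof (cases "h p (moved x) (cyc_group 6 x)")
      case Main
      then show ?thesis using base[OF x] base[OF y] eq by (auto intro: conn_trans pconn_sym)
    next
      case (Gen C)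
      then have "cyc_group 6 x = cyc_group 6 y" using eq by (simp add: h_def split: if_splits)
      then show ?thesis by (rule sconn_generate[OF x y])
    next
      case (Supp T)
      then have "moved x = moved y" "card (moved x) = 6" using eq by (auto simp: h_def split: if_splits)
      then show ?thesis by (rule sconn_six[OF x y])
    qed
  qed
  also have "{h p (moved x) (cyc_group 6 x) |p x. prime_perm 6 p x} =
      Gen ` (prime_type_groups 6 5 5 \<union> prime_type_groups 6 2 4) \<union> {Supp {1..6}, Main}"
    (is "?L = ?R")
  proof (intro equalityI subsetI)
    fix l assume "l \<in> ?L"
    then obtain p x where x: "prime_perm 6 p x" "l = h p (moved x) (cyc_group 6 x)" by blast
    have "moved x = {1..6}" if "card (moved x) = 6"
      using moved_subset[OF x(1)] that by (intro card_subset_eq) auto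
    then show "l \<in> ?R"
      using *[OF x(1)] x by (auto simp: h_def intro!: imageI prime_type_groupsI)
  next
    fix l assume "l \<in> ?R"
    then consider C where "l = Gen C" "C \<in> prime_type_groups 6 5 5" | C where "l = Gen C" "C \<in> prime_type_groups 6 2 4"
      | "l = Supp {1..6}" | "l = Main" by blast
    then show "l \<in> ?L"
    proof cases
      case 1
      then obtain x where "prime_perm 6 5 x" "C = cyc_group 6 x" by (auto elim: prime_type_groupsE)
      then show ?thesis using 1 by (intro CollectI exI[of _ 5] exI[of _ x]) (simp add: h_def)
    next
      case 2
      then obtain x where "prime_perm 6 2 x" "card (moved x) = 4" "C = cyc_group 6 x" by (auto elim: prime_type_groupsE)
      then show ?thesis using 2 by (intro CollectI exI[of _ 2] exI[of _ x]) (simp add: h_def)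
    next
      case 3
      have d: "distinct [1, 2, 3, 4, 5, 6::nat]" "{1, 2, 3, 4, 5, 6::nat} = {1..6}" by auto
      have "prime_perm 6 2 (matching3 1 2 3 4 5 6)" "moved (matching3 1 2 3 4 5 6) = {1..6::nat}"
        using prime_perm_matching3[OF d(1), of 6] moved_matching3[OF d(1)] d(2) by auto
      then show ?thesis using 3
        by (intro CollectI exI[of _ 2] exI[of _ "matching3 1 2 3 4 5 6"]) (simp add: h_def)
    next
      case 4
      have "prime_perm 6 2 (transpose 1 2)" by (intro prime_perm_transpose) auto
      then show ?thesis using 4
        by (intro CollectI exI[of _ 2] exI[of _ "transpose 1 2"]) (simp add: h_def moved_transpose)
    qed
  qed
  also have "card \<dots> = 83"
  proof -
    have "(6 choose 4) = (15::nat)" "(6 choose 5) = (6::nat)" "fact 3 = (6::nat)" by code_simp+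
    then have "card (prime_type_groups 6 5 5 \<union> prime_type_groups 6 2 4) = 81"
      using card_prime_type_groups_cycles[of 5 6] card_prime_type_groups_double[of 6]
      by (simp add: card_Un_disjoint prime_type_groups_disjoint)
    then show ?thesis by (subst card_Un_disjoint) auto
  qed
  finally show ?thesis .
qed

text \<open>Now a double transposition has three fixed points and a 5-cycle two, so both join
  \<open>Main\<close>. There are 120 groups of 7-cycles and one component for each of the seven
  supports of size six: 120 + 7 + 1.\<close>

lemma c0_sym_group_7: "c0 (sym_group 7) = 128"
proof -
  define h where "h p S C = (if p = 7 then Gen C else if card S = 6 then Supp S else Main)"
    for p :: nat and S :: "nat set" and C
  have *: "p = 2 \<and> card (moved x) = 2 \<or> p = 2 \<and> card (moved x) = 4 \<or> p = 2 \<and> card (moved x) = 6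
      \<or> p = 3 \<and> card (moved x) = 3 \<or> p = 3 \<and> card (moved x) = 6 \<or> p = 5 \<and> card (moved x) = 5
      \<or> p = 7 \<and> card (moved x) = 7"
    if "prime_perm 7 p x" for p x
  proof -
    have "p = 2 \<or> p = 3 \<or> p = 4 \<or> p = 5 \<or> p = 6 \<or> p = 7"
      and c: "card (moved x) = 1 \<or> card (moved x) = 2 \<or> card (moved x) = 3 \<or> card (moved x) = 4
        \<or> card (moved x) = 5 \<or> card (moved x) = 6 \<or> card (moved x) = 7"
      using prime_perm_bounds[OF that] by linarith+
    then have "p = 2 \<or> p = 3 \<or> p = 5 \<or> p = 7" using prime_perm_bounds(1)[OF that] by auto
    then show ?thesis using prime_perm_bounds(4)[OF that] c by (elim disjE) simp_all
  qed
  have "c0 (sym_group 7) = card {h p (moved x) (cyc_group 7 x) |p x. prime_perm 7 p x}"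
  proof (rule c0_sym_group_labels)
    fix p q x y assume x: "prime_perm 7 p x" and y: "prime_perm 7 q y" and pq: "p < q" and c: "x \<circ> y = y \<circ> x"
    have "q + 1 < 7" using x y pq c by (rule ord_bound_if_commuting)
    then have q: "q = 3 \<or> q = 5" "p \<noteq> 7" using *[OF x] *[OF y] pq by auto
    show "h p (moved x) (cyc_group 7 x) = h q (moved y) (cyc_group 7 y)"
    proof (cases "card (moved y) = q")
      case True
      then have "moved y \<inter> moved x = {}"
        using moved_disjoint_if_coprime_cycle[OF y x _ c] pq by simp
      then have sub: "moved x \<subseteq> {1..7} - moved y" using moved_subset[OF x] by blast
      \<comment> \<open>A cycle of length 3 or 5 leaves at most four points to \<open>x\<close>,
        which therefore cannot carry a label \<open>Supp\<close>.\<close>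
      have "card ({1..7} - moved y) \<le> 4" using card_compl[OF moved_subset[OF y]] True q by auto
      then have "card (moved x) \<noteq> 6" using card_mono[OF _ sub] by auto
      then show ?thesis using q True by (auto simp: h_def)
    next
      case False
      then have y6: "card (moved y) = 6" "q = 3" "p = 2" using *[OF y] *[OF x] q pq by auto
      then have "moved x = moved y" using moved_eq_six[of 7 x y] x y c by simp
      then show ?thesis using y6 by (simp add: h_def)
    qed
  next
    fix p q x y assume x: "prime_perm 7 p x" and y: "prime_perm 7 q y"
      and eq: "h p (moved x) (cyc_group 7 x) = h q (moved y) (cyc_group 7 y)"
    have base: "sconn 7 u (transpose 1 2)" if u: "prime_perm 7 r u" and m: "h r (moved u) (cyc_group 7 u) = Main" for r u
      using *[OF u] m sconn_base_even[of 7 u] sconn_base_odd[of 7 r u] u by (auto simp: h_def)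
    show "sconn 7 x y"
    proof (cases "h p (moved x) (cyc_group 7 x)")
      case Main
      then show ?thesis using base[OF x] base[OF y] eq by (auto intro: conn_trans pconn_sym)
    next
      case (Gen C)
      then have "cyc_group 7 x = cyc_group 7 y" using eq by (simp add: h_def split: if_splits)
      then show ?thesis by (rule sconn_generate[OF x y])
    next
      case (Supp T)
      then have "moved x = moved y" "card (moved x) = 6" using eq by (auto simp: h_def split: if_splits)
      then show ?thesis by (rule sconn_six[OF x y])
    qed
  qed
  also have "{h p (moved x) (cyc_group 7 x) |p x. prime_perm 7 p x} =
      Gen ` prime_type_groups 7 7 7 \<union> (Supp ` {T. T \<subseteq> {1..7} \<and> card T = 6} \<union> {Main})"
    (is "?L = ?R")
  proof (intro equalityI subsetI)
    fix l assume "l \<in> ?L"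
    then obtain p x where x: "prime_perm 7 p x" "l = h p (moved x) (cyc_group 7 x)" by blast
    show "l \<in> ?R"
      using *[OF x(1)] x moved_subset[OF x(1)] by (auto simp: h_def intro!: imageI prime_type_groupsI)
  next
    fix l assume "l \<in> ?R"
    then consider C where "l = Gen C" "C \<in> prime_type_groups 7 7 7"
      | T where "l = Supp T" "T \<subseteq> {1..7}" "card T = 6" | "l = Main" by blast
    then show "l \<in> ?L"
    proof cases
      case 1
      then obtain x where "prime_perm 7 7 x" "C = cyc_group 7 x" by (auto elim: prime_type_groupsE)
      then show ?thesis using 1 by (intro CollectI exI[of _ 7] exI[of _ x]) (simp add: h_def)
    next
      case 2
      obtain l where l: "set l = T" "distinct l"
        using finite_distinct_list finite_subset[OF 2(2)] by blast
      then have "length l = 6" using 2(3) distinct_card by metis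
      then obtain a b c d e f where le: "l = [a, b, c, d, e, f]"
        by (auto simp: numeral_eq_Suc length_Suc_conv)
      then have T: "T = {a, b, c, d, e, f}" "distinct [a, b, c, d, e, f]" using l by auto
      have "prime_perm 7 2 (matching3 a b c d e f)" "moved (matching3 a b c d e f) = T"
        using prime_perm_matching3[OF T(2), of 7] moved_matching3[OF T(2)] T(1) 2(2) by auto
      then show ?thesis using 2
        by (intro CollectI exI[of _ 2] exI[of _ "matching3 a b c d e f"]) (simp add: h_def)
    next
      case 3
      have "prime_perm 7 2 (transpose 1 2)" by (intro prime_perm_transpose) auto
      then show ?thesis using 3
        by (intro CollectI exI[of _ 2] exI[of _ "transpose 1 2"]) (simp add: h_def moved_transpose)
    qed
  qed
  also have "card \<dots> = 128"
  proof -
    have "(7 choose 6) = (7::nat)" "fact 5 = (120::nat)" by code_simp+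
    then have "card (prime_type_groups 7 7 7) = 120" "card {T. T \<subseteq> {1..7::nat} \<and> card T = 6} = 7"
      using card_prime_type_groups_cycles[of 7 7] n_subsets[of "{1..7::nat}" 6] by simp_all
    moreover have "finite {T. T \<subseteq> {1..7::nat} \<and> card T = 6}" by simp
    moreover have "card (Supp ` {T. T \<subseteq> {1..7} \<and> card T = 6} \<union> {Main}) = 8"
      using calculation by (subst card_Un_disjoint) auto
    ultimately show ?thesis by (subst card_Un_disjoint) auto
  qed
  finally show ?thesis .
qed

section \<open>Degrees 8 and above\<close>

lemma c0_sym_group_ge_8:
  assumes n: "n \<ge> 8"
  shows "c0 (sym_group n) = Suc (card (\<Union>p\<in>{p. prime p \<and> n \<le> p + 1 \<and> p \<le> n}. prime_type_groups n p p))"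
proof -
  define h where "h p S C = (if n \<le> p + 1 then Gen C else Main)"
    for p :: nat and S :: "nat set" and C
  let ?U = "\<Union>p\<in>{p. prime p \<and> n \<le> p + 1 \<and> p \<le> n}. prime_type_groups n p p"
  have "c0 (sym_group n) = card {h p (moved x) (cyc_group n x) |p x. prime_perm n p x}"
  proof (rule c0_sym_group_labels)
    fix p q x y assume x: "prime_perm n p x" and y: "prime_perm n q y" and pq: "p < q" and c: "x \<circ> y = y \<circ> x"
    \<comment> \<open>Commuting elements of distinct prime orders thus both lie below the bound and
      carry \<open>Main\<close>.\<close>
    have "q + 1 < n" using x y pq c by (rule ord_bound_if_commuting)
    then show "h p (moved x) (cyc_group n x) = h q (moved y) (cyc_group n y)" using pq by (simp add: h_def)
  next
    fix p q x y assume x: "prime_perm n p x" and y: "prime_perm n q y"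
      and eq: "h p (moved x) (cyc_group n x) = h q (moved y) (cyc_group n y)"
    show "sconn n x y"
    proof (cases "n \<le> p + 1")
      case True
      then have "cyc_group n x = cyc_group n y" using eq by (simp add: h_def split: if_splits)
      then show ?thesis by (rule sconn_generate[OF x y])
    next
      case False
      then have "p + 1 < n" "q + 1 < n" using eq by (simp_all add: h_def split: if_splits)
      then show ?thesis using sconn_base[OF n x] sconn_base[OF n y] by (auto intro: conn_trans pconn_sym)
    qed
  qed
  also have "{h p (moved x) (cyc_group n x) |p x. prime_perm n p x} = insert Main (Gen ` ?U)" (is "?L = ?R")
  proof (intro equalityI subsetI)
    fix l assume "l \<in> ?L"
    then obtain p x where x: "prime_perm n p x" "l = h p (moved x) (cyc_group n x)" by blast
    show "l \<in> ?R"
    proof (cases "n \<le> p + 1")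
      case True
      then have "cyc_group n x \<in> prime_type_groups n p p"
        using card_moved_large[OF x(1)] x(1) by (intro prime_type_groupsI)
      then show ?thesis using True x prime_perm_bounds[OF x(1)] by (auto simp: h_def)
    qed (use x in \<open>simp add: h_def\<close>)
  next
    fix l assume "l \<in> ?R"
    then consider "l = Main" | C p where "l = Gen C" "prime p" "n \<le> p + 1" "C \<in> prime_type_groups n p p" by blast
    then show "l \<in> ?L"
    proof cases
      case 1
      have "prime_perm n 2 (transpose 1 2)" using n by (intro prime_perm_transpose) auto
      then show ?thesis using 1 n
        by (intro CollectI exI[of _ 2] exI[of _ "transpose 1 2"]) (simp add: h_def)
    next
      case 2
      then obtain x where "prime_perm n p x" "C = cyc_group n x" by (auto elim: prime_type_groupsE)
      then show ?thesis using 2 by (intro CollectI exI[of _ p] exI[of _ x]) (simp add: h_def)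
    qed
  qed
  also have "card \<dots> = Suc (card (Gen ` ?U))"
  proof (rule card_insert_disjoint)
    have "finite {p. prime p \<and> n \<le> p + 1 \<and> p \<le> n}" by (rule finite_subset[of _ "{..n}"]) auto
    then show "finite (Gen ` ?U)" by simp
  qed auto
  finally show ?thesis by simp
qed

text \<open>One of \<open>n\<close> and \<open>n - 1\<close> is even and larger than 2, so at most
  one of them is prime.\<close>

lemma large_primes:
  fixes n :: nat
  assumes "n \<ge> 4"
  shows "prime n \<Longrightarrow> {p. prime p \<and> n \<le> p + 1 \<and> p \<le> n} = {n}"
    "prime (n - 1) \<Longrightarrow> {p. prime p \<and> n \<le> p + 1 \<and> p \<le> n} = {n - 1}"
    "\<not> prime n \<Longrightarrow> \<not> prime (n - 1) \<Longrightarrow> {p. prime p \<and> n \<le> p + 1 \<and> p \<le> n} = {}"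
proof -
  have *: "n \<le> p + 1 \<and> p \<le> n \<longleftrightarrow> p = n \<or> p = n - 1" for p using assms by auto
  have "\<not> (prime n \<and> prime (n - 1))"
  proof
    assume a: "prime n \<and> prime (n - 1)"
    have "2 < n" "2 < n - 1" using assms by linarith+
    then have "odd n" "odd (n - 1)" using a prime_odd_nat by blast+
    then show False using assms by simp
  qed
  then show "prime n \<Longrightarrow> {p. prime p \<and> n \<le> p + 1 \<and> p \<le> n} = {n}"
    "prime (n - 1) \<Longrightarrow> {p. prime p \<and> n \<le> p + 1 \<and> p \<le> n} = {n - 1}"
    "\<not> prime n \<Longrightarrow> \<not> prime (n - 1) \<Longrightarrow> {p. prime p \<and> n \<le> p + 1 \<and> p \<le> n} = {}"
    unfolding * by auto
qed

lemma c0_sym_group_large: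
  assumes n: "n \<ge> 8"
  shows "prime n \<Longrightarrow> c0 (sym_group n) = fact (n - 2) + 1"
    "prime (n - 1) \<Longrightarrow> c0 (sym_group n) = n * fact (n - 3) + 1"
    "\<not> prime n \<Longrightarrow> \<not> prime (n - 1) \<Longrightarrow> c0 (sym_group n) = 1"
proof -
  have n4: "n \<ge> 4" using n by simp
  note c = c0_sym_group_ge_8[OF n]
  show "c0 (sym_group n) = fact (n - 2) + 1" if "prime n"
    unfolding c large_primes(1)[OF n4 that] using card_prime_type_groups_cycles[OF that, of n] by simp
  show "c0 (sym_group n) = n * fact (n - 3) + 1" if "prime (n - 1)"
  proof -
    have "n choose (n - 1) = n" using binomial_symmetric[of 1 n] n by simp
    moreover have "n - 1 - 2 = n - 3" by simp
    ultimately show ?thesis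
      unfolding c large_primes(2)[OF n4 that] using card_prime_type_groups_cycles[OF that, of n]
      by (simp del: diff_diff_left)
  qed
  show "c0 (sym_group n) = 1" if "\<not> prime n" "\<not> prime (n - 1)"
    unfolding c large_primes(3)[OF n4 that] by simp
qed

lemma c0_order_sym_group_values:
  "c0_order (sym_group 2) = 1" "c0_order (sym_group 3) = 2"
  "n \<ge> 4 \<Longrightarrow> prime n \<or> prime (n - 1) \<Longrightarrow> c0_order (sym_group n) = 2"
  "n \<ge> 4 \<Longrightarrow> \<not> prime n \<Longrightarrow> \<not> prime (n - 1) \<Longrightarrow> c0_order (sym_group n) = 1"
proof -
  have "{p::nat. prime p \<and> 2 \<le> p + 1 \<and> p \<le> 2} = {2}"
  proof -
    have "2 \<le> p + 1 \<and> p \<le> 2 \<longleftrightarrow> p = 1 \<or> p = 2" for p :: nat by auto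
    then have "{p::nat. prime p \<and> 2 \<le> p + 1 \<and> p \<le> 2} = {p. prime p \<and> (p = 1 \<or> p = 2)}" by blast
    also have "\<dots> = {2}" by (auto simp del: One_nat_def)
    finally show ?thesis .
  qed
  then show "c0_order (sym_group 2) = 1" by (simp add: c0_order_sym_group)
  have "{p::nat. prime p \<and> 3 \<le> p + 1 \<and> p \<le> 3} = {2, 3}"
  proof -
    have "3 \<le> p + 1 \<and> p \<le> 3 \<longleftrightarrow> p = 2 \<or> p = 3" for p :: nat by auto
    then have "{p::nat. prime p \<and> 3 \<le> p + 1 \<and> p \<le> 3} = {p. prime p \<and> (p = 2 \<or> p = 3)}" by blast
    also have "\<dots> = {2, 3}" by auto
    finally show ?thesis .
  qed
  then show "c0_order (sym_group 3) = 2" by (simp add: c0_order_sym_group)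
  show "c0_order (sym_group n) = 2" if n: "n \<ge> 4" and "prime n \<or> prime (n - 1)"
    using that(2) large_primes(1,2)[OF n] n by (auto simp: c0_order_sym_group)
  show "c0_order (sym_group n) = 1" if n: "n \<ge> 4" and "\<not> prime n" "\<not> prime (n - 1)"
    unfolding c0_order_sym_group large_primes(3)[OF that] using n by simp
qed

section \<open>Partitions\<close>

lemma part_pow_empty [simp]: "part_pow {#} a = {#}"
  by (simp add: part_pow_def)

lemma part_pow_add_mset:
  "part_pow (add_mset m T) a = replicate_mset (gcd a m) (m div gcd a m) + part_pow T a"
  by (simp add: part_pow_def)

lemma part_pow_union: "part_pow (S + T) a = part_pow S a + part_pow T a"
  by (simp add: part_pow_def)

lemma part_pow_replicate:
  "part_pow (replicate_mset k m) a = replicate_mset (k * gcd a m) (m div gcd a m)"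
  by (induction k) (auto simp: part_pow_add_mset multiset_eq_iff)

lemma in_part_powD: "x \<in># part_pow T a \<Longrightarrow> \<exists>m\<in>#T. x = m div gcd a m"
  by (induction T) (auto simp: part_pow_add_mset split: if_splits)

lemma in_part_powI: "m \<in># T \<Longrightarrow> m > 0 \<Longrightarrow> m div gcd a m \<in># part_pow T a"
  by (induction T) (auto simp: part_pow_add_mset)

lemma sum_part_pow: "sum_mset (part_pow T a) = sum_mset T"
  by (induction T) (auto simp: part_pow_add_mset sum_mset_replicate_mset)

lemma part_pow_partitions: "T \<in> partitions n \<Longrightarrow> part_pow T a \<in> partitions n"
  unfolding partitions_def
  by (auto simp: sum_part_pow div_greater_zero_iff gcd_le2_nat dest!: in_part_powD)

section \<open>Nontrivial partitions and their powers of prime type\<close>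

definition nontrivial_partitions :: "nat \<Rightarrow> nat multiset set" where
  "nontrivial_partitions n = partitions n - {replicate_mset n 1}"

abbreviation tconn :: "nat \<Rightarrow> nat multiset \<Rightarrow> nat multiset \<Rightarrow> bool" where
  "tconn n \<equiv> conn (nontrivial_partitions n) part_adj"

lemma tconn_sym: "tconn n S T \<Longrightarrow> tconn n T S"
  using conn_sym[OF symp_part_adj] .

lemma tconn_pow:
  assumes "T \<in> nontrivial_partitions n" "a > 0" "part_pow T a \<noteq> replicate_mset n 1"
  shows "tconn n T (part_pow T a)"
proof (cases "T = part_pow T a")
  case True
  then show ?thesis by (metis conn_refl)
next
  case False
  then have "part_adj T (part_pow T a)" using assms(2) by (auto simp: part_adj_def)
  then show ?thesis
    using assms part_pow_partitions[of T n a] by (intro conn_step) (auto simp: nontrivial_partitions_def)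
qed

text \<open>The cycle type of a permutation of prime order \<open>p\<close> with \<open>k\<close>
  nontrivial orbits. It is a partition of \<open>n\<close> only for \<open>p * k \<le> n\<close>, as
  the subtraction truncates.\<close>

definition prime_type :: "nat \<Rightarrow> nat \<Rightarrow> nat \<Rightarrow> nat multiset" where
  "prime_type n p k = replicate_mset k p + replicate_mset (n - p * k) 1"

lemma count_prime_type: "prime p \<Longrightarrow> count (prime_type n p k) p = k"
  by (auto simp: prime_type_def)

lemma prime_type_nontrivial:
  assumes "prime p" "k \<ge> 1" "p * k \<le> n"
  shows "prime_type n p k \<in> nontrivial_partitions n"
proof -
  have "prime_type n p k \<noteq> replicate_mset n 1"
    using count_prime_type[OF assms(1), of n k] assms(1,2) by (auto split: if_splits)
  then show ?thesis
    using assms prime_gt_0_nat[OF assms(1)]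
    by (auto simp: nontrivial_partitions_def partitions_def prime_type_def sum_mset_replicate_mset mult.commute split: if_splits)
qed

lemma partition_one_prime:
  assumes T: "T \<in> partitions n" and p: "prime p" and m: "\<forall>m\<in>#T. m = 1 \<or> m = p"
  shows "T = prime_type n p (count T p)" "p * count T p \<le> n"
proof -
  have T2: "T = replicate_mset (count T p) p + replicate_mset (count T 1) 1"
  proof (rule multiset_eqI)
    fix x
    have "p \<noteq> 1" using p by auto
    then show "count T x = count (replicate_mset (count T p) p + replicate_mset (count T 1) 1) x"
      using m count_eq_zero_iff[of T x] by (cases "x = p"; cases "x = 1") auto
  qed
  have "n = sum_mset T" using T by (simp add: partitions_def)
  also have "\<dots> = p * count T p + count T 1"
    by (subst T2) (simp only: sum_mset.union sum_mset_replicate_mset, simp)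
  finally have n: "n = p * count T p + count T 1" .
  then show "p * count T p \<le> n" by simp
  have "count T 1 = n - p * count T p" using n by simp
  then show "T = prime_type n p (count T p)" using T2 by (simp add: prime_type_def)
qed

text \<open>The least common multiple \<open>L\<close> of the parts is the order of a permutation of
  type \<open>T\<close>, and \<open>a = L div p\<close> for a prime \<open>p\<close> dividing it.
  Then \<open>m div gcd a m\<close> divides \<open>p\<close> for each part \<open>m\<close>, and it
  is not always 1 because \<open>a\<close> is no common multiple.\<close>

lemma exists_prime_type_power:
  assumes T: "T \<in> nontrivial_partitions n"
  obtains a p k where "a > 0" "prime p" "k \<ge> 1" "p * k \<le> n" "part_pow T a = prime_type n p k"
proof -
  have Tn: "T \<in> partitions n" and pos: "\<And>m. m \<in># T \<Longrightarrow> m > 0"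
    using T by (auto simp: nontrivial_partitions_def partitions_def)
  define L where "L = Lcm (set_mset T)"
  have L0: "L > 0" using pos[of 0] by (auto simp: L_def Lcm_0_iff_nat intro!: Nat.gr0I)
  have dL: "m dvd L" if "m \<in># T" for m using that by (simp add: L_def)
  have "\<exists>m\<in>#T. m \<noteq> 1"
  proof (rule ccontr)
    assume "\<not> ?thesis"
    then have "\<forall>m\<in>#T. m = 1" by blast
    moreover then have "count T 2 = 0" by (auto simp: count_eq_zero_iff)
    ultimately have "T = replicate_mset n 1"
      using partition_one_prime(1)[OF Tn two_is_prime_nat] by (simp add: prime_type_def)
    then show False using T by (simp add: nontrivial_partitions_def)
  qed
  then have "L \<noteq> 1" using dL by (metis nat_dvd_1_iff_1)
  then obtain p where p: "prime p" "p dvd L" using prime_factor_nat by blast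
  define a where "a = L div p"
  have La: "L = p * a" using p(2) by (simp add: a_def)
  have a0: "a > 0" using L0 La by (cases a) auto
  have one: "m div gcd a m = 1 \<or> m div gcd a m = p" if m: "m \<in># T" for m
  proof -
    have "m dvd gcd (p * a) (p * m)" using dL[OF m] La by simp
    then have "m dvd p * gcd a m" by (simp add: gcd_mult_distrib_nat)
    then have "m div gcd a m dvd p" using pos[OF m] by (simp add: div_dvd_iff_mult)
    then show ?thesis using p(1) by (auto simp: prime_nat_iff)
  qed
  let ?S = "part_pow T a"
  have S: "?S \<in> partitions n" using Tn by (rule part_pow_partitions)
  have Sp: "\<forall>m\<in>#?S. m = 1 \<or> m = p" using one in_part_powD by metis
  have "p \<in># ?S"
  proof (rule ccontr)
    assume np: "p \<notin># ?S"
    have "m dvd a" if m: "m \<in># T" for m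
    proof -
      have "m div gcd a m = 1" using one[OF m] in_part_powI[OF m pos[OF m], of a] np by auto
      then have "m = gcd a m" by (metis dvd_mult_div_cancel gcd_dvd2 mult.right_neutral)
      then show ?thesis by (metis gcd_dvd1)
    qed
    then have "L dvd a" unfolding L_def by (intro Lcm_least)
    then show False using La a0 prime_gt_1_nat[OF p(1)] by (auto dest: dvd_imp_le)
  qed
  then have "count ?S p \<ge> 1" by (simp add: Suc_le_eq)
  then show ?thesis using that[OF a0 p(1) _ partition_one_prime(2)[OF S p(1) Sp] partition_one_prime(1)[OF S p(1) Sp]] by blast
qed

text \<open>A part dividing \<open>a\<close> dissolves into ones; any other has the form
  \<open>p * g\<close> and becomes \<open>g\<close> parts of size \<open>p\<close>.\<close>

lemma sum_filter_not_dvd: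
  assumes "\<forall>m\<in>#T. m > 0 \<and> (m dvd a \<or> m = p * gcd a m)" "p > 1"
  shows "sum_mset (filter_mset (\<lambda>m. \<not> m dvd a) T) = p * count (part_pow T a) p"
  using assms(1)
proof (induction T)
  case (add m T)
  have IH: "sum_mset (filter_mset (\<lambda>m. \<not> m dvd a) T) = p * count (part_pow T a) p" using add by simp
  show ?case
  proof (cases "m dvd a")
    case True
    then have "gcd a m = m" by (simp add: gcd_nat.absorb2)
    then show ?thesis using True IH add.prems assms(2) by (auto simp: part_pow_add_mset)
  next
    case False
    define g where "g = gcd a m"
    have m: "m = p * g" "g > 0" using False add.prems by (auto simp: g_def)
    then have "m div g = p" by simp
    then have "part_pow (add_mset m T) a = replicate_mset g p + part_pow T a"
      by (simp add: part_pow_add_mset g_def)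
    then show ?thesis using False IH m(1) by (simp add: algebra_simps)
  qed
qed simp

lemma prime_type_power:
  assumes T: "T \<in> partitions n" and p: "prime p" and eq: "part_pow T a = prime_type n p k"
  shows "\<forall>m\<in>#T. m > 0 \<and> (m dvd a \<or> m = p * gcd a m)"
    "sum_mset (filter_mset (\<lambda>m. \<not> m dvd a) T) = p * k"
proof -
  have pos: "\<forall>m\<in>#T. m > 0" using T by (simp add: partitions_def)
  show *: "\<forall>m\<in>#T. m > 0 \<and> (m dvd a \<or> m = p * gcd a m)"
  proof
    fix m assume m: "m \<in># T"
    then have "m div gcd a m \<in># prime_type n p k" using in_part_powI[OF m, of a] pos eq by simp
    then have "m div gcd a m = p \<or> m div gcd a m = 1" by (auto simp: prime_type_def split: if_splits)
    moreover have "m = (m div gcd a m) * gcd a m" by simp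
    ultimately have "m = p * gcd a m \<or> m = gcd a m" by (metis mult_1)
    then show "m > 0 \<and> (m dvd a \<or> m = p * gcd a m)" using pos m by (metis gcd_dvd1)
  qed
  show "sum_mset (filter_mset (\<lambda>m. \<not> m dvd a) T) = p * k"
    using sum_filter_not_dvd[OF * prime_gt_1_nat[OF p]] by (simp add: eq count_prime_type[OF p])
qed

text \<open>Write \<open>a = g * c\<close> with \<open>g = gcd a m\<close>. If \<open>p\<close>
  divided \<open>c\<close>, then \<open>m = p * g\<close> would divide \<open>a\<close>; so
  \<open>a\<close> and \<open>g\<close> have equal valuation.\<close>

lemma multiplicity_eq_Suc_if_not_dvd:
  fixes m a p :: nat
  assumes p: "prime p" and m: "m = p * gcd a m" "m > 0" and a: "a > 0" and nd: "\<not> m dvd a"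
  shows "multiplicity p m = Suc (multiplicity p a)"
proof -
  define g where "g = gcd a m"
  have g: "g > 0" "m = p * g" using m by (auto simp: g_def)
  obtain c where c: "a = g * c" unfolding g_def by (meson dvdE gcd_dvd1)
  have "\<not> p dvd c" using nd c g(2) by (auto elim!: dvdE)
  then have "multiplicity p c = 0" by (rule not_dvd_imp_multiplicity_0)
  moreover have "c > 0" using a c by (cases c) auto
  ultimately have "multiplicity p a = multiplicity p g"
    using p g(1) by (simp add: c prime_elem_multiplicity_mult_distrib)
  moreover have "multiplicity p m = Suc (multiplicity p g)"
    using p g by (simp add: prime_elem_multiplicity_mult_distrib)
  ultimately show ?thesis by simp
qed

text \<open>The parts of \<open>T\<close> surviving in the power are those of maximal \<open>p\<close>-adic valuation.\<close>

lemma prime_type_power_unique: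
  assumes T: "T \<in> partitions n" and p: "prime p" and ab: "a > 0" "b > 0" and kl: "k \<ge> 1" "l \<ge> 1"
    and eq: "part_pow T a = prime_type n p k" "part_pow T b = prime_type n p l"
  shows "k = l"
proof -
  let ?v = "multiplicity p"
  note A = prime_type_power[OF T p eq(1)] and B = prime_type_power[OF T p eq(2)]
  \<comment> \<open>Whether a part divides the exponent is thus decided by \<open>p\<close>-adic
    valuations alone.\<close>
  have char: "(m dvd c \<longleftrightarrow> ?v m \<le> ?v c) \<and> ?v m \<le> Suc (?v c)"
    if m: "m \<in># T" and c: "c > 0" and C: "\<forall>m\<in>#T. m > 0 \<and> (m dvd c \<or> m = p * gcd c m)" for m c
  proof (cases "m dvd c")
    case True
    then show ?thesis using dvd_imp_multiplicity_le[of m c p] c by auto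
  next
    case False
    then have "m = p * gcd c m" "m > 0" using C m by auto
    then show ?thesis using multiplicity_eq_Suc_if_not_dvd[OF p _ _ c False] False by simp
  qed
  have ex: "\<exists>m\<in>#T. ?v m = Suc (?v c)"
    if c: "c > 0" and C: "\<forall>m\<in>#T. m > 0 \<and> (m dvd c \<or> m = p * gcd c m)"
      and s: "sum_mset (filter_mset (\<lambda>m. \<not> m dvd c) T) = p * j" and j: "j \<ge> 1" for c j
  proof -
    have "filter_mset (\<lambda>m. \<not> m dvd c) T \<noteq> {#}"
      using s j prime_gt_0_nat[OF p] by (metis mult_is_0 not_one_le_zero sum_mset.empty less_numeral_extra(3))
    then obtain m where "m \<in># T" "\<not> m dvd c" by (auto simp: filter_mset_eq_conv multiset_nonemptyE)
    then show ?thesis using char[OF _ c C] by (metis le_SucE)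
  qed
  \<comment> \<open>Some part has valuation one above that of \<open>a\<close>, and no part exceeds
    it. The same holds for \<open>b\<close>, so both exponents have equal valuation and single out
    the same parts.\<close>
  obtain m1 where "m1 \<in># T" "?v m1 = Suc (?v a)" using ex[OF ab(1) A kl(1)] by blast
  moreover obtain m2 where "m2 \<in># T" "?v m2 = Suc (?v b)" using ex[OF ab(2) B kl(2)] by blast
  ultimately have v: "?v a = ?v b"
    using char[OF _ ab(1) A(1), of m2] char[OF _ ab(2) B(1), of m1] by simp
  have "filter_mset (\<lambda>m. \<not> m dvd a) T = filter_mset (\<lambda>m. \<not> m dvd b) T"
    using char[OF _ ab(1) A(1)] char[OF _ ab(2) B(1)] v by (intro filter_mset_cong) auto
  then have "p * k = p * l" by (simp only: A(2)[symmetric] B(2)[symmetric])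
  then show ?thesis using prime_gt_0_nat[OF p] by simp
qed

lemma filter_mset_disjoint_sum:
  fixes T :: "nat multiset"
  assumes "\<forall>m\<in>#T. \<not> (P m \<and> Q m)"
  shows "sum_mset (filter_mset P T) + sum_mset (filter_mset Q T) \<le> sum_mset T"
  using assms by (induction T) auto

text \<open>Either the two powers come from disjoint sets of parts of \<open>T\<close>, or from a shared part \<open>m\<close>.\<close>

lemma prime_type_powers_distinct:
  assumes T: "T \<in> partitions n" and pq: "prime p" "prime q" "p \<noteq> q"
    and eq: "part_pow T a = prime_type n p k" "part_pow T b = prime_type n q l"
  shows "p * k + q * l \<le> n \<or> (\<exists>m>0. p * q dvd m \<and> m \<le> p * k \<and> m \<le> q * l)"
proof (cases "\<forall>m\<in>#T. \<not> (\<not> m dvd a \<and> \<not> m dvd b)")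
  case True
  note A = prime_type_power(2)[OF T pq(1) eq(1)] and B = prime_type_power(2)[OF T pq(2) eq(2)]
  have "p * k + q * l \<le> sum_mset T"
    using filter_mset_disjoint_sum[OF True] A B by simp
  then show ?thesis using T by (simp add: partitions_def)
next
  case False
  note A = prime_type_power[OF T pq(1) eq(1)] and B = prime_type_power[OF T pq(2) eq(2)]
  obtain m where m: "m \<in># T" "\<not> m dvd a" "\<not> m dvd b" using False by blast
  have "p dvd m" "q dvd m" using A(1) B(1) m by (metis dvd_triv_left)+
  moreover have "coprime p q" using pq by (simp add: primes_coprime)
  ultimately have "p * q dvd m" by (simp add: divides_mult)
  moreover have "m \<le> p * k"
    using A(2) m by (metis (mono_tags, lifting) count_filter_mset count_greater_zero_iff sum_mset.remove le_add1)
  moreover have "m \<le> q * l"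
    using B(2) m by (metis (mono_tags, lifting) count_filter_mset count_greater_zero_iff sum_mset.remove le_add1)
  ultimately show ?thesis using A(1) m(1) by blast
qed

lemma c0_type_labels:
  fixes g :: "nat \<Rightarrow> nat \<Rightarrow> 'l"
  assumes com: "\<And>p k q l. prime p \<Longrightarrow> prime q \<Longrightarrow> p < q \<Longrightarrow> k \<ge> 1 \<Longrightarrow> l \<ge> 1 \<Longrightarrow> p * k \<le> n \<Longrightarrow> q * l \<le> n \<Longrightarrow>
      p * k + q * l \<le> n \<or> (\<exists>m>0. p * q dvd m \<and> m \<le> p * k \<and> m \<le> q * l) \<Longrightarrow> g p k = g q l"
    and con: "\<And>p k q l. prime p \<Longrightarrow> prime q \<Longrightarrow> k \<ge> 1 \<Longrightarrow> l \<ge> 1 \<Longrightarrow> p * k \<le> n \<Longrightarrow> q * l \<le> n \<Longrightarrow>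
      g p k = g q l \<Longrightarrow> tconn n (prime_type n p k) (prime_type n q l)"
  shows "c0_type n = card {g p k |p k. prime p \<and> k \<ge> 1 \<and> p * k \<le> n}"
proof -
  let ?V = "nontrivial_partitions n"
  define R where "R T p k \<longleftrightarrow> prime p \<and> k \<ge> 1 \<and> p * k \<le> n \<and> (\<exists>a>0. part_pow T a = prime_type n p k)" for T p k
  define F where "F T = (THE l. \<exists>p k. R T p k \<and> l = g p k)" for T
  have ex: "\<exists>p k. R T p k" if "T \<in> ?V" for T
    using exists_prime_type_power[OF that] unfolding R_def by metis
  have uniq: "g p k = g q l" if T: "T \<in> ?V" and R: "R T p k" "R T q l" for T p k q l
  proof -
    have TP: "T \<in> partitions n" using T by (simp add: nontrivial_partitions_def)
    obtain a where a: "a > 0" "part_pow T a = prime_type n p k" using R(1) by (auto simp: R_def)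
    obtain b where b: "b > 0" "part_pow T b = prime_type n q l" using R(2) by (auto simp: R_def)
    have h: "prime p" "k \<ge> 1" "p * k \<le> n" "prime q" "l \<ge> 1" "q * l \<le> n" using R by (simp_all add: R_def)
    consider "p = q" | "p < q" | "q < p" by linarith
    then show ?thesis
    proof cases
      case 1
      then show ?thesis using prime_type_power_unique[OF TP h(1) a(1) b(1) h(2,5) a(2)] b(2) by simp
    next
      case 2
      then show ?thesis using prime_type_powers_distinct[OF TP h(1,4) _ a(2) b(2)] h by (intro com) auto
    next
      case 3
      then show ?thesis using prime_type_powers_distinct[OF TP h(4,1) _ b(2) a(2)] h by (intro com[symmetric]) auto
    qed
  qed
  have F: "F T = g p k" if "T \<in> ?V" "R T p k" for T p k
    unfolding F_def using uniq[OF that(1)] that(2) by (intro the_equality) blast+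
  have self: "R (prime_type n p k) p k" if "prime p" "k \<ge> 1" "p * k \<le> n" for p k
  proof -
    have "part_pow T 1 = T" for T
      by (induction T) (simp_all add: part_pow_add_mset)
    then show ?thesis using that unfolding R_def by (metis zero_less_one)
  qed
  have "num_components ?V part_adj = card (F ` ?V)"
  proof (rule num_components_eq_card[OF symp_part_adj])
    have *: "F S = F T" if V: "S \<in> ?V" "T \<in> ?V" and a: "a > 0" "T = part_pow S a" for S T a
    proof -
      obtain p k where R: "R T p k" using ex[OF V(2)] by blast
      then obtain b where b: "b > 0" "part_pow T b = prime_type n p k" by (auto simp: R_def)
      \<comment> \<open>This yields \<open>part_pow (part_pow S a) b = part_pow S (a * b)\<close>,
        so prime type powers of \<open>T\<close> are powers of \<open>S\<close> too.\<close>
      have "gcd (a * b) m = gcd a m * gcd b (m div gcd a m)" for m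
      proof -
        define e where "e = gcd a m"
        show ?thesis
        proof (cases "e = 0")
          case False
          define a' where "a' = a div e"
          define m' where "m' = m div e"
          have "a = e * a'" "m = e * m'" by (simp_all add: a'_def m'_def e_def)
          moreover have "coprime a' m'" using False unfolding a'_def m'_def e_def
            by (simp add: div_gcd_coprime)
          ultimately have "gcd (a * b) m = e * gcd b m'"
            by (simp add: mult.assoc gcd_mult_distrib_nat[symmetric] gcd_mult_left_left_cancel coprime_commute)
          then show ?thesis by (simp add: e_def m'_def)
        qed (use a in \<open>simp add: e_def\<close>)
      qed
      then have "part_pow (part_pow S a) b = part_pow S (a * b)"
        by (induction S) (simp_all add: part_pow_add_mset part_pow_union part_pow_replicate div_mult2_eq)
      then have "R S p k" using R a b by (auto simp: R_def intro!: exI[of _ "a * b"])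
      then show ?thesis using F[OF V(1)] F[OF V(2) R] by simp
    qed
    fix S T assume "S \<in> ?V" "T \<in> ?V" "part_adj S T"
    then show "F S = F T" using *[of S T] *[of T S] by (auto simp: part_adj_def)
  next
    have to: "tconn n T (prime_type n p k)" if T: "T \<in> ?V" and R: "R T p k" for T p k
    proof -
      obtain a where a: "a > 0" "part_pow T a = prime_type n p k" using R by (auto simp: R_def)
      have "prime_type n p k \<in> ?V" using R by (intro prime_type_nontrivial) (auto simp: R_def)
      then show ?thesis using tconn_pow[OF T a(1)] a(2) by (simp add: nontrivial_partitions_def)
    qed
    fix S T assume V: "S \<in> ?V" "T \<in> ?V" and eq: "F S = F T"
    obtain p k q l where R: "R S p k" "R T q l" using ex V by metis
    have "g p k = g q l" using F[OF V(1) R(1)] F[OF V(2) R(2)] eq by simp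
    then have "tconn n (prime_type n p k) (prime_type n q l)" using R by (intro con) (auto simp: R_def)
    then show "tconn n S T" using to[OF V(1) R(1)] tconn_sym[OF to[OF V(2) R(2)]] by (blast intro: conn_trans)
  qed
  also have "F ` ?V = {g p k |p k. prime p \<and> k \<ge> 1 \<and> p * k \<le> n}"
  proof (intro equalityI subsetI)
    fix l assume "l \<in> F ` ?V"
    then obtain T where T: "T \<in> ?V" "l = F T" by blast
    obtain p k where R: "R T p k" using ex[OF T(1)] by blast
    then have "l = g p k" "prime p \<and> k \<ge> 1 \<and> p * k \<le> n" using F[OF T(1) R] T(2) by (auto simp: R_def)
    then show "l \<in> {g p k |p k. prime p \<and> k \<ge> 1 \<and> p * k \<le> n}" by blast
  next
    fix l assume "l \<in> {g p k |p k. prime p \<and> k \<ge> 1 \<and> p * k \<le> n}"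
    then obtain p k where pk: "prime p" "k \<ge> 1" "p * k \<le> n" and l: "l = g p k" by blast
    show "l \<in> F ` ?V"
      using F[OF prime_type_nontrivial[OF pk] self[OF pk]] prime_type_nontrivial[OF pk] l by (intro image_eqI) auto
  qed
  finally show ?thesis by (simp add: c0_type_def nontrivial_partitions_def)
qed

section \<open>Common roots of prime types\<close>

lemma replicate_mset_union: "replicate_mset a x + replicate_mset b x = replicate_mset (a + b) x"
  by (simp add: multiset_eq_iff)

lemma nontrivial_partitionsI:
  assumes "T \<in> partitions n" "m \<in># T" "m \<noteq> 1"
  shows "T \<in> nontrivial_partitions n"
  using assms by (auto simp: nontrivial_partitions_def split: if_splits)

lemma tconn_if_common_root:
  assumes "T \<in> partitions n" "m \<in># T" "m \<noteq> 1" "a > 0" "b > 0"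
    and "part_pow T a = prime_type n p k" "prime p" "k \<ge> 1" "p * k \<le> n"
    and "part_pow T b = prime_type n q l" "prime q" "l \<ge> 1" "q * l \<le> n"
  shows "tconn n (prime_type n p k) (prime_type n q l)"
proof -
  have T: "T \<in> nontrivial_partitions n" using assms(1-3) by (rule nontrivial_partitionsI)
  have "tconn n T (prime_type n p k)"
    using tconn_pow[OF T assms(4)] prime_type_nontrivial[OF assms(7-9)] assms(6)
    by (simp add: nontrivial_partitions_def)
  moreover have "tconn n T (prime_type n q l)"
    using tconn_pow[OF T assms(5)] prime_type_nontrivial[OF assms(11-13)] assms(10)
    by (simp add: nontrivial_partitions_def)
  ultimately show ?thesis by (blast intro: conn_trans tconn_sym)
qed

text \<open>The root has parts \<open>p\<close> and \<open>q\<close> side by side; either prime as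
  exponent turns its own parts into ones and, being coprime to the others, keeps them.\<close>

lemma tconn_disjoint:
  assumes p: "prime p" "prime q" "p \<noteq> q" and k: "k \<ge> 1" "l \<ge> 1" "p * k + q * l \<le> n"
  shows "tconn n (prime_type n p k) (prime_type n q l)"
proof -
  define T where "T = replicate_mset k p + replicate_mset l q + replicate_mset (n - p * k - q * l) 1"
  have c: "coprime p q" "coprime q p" using p primes_coprime by (auto simp: coprime_commute)
  have g: "p > 0" "q > 0" using p prime_gt_0_nat by auto
  have "T \<in> partitions n"
    using k g by (auto simp: T_def partitions_def sum_mset_replicate_mset mult.commute split: if_splits)
  moreover have "p \<in># T" "p \<noteq> 1" using k p by (auto simp: T_def)
  moreover have "part_pow T q = prime_type n p k"
  proof -
    have "part_pow T q = replicate_mset k p + replicate_mset (l * q + (n - p * k - q * l)) 1"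
      using c g by (simp add: T_def part_pow_union part_pow_replicate replicate_mset_union[symmetric])
    also have "l * q + (n - p * k - q * l) = n - p * k" using k by (simp add: mult.commute)
    finally show ?thesis by (simp add: prime_type_def)
  qed
  moreover have "part_pow T p = prime_type n q l"
  proof -
    have "part_pow T p = replicate_mset l q + replicate_mset (k * p + (n - p * k - q * l)) 1"
      using c g by (simp add: T_def part_pow_union part_pow_replicate replicate_mset_union[symmetric])
    also have "k * p + (n - p * k - q * l) = n - q * l" using k by (simp add: mult.commute)
    finally show ?thesis by (simp add: prime_type_def)
  qed
  ultimately show ?thesis using g k p by (intro tconn_if_common_root[of T n p q p]) auto
qed

text \<open>The root fuses two parts \<open>p\<close> into \<open>2 * p\<close>: it is the cycle
  type of a permutation multiplied by the involution exchanging two of its orbits.\<close>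

lemma tconn_swap:
  assumes p: "prime p" "p \<noteq> 2" and k: "k \<ge> 2" "p * k \<le> n"
  shows "tconn n (prime_type n p k) (prime_type n 2 p)"
proof -
  define T where "T = add_mset (2 * p) (replicate_mset (k - 2) p + replicate_mset (n - p * k) 1)"
  have c: "coprime 2 p" using p primes_coprime[of 2 p] by auto
  have g: "p > 1" using p prime_gt_1_nat by auto
  obtain j where j: "k = j + 2" using k(1) by (metis le_add_diff_inverse2)
  have "T \<in> partitions n"
    using k g by (auto simp: T_def j partitions_def sum_mset_replicate_mset algebra_simps split: if_splits)
  moreover have "2 * p \<in># T" "2 * p \<noteq> 1" by (auto simp: T_def)
  moreover have "part_pow T 2 = prime_type n p k"
    using c g by (simp add: T_def j part_pow_add_mset part_pow_union part_pow_replicate prime_type_def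
        replicate_mset_union[symmetric] coprime_iff_gcd_eq_1 ac_simps) (simp add: numeral_2_eq_2)
  moreover have "part_pow T p = prime_type n 2 p"
  proof -
    have "part_pow T p = replicate_mset p 2 + replicate_mset (j * p + (n - p * k)) 1"
      using g by (simp add: T_def j part_pow_add_mset part_pow_union part_pow_replicate replicate_mset_union[symmetric])
    also have "j * p + (n - p * k) = n - 2 * p" using k by (simp add: j algebra_simps)
    finally show ?thesis by (simp add: prime_type_def)
  qed
  moreover have "2 * p \<le> n"
  proof -
    have "p * 2 \<le> p * k" using k(1) by (rule mult_le_mono2)
    then show ?thesis using k(2) by linarith
  qed
  ultimately show ?thesis using g k p
    by (intro tconn_if_common_root[of T n "2 * p" 2 p]) auto
qed

text \<open>Three parts 2 are fused into a part 6, which the exponent 3 splits back and the exponent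
  2 turns into two parts 3.\<close>

lemma tconn_triple:
  assumes k: "k \<ge> 3" "2 * k \<le> n"
  shows "tconn n (prime_type n 2 k) (prime_type n 3 2)"
proof -
  define T where "T = add_mset 6 (replicate_mset (k - 3) 2 + replicate_mset (n - 2 * k) (1::nat))"
  obtain j where j: "k = j + 3" using k(1) by (metis le_add_diff_inverse2)
  have gc: "gcd 3 (6::nat) = 3" "gcd 2 (6::nat) = 2" "gcd 3 (2::nat) = 1" "gcd 2 (2::nat) = 2" by code_simp+
  have "T \<in> partitions n"
    using k by (auto simp: T_def j partitions_def sum_mset_replicate_mset split: if_splits)
  moreover have "6 \<in># T" "(6::nat) \<noteq> 1" by (auto simp: T_def)
  moreover have "part_pow T 3 = prime_type n 2 k"
    by (simp add: T_def j part_pow_add_mset part_pow_union part_pow_replicate prime_type_def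
        replicate_mset_union[symmetric] gc ac_simps) (simp add: numeral_2_eq_2)
  moreover have "part_pow T 2 = prime_type n 3 2"
  proof -
    have "part_pow T 2 = replicate_mset 2 3 + replicate_mset (j * 2 + (n - 2 * k)) 1"
      by (simp add: T_def j part_pow_add_mset part_pow_union part_pow_replicate replicate_mset_union[symmetric] gc)
    also have "j * 2 + (n - 2 * k) = n - 3 * 2" using k by (simp add: j)
    finally show ?thesis by (simp add: prime_type_def)
  qed
  ultimately show ?thesis using k
    by (intro tconn_if_common_root[of T n 6 3 2]) auto
qed

section \<open>Counting components of the partition graph\<close>

lemma small_prime_types:
  fixes p k n :: nat
  assumes "prime p" "k \<ge> 1" "p * k \<le> n" "n \<le> 7"
  shows "(p, k) \<in> {(2, 1), (2, 2), (2, 3), (3, 1), (3, 2), (5, 1), (7, 1)}"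
proof -
  have p2: "p \<ge> 2" using assms(1) by (rule prime_ge_2_nat)
  have "p * 1 \<le> p * k" using assms(2) by (rule mult_le_mono2)
  then have "p = 2 \<or> p = 3 \<or> p = 4 \<or> p = 5 \<or> p = 6 \<or> p = 7" using assms(3,4) p2 by linarith
  then have "p = 2 \<or> p = 3 \<or> p = 5 \<or> p = 7" using assms(1) by auto
  moreover have "2 * k \<le> p * k" using p2 by (rule mult_le_mono1)
  then have "k = 1 \<or> k = 2 \<or> k = 3" using assms(2-4) by linarith
  ultimately show ?thesis using assms(3,4) by (elim disjE) simp_all
qed

text \<open>A multiple of \<open>p * q\<close> bounded by \<open>p * k\<close> and
  \<open>q * l\<close> forces \<open>q \<le> k\<close> and \<open>p \<le> l\<close>. With the
  finitely many types listed in \<open>K\<close>, the hypotheses become finite checks.\<close>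

lemma small_type_labels:
  fixes g :: "nat \<Rightarrow> nat \<Rightarrow> nat"
  assumes n: "n \<le> 7"
    and K: "\<And>p k. (p, k) \<in> {(2, 1), (2, 2), (2, 3), (3, 1), (3, 2), (5, 1), (7, 1)} \<Longrightarrow> p * k \<le> n \<Longrightarrow> (p, k) \<in> K"
    and K': "\<And>p k. (p, k) \<in> K \<Longrightarrow> prime p \<and> k \<ge> 1 \<and> p * k \<le> n"
    and com: "\<And>p k q l. (p, k) \<in> K \<Longrightarrow> (q, l) \<in> K \<Longrightarrow> p < q \<Longrightarrow>
      p * k + q * l \<le> n \<or> q \<le> k \<and> p \<le> l \<Longrightarrow> g p k = g q l"
    and con: "\<And>p k q l. (p, k) \<in> K \<Longrightarrow> (q, l) \<in> K \<Longrightarrow> g p k = g q l \<Longrightarrow> tconn n (prime_type n p k) (prime_type n q l)"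
  shows "c0_type n = card ((\<lambda>(p, k). g p k) ` K)"
proof -
  have Kin: "(p, k) \<in> K" if "prime p" "k \<ge> 1" "p * k \<le> n" for p k
    using small_prime_types[OF that n] K that(3) by blast
  have "c0_type n = card {g p k |p k. prime p \<and> k \<ge> 1 \<and> p * k \<le> n}"
  proof (rule c0_type_labels)
    fix p k q l :: nat
    assume a: "prime p" "prime q" "p < q" "k \<ge> 1" "l \<ge> 1" "p * k \<le> n" "q * l \<le> n"
      and r: "p * k + q * l \<le> n \<or> (\<exists>m>0. p * q dvd m \<and> m \<le> p * k \<and> m \<le> q * l)"
    have "p * k + q * l \<le> n \<or> q \<le> k \<and> p \<le> l"
    proof (cases "p * k + q * l \<le> n")
      case False
      then obtain m where "m > 0" "p * q dvd m" "m \<le> p * k" "m \<le> q * l" using r by blast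
      then have "p * q \<le> p * k" "p * q \<le> q * l" using dvd_imp_le le_trans by blast+
      then have "p * q \<le> p * k" "q * p \<le> q * l" by (simp_all only: mult.commute[of q p])
      then show ?thesis using prime_gt_0_nat[OF a(1)] prime_gt_0_nat[OF a(2)] by simp
    qed simp
    then show "g p k = g q l" using com Kin a by blast
  next
    fix p k q l :: nat
    assume "prime p" "prime q" "k \<ge> 1" "l \<ge> 1" "p * k \<le> n" "q * l \<le> n" "g p k = g q l"
    then show "tconn n (prime_type n p k) (prime_type n q l)" using con Kin by blast
  qed
  also have "{g p k |p k. prime p \<and> k \<ge> 1 \<and> p * k \<le> n} = (\<lambda>(p, k). g p k) ` K"
    using Kin K' by (auto simp: image_iff) (metis case_prod_conv)+
  finally show ?thesis .
qed

lemma c0_type_small: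
  "c0_type 2 = 1" "c0_type 3 = 2" "c0_type 4 = 3" "c0_type 5 = 3" "c0_type 6 = 4" "c0_type 7 = 3"
proof -
  \<comment> \<open>Up to degree 4 no two prime types are connected, and the number
    \<open>p * k\<close> of moved points tells them apart.\<close>
  have "c0_type 2 = card ((\<lambda>(p, k). p * k) ` {(2::nat, 1::nat)})"
    by (rule small_type_labels) auto
  then show "c0_type 2 = 1" by simp
  have "c0_type 3 = card ((\<lambda>(p, k). p * k) ` {(2::nat, 1::nat), (3, 1)})"
    by (rule small_type_labels) auto
  then show "c0_type 3 = 2" by simp
  have "c0_type 4 = card ((\<lambda>(p, k). p * k) ` {(2::nat, 1::nat), (2, 2), (3, 1)})"
    by (rule small_type_labels) auto
  then show "c0_type 4 = 3" by simp
  have p: "prime (2::nat)" "prime (3::nat)" "prime (5::nat)" by simp_all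
  \<comment> \<open>The value 2 is shared by the types of a transposition and a 3-cycle, which have
    the common root \<open>[3, 2]\<close>.\<close>
  define g5 where "g5 p k = (if p * k = 3 then 2 else p * k)" for p k :: nat
  have t5: "tconn 5 (prime_type 5 2 1) (prime_type 5 3 1)"
    using tconn_disjoint[OF p(1,2), of 1 1 5] by simp
  have "c0_type 5 = card ((\<lambda>(p, k). g5 p k) ` {(2::nat, 1::nat), (2, 2), (3, 1), (5, 1)})"
    by (rule small_type_labels) (auto simp: g5_def t5 tconn_sym[OF t5] simp del: One_nat_def)
  then show "c0_type 5 = 3" by (simp add: g5_def card_insert_if)
  \<comment> \<open>The formula of degree 5 still works: the value 6 is common to
    \<open>[2, 2, 2]\<close> and \<open>[3, 3]\<close>, which are joined.\<close>
  define g6 where "g6 p k = (if p * k = 3 then 2 else p * k)" for p k :: nat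
  have t6: "tconn 6 (prime_type 6 2 1) (prime_type 6 3 1)" "tconn 6 (prime_type 6 3 2) (prime_type 6 2 3)"
    using tconn_disjoint[OF p(1,2), of 1 1 6] tconn_swap[OF p(2), of 2 6] by simp_all
  have "c0_type 6 = card ((\<lambda>(p, k). g6 p k) ` {(2::nat, 1::nat), (2, 2), (2, 3), (3, 1), (3, 2), (5, 1)})"
    by (rule small_type_labels) (auto simp: g6_def t6 tconn_sym[OF t6(1)] tconn_sym[OF t6(2)] simp del: One_nat_def)
  then show "c0_type 6 = 4" by (simp add: g6_def card_insert_if)
  \<comment> \<open>With seven points \<open>[2, 2]\<close> fits beside a part 3 and a part 5 beside
    a part 2, so everything below six moved points is joined.\<close>
  define g7 where "g7 p k = (if p * k < 6 then 0 else p * k)" for p k :: nat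
  have t7: "tconn 7 (prime_type 7 3 1) (prime_type 7 2 1)" "tconn 7 (prime_type 7 2 2) (prime_type 7 3 1)"
      "tconn 7 (prime_type 7 5 1) (prime_type 7 2 1)" "tconn 7 (prime_type 7 3 2) (prime_type 7 2 3)"
    using tconn_disjoint[OF p(2,1), of 1 1 7] tconn_disjoint[OF p(1,2), of 2 1 7]
      tconn_disjoint[OF p(3,1), of 1 1 7] tconn_swap[OF p(2), of 2 7] by simp_all
  have b7: "tconn 7 (prime_type 7 p k) (prime_type 7 2 1)"
    if "(p, k) \<in> {(2, 1), (2, 2), (3, 1), (5, 1)}" for p k
    using that t7(1,3) conn_trans[OF t7(2,1)] by auto
  have "c0_type 7 = card ((\<lambda>(p, k). g7 p k) ` {(2::nat, 1::nat), (2, 2), (2, 3), (3, 1), (3, 2), (5, 1), (7, 1)})"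
  proof (rule small_type_labels)
    fix p k q l :: nat
    assume a: "(p, k) \<in> {(2, 1), (2, 2), (2, 3), (3, 1), (3, 2), (5, 1), (7, 1)}"
      "(q, l) \<in> {(2, 1), (2, 2), (2, 3), (3, 1), (3, 2), (5, 1), (7, 1)}" and eq: "g7 p k = g7 q l"
    show "tconn 7 (prime_type 7 p k) (prime_type 7 q l)"
    proof (cases "p * k < 6")
      case True
      then have "q * l < 6" using eq by (simp add: g7_def split: if_splits)
      then have "(p, k) \<in> {(2, 1), (2, 2), (3, 1), (5, 1)}" "(q, l) \<in> {(2, 1), (2, 2), (3, 1), (5, 1)}"
        using True a by auto
      then show ?thesis using b7 tconn_sym conn_trans by metis
    next
      case False
      then have "(p, k) \<in> {(2, 3), (3, 2), (7, 1)}" "(q, l) \<in> {(2, 3), (3, 2), (7, 1)}" "p * k = q * l"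
        using a eq by (auto simp: g7_def split: if_splits)
      then show ?thesis using t7(4) tconn_sym[OF t7(4)] by auto
    qed
  qed (auto simp: g7_def)
  then show "c0_type 7 = 3" by (simp add: g7_def card_insert_if)
qed

text \<open>The paths imitate those in the symmetric group on the level of cycle types, with the
  type of a transposition as centre.\<close>

lemma c0_type_large:
  assumes n: "n \<ge> 8"
  shows "c0_type n = Suc (card {p. prime p \<and> n \<le> p + 1 \<and> p \<le> n})"
proof -
  define g where "g p k = (if k = 1 \<and> n \<le> p + 1 then p else 0)" for p k :: nat
  let ?P = "{p. prime p \<and> n \<le> p + 1 \<and> p \<le> n}"
  have odd: "tconn n (prime_type n p k) (prime_type n 2 1)"
    if "prime p" "p \<noteq> 2" "k \<ge> 1" "p * k + 2 \<le> n" for p k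
    using tconn_disjoint[of p 2 k 1 n] that by simp
  have even: "tconn n (prime_type n 2 k) (prime_type n 2 1)" if k: "k \<ge> 1" "2 * k \<le> n" for k
  proof (cases "k \<ge> 3")
    case True
    then show ?thesis using conn_trans[OF tconn_triple[OF True k(2)] odd[of 3 2]] n by simp
  next
    case False
    then have "tconn n (prime_type n 2 k) (prime_type n 3 1)"
      using k n by (intro tconn_disjoint) auto
    then show ?thesis using conn_trans[OF _ odd[of 3 1]] n by simp
  qed
  have base: "tconn n (prime_type n p k) (prime_type n 2 1)"
    if p: "prime p" and k: "k \<ge> 1" "p * k \<le> n" and g: "g p k = 0" for p k
  proof (cases "p = 2")
    case True
    then show ?thesis using even k by simp
  next
    case p2: False
    show ?thesis
    proof (cases "p * k + 2 \<le> n")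
      case True
      then show ?thesis using odd p p2 k by blast
    next
      case False
      \<comment> \<open>For \<open>k = 1\<close> the failure of \<open>p * k + 2 \<le> n\<close>
        means \<open>n \<le> p + 1\<close>, and then the label would be \<open>p\<close> instead of
        0.\<close>
      have "k \<noteq> 1" using g False prime_gt_0_nat[OF p] by (auto simp: g_def split: if_splits)
      then have k2: "k \<ge> 2" using k(1) by simp
      have "p * 2 \<le> p * k" using k2 by (rule mult_le_mono2)
      then have "2 * p \<le> n" using k(2) by linarith
      then have "tconn n (prime_type n 2 p) (prime_type n 2 1)"
        using even prime_gt_0_nat[OF p] by simp
      then show ?thesis using tconn_swap[OF p p2 k2 k(2)] by (rule conn_trans[rotated])
    qed
  qed
  have "c0_type n = card {g p k |p k. prime p \<and> k \<ge> 1 \<and> p * k \<le> n}"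
  proof (rule c0_type_labels)
    fix p k q l :: nat
    assume a: "prime p" "prime q" "p < q" "k \<ge> 1" "l \<ge> 1" "p * k \<le> n" "q * l \<le> n"
      and r: "p * k + q * l \<le> n \<or> (\<exists>m>0. p * q dvd m \<and> m \<le> p * k \<and> m \<le> q * l)"
    have p2: "p \<ge> 2" using a(1) by (rule prime_ge_2_nat)
    \<comment> \<open>For \<open>q \<ge> n - 1\<close> neither alternative is possible: side by side
      the parts need at least \<open>q + 2\<close> points, and a shared part has size at least
      \<open>2 * q\<close>, which exceeds \<open>n\<close>.\<close>
    have "q + 1 < n"
    proof (rule ccontr)
      assume "\<not> q + 1 < n"
      then have q: "n \<le> q + 1" by simp
      have "p * k \<ge> 2" using p2 a(4) mult_le_mono[of 2 p 1 k] by simp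
      moreover have "q * l \<ge> q" using a(5) by simp
      ultimately have "\<not> p * k + q * l \<le> n" using q by linarith
      then obtain m where m: "m > 0" "p * q dvd m" "m \<le> q * l" using r by blast
      have "p * q \<le> m" using m by (simp add: dvd_imp_le)
      moreover have "2 * q \<le> p * q" using p2 by (rule mult_le_mono1)
      ultimately show False using m(3) a(7) q n by linarith
    qed
    then show "g p k = g q l" using a(3) by (simp add: g_def)
  next
    fix p k q l :: nat
    assume a: "prime p" "prime q" "k \<ge> 1" "l \<ge> 1" "p * k \<le> n" "q * l \<le> n" and eq: "g p k = g q l"
    show "tconn n (prime_type n p k) (prime_type n q l)"
    proof (cases "g p k = 0")
      case True
      then show ?thesis using base[of p k] base[of q l] a eq by (auto intro: conn_trans tconn_sym)
    next
      case False
      then have "p = q" "k = l" using eq by (auto simp: g_def split: if_splits)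
      then show ?thesis by simp
    qed
  qed
  also have "{g p k |p k. prime p \<and> k \<ge> 1 \<and> p * k \<le> n} = insert 0 ?P" (is "?L = ?R")
  proof (intro equalityI subsetI)
    fix l assume "l \<in> ?L"
    then show "l \<in> ?R" by (auto simp: g_def split: if_splits)
  next
    fix l assume l: "l \<in> ?R"
    show "l \<in> ?L"
    proof (cases "l = 0")
      case True
      then show ?thesis using n by (intro CollectI exI[of _ 2] exI[of _ 1]) (simp add: g_def)
    next
      case False
      then show ?thesis using l by (intro CollectI exI[of _ l] exI[of _ 1]) (simp add: g_def)
    qed
  qed
  also have "card (insert 0 ?P) = Suc (card ?P)"
  proof (rule card_insert_disjoint)
    show "finite ?P" by (rule finite_subset[of _ "{..n}"]) auto
  qed simp
  finally show ?thesis .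
qed

theorem theoremB:
  shows "(\<forall>n::nat. c0 (sym_group n) = c0_tilde (sym_group n))
   \<and> (c0 (sym_group 2) = 1 \<and> c0 (sym_group 3) = 4 \<and> c0 (sym_group 4) = 13 \<and>
      c0 (sym_group 5) = 31 \<and> c0 (sym_group 6) = 83 \<and> c0 (sym_group 7) = 128)
   \<and> (c0_type 2 = 1 \<and> c0_type 3 = 2 \<and> c0_type 4 = 3 \<and>
      c0_type 5 = 3 \<and> c0_type 6 = 4 \<and> c0_type 7 = 3)
   \<and> (c0_order (sym_group 2) = 1 \<and> c0_order (sym_group 3) = 2 \<and> c0_order (sym_group 4) = 2 \<and>
      c0_order (sym_group 5) = 2 \<and> c0_order (sym_group 6) = 2 \<and> c0_order (sym_group 7) = 2)
   \<and> (\<forall>n::nat. n \<ge> 8 \<longrightarrow>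
        (prime n \<longrightarrow> c0 (sym_group n) = fact (n - 2) + 1 \<and>
            c0_type n = 2 \<and> c0_order (sym_group n) = 2)
      \<and> (prime (n - 1) \<longrightarrow> c0 (sym_group n) = n * fact (n - 3) + 1 \<and>
            c0_type n = 2 \<and> c0_order (sym_group n) = 2)
      \<and> (\<not> prime n \<and> \<not> prime (n - 1) \<longrightarrow> c0 (sym_group n) = 1 \<and>
            c0_type n = 1 \<and> c0_order (sym_group n) = 1))"
proof -
  have tilde: "c0 (sym_group n) = c0_tilde (sym_group n)" for n
    using group.c0_tilde_eq_c0[OF sym_group_is_group finite_sym_group] by simp
  have ord: "c0_order (sym_group 4) = 2" "c0_order (sym_group 5) = 2" "c0_order (sym_group 6) = 2"
    "c0_order (sym_group 7) = 2"
    by (rule c0_order_sym_group_values(3); simp)+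
  have large: "(prime n \<longrightarrow> c0 (sym_group n) = fact (n - 2) + 1 \<and>
            c0_type n = 2 \<and> c0_order (sym_group n) = 2)
      \<and> (prime (n - 1) \<longrightarrow> c0 (sym_group n) = n * fact (n - 3) + 1 \<and>
            c0_type n = 2 \<and> c0_order (sym_group n) = 2)
      \<and> (\<not> prime n \<and> \<not> prime (n - 1) \<longrightarrow> c0 (sym_group n) = 1 \<and>
            c0_type n = 1 \<and> c0_order (sym_group n) = 1)" if n: "n \<ge> 8" for n
  proof -
    have n4: "n \<ge> 4" using n by simp
    show ?thesis
      using c0_sym_group_large[OF n] c0_type_large[OF n] large_primes[OF n4]
        c0_order_sym_group_values(3,4)[OF n4] by simp
  qed
  show ?thesis
    using tilde c0_sym_group_2 c0_sym_group_3 c0_sym_group_4 c0_sym_group_5 c0_sym_group_6 c0_sym_group_7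
      c0_type_small c0_order_sym_group_values(1,2) ord large by blast
qed

end
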